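(* Let $(Q,\lhd)$ be a quandle, $R$ a commutative ring, $A$ an $R$-module, and $\alpha\in R^*$ a unit. Suppose that for some $c_1,\ldots,c_k\in Q$ and $\varepsilon_1,\ldots,\varepsilon_k\in\{\pm1\}$, the relation $$(\cdots(a\lhd^{\varepsilon_1}c_1)\lhd^{\varepsilon_2}\cdots)\lhd^{\varepsilon_k}c_k=a$$ holds for all $a\in Q$, where $\lhd^{+1}=\lhd$ and $\lhd^{-1}=\widetilde{\lhd}$. Then multiplication by $\alpha^{\sum_{i=1}^k\varepsilon_i}-1$ annihilates all $\alpha$-twisted weights: for every $\alpha$-twisted quandle $2$-cocycle $\omega\colon Q\times Q\to A$ and every $Q$-colored knot diagram $(D,\mathcal{C})$, one has $(\alpha^{\sum_{i=1}^k\varepsilon_i}-1)\,\mathcal{W}^{tw}_\omega(D,\mathcal{C},\alpha)=0$.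
   Context: Quandle: a set $Q$ with operations $\lhd,\widetilde{\lhd}$ such that $(a\lhd b)\lhd c=(a\lhd c)\lhd(b\lhd c)$, $(a\lhd b)\,\widetilde{\lhd}\,b=(a\,\widetilde{\lhd}\,b)\lhd b=a$, $a\lhd a=a$ for all $a,b,c\in Q$. Knots: "knot" means oriented knot or link in $\mathbb{R}^3$; a knot diagram $D$ is a diagram in $\mathbb{R}^2$ of such a link. Arcs run from undercrossing to undercrossing (or are closed curves). Regions are the connected components of $\mathbb{R}^2\setminus D$; $\Delta_{ex}(D)$ is the exterior (unbounded) region. Left and right of an oriented arc are as seen when travelling along it. A $Q$-coloring $\mathcal{C}$ of $D$ assigns an element of $Q$ to each arc such that at each crossing, if the over-arc has color $b$ and the under-arc on the right of the over-arc has color $a$, then the under-arc on the left of the over-arc has color $a\lhd b$. A $Q$-colored diagram is a pair $(D,\mathcal{C})$. The index $i(\Delta)$ of a region $\Delta$ is the algebraic intersection number of $D$ with a path from $\Delta$ to $\Delta_{ex}(D)$ (finitely many simple transverse intersections), where a crossing of the path over $D$ from the left side to the right side of the oriented $D$ counts $+1$ and from right to left counts $-1$. The source region $\Delta(x)$ of a crossing $x$ is the one of the four regions at $x$ lying on the right of both strands. Put $i(x)=i(\Delta(x))$. The $\alpha$-twisted $\omega$-weight is $\mathcal{W}^{tw}_\omega(D,\mathcal{C},\alpha)=\sum_x\varepsilon(x)\alpha^{-i(x)}\omega(a_x,b_x)$, summed over all crossings, where $\varepsilon(x)=\pm1$ is the usual sign, $b_x$ is the color of the over-arc and $a_x$ the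 color of the under-arc lying on the right of the over-arc. An $\alpha$-twisted quandle $2$-cocycle is a map $\omega\colon Q\times Q\to A$ with $\omega(a,a)=0$ and $\omega(a\lhd c,b\lhd c)-\alpha\omega(a,b)-\omega(a\lhd b,c)+\alpha\omega(a,c)+(1-\alpha)\omega(b,c)=0$ for all $a,b,c$. *)

theory Defs
  imports "HOL-Analysis.Analysis"
begin

section \<open>Algebra\<close>

locale quandle =
  fixes tri :: "'q \<Rightarrow> 'q \<Rightarrow> 'q"  (infixl "\<lhd>" 70)
    and tri_inv :: "'q \<Rightarrow> 'q \<Rightarrow> 'q"  (infixl "\<unlhd>" 70)
  assumes self_distrib: "(a \<lhd> b) \<lhd> c = (a \<lhd> c) \<lhd> (b \<lhd> c)"
    and tri_tri_inv: "(a \<lhd> b) \<unlhd> b = a"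
    and tri_inv_tri: "(a \<unlhd> b) \<lhd> b = a"
    and idem: "a \<lhd> a = a"

definition tri_pow :: "('q \<Rightarrow> 'q \<Rightarrow> 'q) \<Rightarrow> ('q \<Rightarrow> 'q \<Rightarrow> 'q) \<Rightarrow> int \<Rightarrow> 'q \<Rightarrow> 'q \<Rightarrow> 'q" where
  "tri_pow tri tri_inv e a c = (if e = 1 then tri a c else tri_inv a c)"

text \<open>Integer powers of a unit of a commutative ring (meaningful only if \<open>\<alpha> dvd 1\<close>;
  the inverse is then unique).\<close>
definition unit_pow :: "'r::comm_ring_1 \<Rightarrow> int \<Rightarrow> 'r" where
  "unit_pow \<alpha> n = (if n \<ge> 0 then \<alpha> ^ nat n else (THE \<beta>. \<alpha> * \<beta> = 1) ^ nat (- n))"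

definition twisted_cocycle ::
  "('q \<Rightarrow> 'q \<Rightarrow> 'q) \<Rightarrow> ('r::comm_ring_1 \<Rightarrow> 'm::ab_group_add \<Rightarrow> 'm) \<Rightarrow> 'r \<Rightarrow> ('q \<times> 'q \<Rightarrow> 'm) \<Rightarrow> bool" where
  "twisted_cocycle tri smul \<alpha> \<omega> \<longleftrightarrow>
     (\<forall>a. \<omega> (a, a) = 0) \<and>
     (\<forall>a b c. \<omega> (tri a c, tri b c) - smul \<alpha> (\<omega> (a, b)) - \<omega> (tri a b, c)
               + smul \<alpha> (\<omega> (a, c)) + smul (1 - \<alpha>) (\<omega> (b, c)) = 0)"


section \<open>Oriented links and their diagrams\<close>

text \<open>
  An oriented link in \<open>\<real>\<^sup>3 = \<complex> \<times> \<real>\<close> is given by a nonempty list of \<open>C\<^sup>1\<close> closed curves, each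
  parametrised with period 1 over the whole real line and oriented by its parametrisation. Its
  diagram is the projection to \<open>\<complex>\<close>, with over/under information read off the last coordinate.
\<close>
type_synonym link = "(real \<Rightarrow> complex \<times> real) list"

text \<open>A parameter point \<open>(j, t)\<close> is a point of the \<open>j\<close>-th source circle.\<close>
definition params :: "link \<Rightarrow> (nat \<times> real) set" where
  "params L = {(j, t). j < length L \<and> 0 \<le> t \<and> t < 1}"

definition space_point :: "link \<Rightarrow> nat \<times> real \<Rightarrow> complex \<times> real" where
  "space_point L p = (L ! fst p) (snd p)"

definition proj :: "link \<Rightarrow> nat \<times> real \<Rightarrow> complex" where
  "proj L p = fst (space_point L p)"

definition height :: "link \<Rightarrow> nat \<times> real \<Rightarrow> real" where
  "height L p = snd (space_point L p)"

definition tangent :: "link \<Rightarrow> nat \<times> real \<Rightarrow> complex" where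
  "tangent L p = vector_derivative (\<lambda>t. fst ((L ! fst p) t)) (at (snd p))"

text \<open>Planar determinant: \<open>det2 u v > 0\<close> iff \<open>v\<close> points to the left of the oriented direction \<open>u\<close>.\<close>
definition det2 :: "complex \<Rightarrow> complex \<Rightarrow> real" where
  "det2 u v = Re u * Im v - Im u * Re v"

definition oriented_link :: "link \<Rightarrow> bool" where
  "oriented_link L \<longleftrightarrow>
     L \<noteq> [] \<and>
     (\<forall>\<gamma>\<in>set L. \<gamma> C1_differentiable_on UNIV \<and> (\<forall>t. \<gamma> (t + 1) = \<gamma> t)) \<and>
     inj_on (space_point L) (params L)"

text \<open>The pairs (over, under) of parameter points.\<close>
definition crossings :: "link \<Rightarrow> ((nat \<times> real) \<times> (nat \<times> real)) set" where
  "crossings L = {(p, q). p \<in> params L \<and> q \<in> params L \<and> proj L p = proj L q \<and> height L q < height L p}"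

text \<open>The projection is an immersion whose only singularities are finitely many transverse
  double points.\<close>
definition knot_diagram :: "link \<Rightarrow> bool" where
  "knot_diagram L \<longleftrightarrow>
     oriented_link L \<and>
     (\<forall>p\<in>params L. tangent L p \<noteq> 0) \<and>
     finite (crossings L) \<and>
     (\<forall>p\<in>params L. \<forall>q\<in>params L. p \<noteq> q \<and> proj L p = proj L q \<longrightarrow> det2 (tangent L p) (tangent L q) \<noteq> 0) \<and>
     (\<forall>p\<in>params L. \<forall>q\<in>params L. \<forall>r\<in>params L.
        proj L p = proj L q \<and> proj L q = proj L r \<longrightarrow> p = q \<or> q = r \<or> p = r)"

definition crossing_sign :: "link \<Rightarrow> (nat \<times> real) \<times> (nat \<times> real) \<Rightarrow> int" where
  "crossing_sign L x = (if det2 (tangent L (fst x)) (tangent L (snd x)) > 0 then 1 else -1)"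


section \<open>Arcs and colorings\<close>

text \<open>
  Arcs are represented by their lifts to space: the connected components of the link after
  removal of the undercrossing points. In space the link does not meet itself, so that passing
  over another strand does not interrupt an arc; a component without undercrossings is a
  single closed arc.
\<close>
definition cut_link :: "link \<Rightarrow> (complex \<times> real) set" where
  "cut_link L = space_point L ` params L - (\<lambda>x. space_point L (snd x)) ` crossings L"

definition arcs :: "link \<Rightarrow> (complex \<times> real) set set" where
  "arcs L = components (cut_link L)"

definition over_arc :: "link \<Rightarrow> (nat \<times> real) \<times> (nat \<times> real) \<Rightarrow> (complex \<times> real) set" where
  "over_arc L x = (THE A. A \<in> arcs L \<and> space_point L (fst x) \<in> A)"

definition under_arc_in :: "link \<Rightarrow> (nat \<times> real) \<times> (nat \<times> real) \<Rightarrow> (complex \<times> real) set" where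
  "under_arc_in L x = (THE A. A \<in> arcs L \<and>
     (\<forall>\<^sub>F t in at_left (snd (snd x)). (L ! fst (snd x)) t \<in> A))"

definition under_arc_out :: "link \<Rightarrow> (nat \<times> real) \<times> (nat \<times> real) \<Rightarrow> (complex \<times> real) set" where
  "under_arc_out L x = (THE A. A \<in> arcs L \<and>
     (\<forall>\<^sub>F t in at_right (snd (snd x)). (L ! fst (snd x)) t \<in> A))"

text \<open>If the under-strand runs from the right to the left of the over-strand, the incoming
  under-arc is the one on the right of the over-arc.\<close>
definition under_arc_right :: "link \<Rightarrow> (nat \<times> real) \<times> (nat \<times> real) \<Rightarrow> (complex \<times> real) set" where
  "under_arc_right L x =
     (if det2 (tangent L (fst x)) (tangent L (snd x)) > 0 then under_arc_in L x else under_arc_out L x)"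

definition under_arc_left :: "link \<Rightarrow> (nat \<times> real) \<times> (nat \<times> real) \<Rightarrow> (complex \<times> real) set" where
  "under_arc_left L x =
     (if det2 (tangent L (fst x)) (tangent L (snd x)) > 0 then under_arc_out L x else under_arc_in L x)"

text \<open>The values of \<open>C\<close> on sets that are not arcs are irrelevant.\<close>
definition coloring :: "('q \<Rightarrow> 'q \<Rightarrow> 'q) \<Rightarrow> link \<Rightarrow> ((complex \<times> real) set \<Rightarrow> 'q) \<Rightarrow> bool" where
  "coloring tri L C \<longleftrightarrow>
     (\<forall>x\<in>crossings L. C (under_arc_left L x) = tri (C (under_arc_right L x)) (C (over_arc L x)))"


section \<open>Regions and indices\<close>

definition diagram_image :: "link \<Rightarrow> complex set" where
  "diagram_image L = proj L ` params L"

definition regions :: "link \<Rightarrow> complex set set" where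
  "regions L = components (- diagram_image L)"

definition exterior_region :: "link \<Rightarrow> complex set" where
  "exterior_region L = (THE \<Delta>. \<Delta> \<in> regions L \<and> \<not> bounded \<Delta>)"

definition hits :: "link \<Rightarrow> (real \<Rightarrow> complex) \<Rightarrow> (real \<times> (nat \<times> real)) set" where
  "hits L g = {(s, p). s \<in> {0..1} \<and> p \<in> params L \<and> g s = proj L p}"

text \<open>Paths between the regions that meet the diagram in finitely many simple (i.e. noncrossing)
  points, transversely.\<close>
definition transverse_path :: "link \<Rightarrow> complex set \<Rightarrow> complex set \<Rightarrow> (real \<Rightarrow> complex) \<Rightarrow> bool" where
  "transverse_path L \<Delta> \<Delta>' g \<longleftrightarrow>
     path g \<and> pathstart g \<in> \<Delta> \<and> pathfinish g \<in> \<Delta>' \<and>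
     finite (hits L g) \<and>
     (\<forall>(s, p)\<in>hits L g.
        (\<forall>q\<in>params L. proj L q = proj L p \<longrightarrow> q = p) \<and>
        g differentiable (at s) \<and>
        det2 (tangent L p) (vector_derivative g (at s)) \<noteq> 0)"

text \<open>Crossing the diagram from its left to its right side counts \<open>+1\<close>.\<close>
definition intersection_number :: "link \<Rightarrow> (real \<Rightarrow> complex) \<Rightarrow> int" where
  "intersection_number L g =
     (\<Sum>(s, p)\<in>hits L g. if det2 (tangent L p) (vector_derivative g (at s)) < 0 then 1 else -1)"

definition region_index :: "link \<Rightarrow> complex set \<Rightarrow> int" where
  "region_index L \<Delta> =
     (THE i. \<exists>g. transverse_path L \<Delta> (exterior_region L) g \<and> i = intersection_number L g)"

text \<open>The region containing, close to the crossing, all rays that leave the crossing to the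
  right of both strands.\<close>
definition source_region :: "link \<Rightarrow> (nat \<times> real) \<times> (nat \<times> real) \<Rightarrow> complex set" where
  "source_region L x = (THE \<Delta>. \<Delta> \<in> regions L \<and>
     (\<forall>d. det2 (tangent L (fst x)) d < 0 \<and> det2 (tangent L (snd x)) d < 0 \<longrightarrow>
        (\<forall>\<^sub>F r in at_right 0. proj L (fst x) + of_real r * d \<in> \<Delta>)))"

definition crossing_index :: "link \<Rightarrow> (nat \<times> real) \<times> (nat \<times> real) \<Rightarrow> int" where
  "crossing_index L x = region_index L (source_region L x)"


section \<open>Twisted weights\<close>

definition twisted_weight ::
  "('r::comm_ring_1 \<Rightarrow> 'm::ab_group_add \<Rightarrow> 'm) \<Rightarrow> ('q \<times> 'q \<Rightarrow> 'm) \<Rightarrow> link \<Rightarrow> ((complex \<times> real) set \<Rightarrow> 'q) \<Rightarrow> 'r \<Rightarrow> 'm" where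
  "twisted_weight smul \<omega> L C \<alpha> =
     (\<Sum>x\<in>crossings L. smul (of_int (crossing_sign L x) * unit_pow \<alpha> (- crossing_index L x))
        (\<omega> (C (under_arc_right L x), C (over_arc L x))))"

end

(*
  The index of a region is the winding number of the diagram about its points. Colouring by
  C' = C \<lhd> c multiplies every local contribution by \<alpha>, up to an error which the cocycle
  condition expresses through \<omega>(_, c) alone. Let K(t) be the winding number just to the right of
  the diagram at the parameter t, and f(t) = \<alpha>^(-K(t)) \<omega>(C(arc at t), c). The function f is
  locally constant along the strands except at the crossings, and the error at a crossing is,
  up to the factor \<alpha>, the sum of the jumps of f at its over- and undercrossing. The jumps
  along a closed curve sum to 0, so W(C \<lhd> c) = \<alpha> W(C), whence W(C \<lhd>~ c) = \<alpha>^(-1) W(C).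
  Iterating over c_1, ..., c_k, which fixes C by hypothesis, gives W(C) = \<alpha>^(\<Sum> \<epsilon>_i) W(C).
*)
theory Submission
  imports Defs "HOL-Complex_Analysis.Complex_Analysis"
begin

text \<open>The indices are definite descriptions over paths and regions, whereas the jumps of f
  live on the diagram itself, where the winding number has no meaning. The bridge is a local picture
  at each point p of the plane: off the diagram and near p, the winding number is a constant
  \<open>base p\<close> plus the number of strands through p that have the point on their left. This
  \<open>base p\<close> serves as K, at simple points and crossings alike. The curves are only C^1,
  so the picture is derived from the Cauchy integral over short arcs. Along a strand,
  \<open>base\<close> changes only by the other strand of a crossing, which adds 1 to it on its
  left. If i is the index of the crossing, both strands therefore see just the two factors
  \<alpha>^(-i) and \<alpha>^(-i-1). After multiplication by \<alpha>, the under-strand supplies the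
  terms with \<omega>(a \<lhd> b, c) and \<omega>(a, c) of the cocycle condition, and the
  over-strand, whose arc does not change, the term with (1 - \<alpha>) \<omega>(b, c). The values
  lie in a module without topology, so one-sided limits are eventual values.\<close>

section \<open>Jumps of locally constant functions\<close>

text \<open>The identity is additive under subdivision, so bisection reduces it to short intervals
  around one point \<open>x\<close>, where \<open>f\<close> is \<open>l x\<close> on the left and
  \<open>r x\<close> on the right. The eventual values \<open>l\<close> and \<open>r\<close> stand
  in for one-sided limits.\<close>

lemma jump_sum_interval:
  fixes f l r :: "real \<Rightarrow> 'm::ab_group_add"
  assumes "a < b" "finite S"
    and left: "\<And>x. a < x \<Longrightarrow> x \<le> b \<Longrightarrow> \<forall>\<^sub>F y in at_left x. f y = l x"
    and right: "\<And>x. a \<le> x \<Longrightarrow> x < b \<Longrightarrow> \<forall>\<^sub>F y in at_right x. f y = r x"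
    and cont: "\<And>x. a < x \<Longrightarrow> x < b \<Longrightarrow> x \<notin> S \<Longrightarrow> l x = f x \<and> r x = f x"
  shows "l b - r a = (\<Sum>x\<in>S \<inter> {a<..<b}. r x - l x)"
proof -
  have cont': "l x = r x" if "a < x" "x < b" "x \<notin> S" for x
    using cont[OF that] by simp
  \<comment> \<open>\<open>Bolzano\<close> also tests intervals that are degenerate or leave
    \<open>{a..b}\<close>; the guard makes \<open>P\<close> hold there trivially.\<close>
  define P where "P c d \<longleftrightarrow> (a \<le> c \<and> c < d \<and> d \<le> b \<longrightarrow>
    l d - r c = (\<Sum>x\<in>S \<inter> {c<..<d}. r x - l x))" for c d
  have "P a b"
  proof (rule Bolzano)
    show "a \<le> b" using \<open>a < b\<close> by simp
  next
    fix c d e assume P: "P c d" "P d e" "c \<le> d" "d \<le> e"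
    show "P c e"
    proof (cases "c = d \<or> d = e")
      case True then show ?thesis using P by auto
    next
      case False
      then have cd: "c < d" "d < e" using P by auto
      show ?thesis unfolding P_def
      proof
        assume ce: "a \<le> c \<and> c < e \<and> e \<le> b"
        have "(\<Sum>x\<in>S \<inter> {c<..<e}. r x - l x)
          = (\<Sum>x\<in>(S \<inter> {c<..<d}) \<union> (S \<inter> {d<..<e}) \<union> (S \<inter> {d}). r x - l x)"
          using cd by (intro sum.cong) auto
        also have "\<dots> = (\<Sum>x\<in>S \<inter> {c<..<d}. r x - l x) + (\<Sum>x\<in>S \<inter> {d<..<e}. r x - l x)
            + (\<Sum>x\<in>S \<inter> {d}. r x - l x)"
          using \<open>finite S\<close> by (subst sum.union_disjoint, auto)+
        also have "(\<Sum>x\<in>S \<inter> {d}. r x - l x) = r d - l d"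
          using cont'[of d] cd ce by (cases "d \<in> S") auto
        finally show "l e - r c = (\<Sum>x\<in>S \<inter> {c<..<e}. r x - l x)"
          using P(1,2) cd ce unfolding P_def by (simp add: algebra_simps)
      qed
    qed
  next
    fix x assume x: "a \<le> x" "x \<le> b"
    obtain d1 where d1: "d1 > 0" "a < x \<Longrightarrow> x - d1 < y \<Longrightarrow> y < x \<Longrightarrow> f y = l x" for y
    proof (cases "a < x")
      case True
      then obtain c where "c < x" "\<And>y. c < y \<Longrightarrow> y < x \<Longrightarrow> f y = l x"
        using left[of x] x unfolding eventually_at_left_field by blast
      then show ?thesis using that[of "x - c"] by auto
    qed (use that[of 1] in auto)
    obtain d2 where d2: "d2 > 0" "x < b \<Longrightarrow> x < y \<Longrightarrow> y < x + d2 \<Longrightarrow> f y = r x" for y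
    proof (cases "x < b")
      case True
      then obtain c where "x < c" "\<And>y. x < y \<Longrightarrow> y < c \<Longrightarrow> f y = r x"
        using right[of x] x unfolding eventually_at_right_field by blast
      then show ?thesis using that[of "c - x"] by auto
    qed (use that[of 1] in auto)
    \<comment> \<open>Next to \<open>x\<close> the function is constant on each side, so the
      eventual values at all other points of the interval agree with it and only \<open>x\<close>
      can contribute a jump.\<close>
    have L: "l y = l x" if "a < x" "x - d1 < y" "y < x" "a < y" for y
    proof -
      have "\<forall>\<^sub>F z in at_left y. f z = l x \<and> f z = l y"
        using left[of y] that x unfolding eventually_conj_iff
        by (auto simp: eventually_at_left_field intro!: exI[of _ "x - d1"] d1)
      then show ?thesis
        by (metis (mono_tags, lifting) eventually_happens trivial_limit_at_left_real)
    qed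
    have L': "r y = l x" if "a < x" "x - d1 < y" "y < x" "a \<le> y" for y
    proof -
      have "\<forall>\<^sub>F z in at_right y. f z = l x \<and> f z = r y"
        using right[of y] that x unfolding eventually_conj_iff
        by (auto simp: eventually_at_right_field intro!: exI[of _ "x"] d1)
      then show ?thesis
        by (metis (mono_tags, lifting) eventually_happens trivial_limit_at_right_real)
    qed
    have R: "r y = r x" if "x < b" "x < y" "y < x + d2" "y < b" for y
    proof -
      have "\<forall>\<^sub>F z in at_right y. f z = r x \<and> f z = r y"
        using right[of y] that x unfolding eventually_conj_iff
        by (auto simp: eventually_at_right_field intro!: exI[of _ "x + d2"] d2)
      then show ?thesis
        by (metis (mono_tags, lifting) eventually_happens trivial_limit_at_right_real)
    qed
    have R': "l y = r x" if "x < b" "x < y" "y < x + d2" "y \<le> b" for y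
    proof -
      have "\<forall>\<^sub>F z in at_left y. f z = r x \<and> f z = l y"
        using left[of y] that x unfolding eventually_conj_iff
        by (auto simp: eventually_at_left_field intro!: exI[of _ "x"] d2)
      then show ?thesis
        by (metis (mono_tags, lifting) eventually_happens trivial_limit_at_left_real)
    qed
    show "\<exists>d>0. \<forall>c e. c \<le> x \<and> x \<le> e \<and> e - c < d \<longrightarrow> P c e"
    proof (intro exI[of _ "min d1 d2"] conjI allI impI)
      show "0 < min d1 d2" using d1 d2 by simp
    next
      fix c e assume ce: "c \<le> x \<and> x \<le> e \<and> e - c < min d1 d2"
      show "P c e" unfolding P_def
      proof
        assume ace: "a \<le> c \<and> c < e \<and> e \<le> b"
        have zero: "r y - l y = 0" if "c < y" "y < e" "y \<noteq> x" for y
          using that ce ace L[of y] L'[of y] R[of y] R'[of y] by (cases "y < x") auto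
        have "(\<Sum>y\<in>S \<inter> {c<..<e}. r y - l y) = (\<Sum>y\<in>S \<inter> {c<..<e} \<inter> {x}. r y - l y)"
          by (rule sum.mono_neutral_right) (use \<open>finite S\<close> zero in auto)
        also have "\<dots> = l e - r c"
        proof (cases "c < x \<and> x < e")
          case True
          then have "l e = r x" "r c = l x" using L'[of c] R'[of e] ce ace by auto
          then show ?thesis using True cont'[of x] ace by (cases "x \<in> S") (auto simp: Int_absorb1)
        next
          case False
          then show ?thesis using L'[of c] R'[of e] ce ace by (cases "c = x") auto
        qed
        finally show "l e - r c = (\<Sum>x\<in>S \<inter> {c<..<e}. r x - l x)" by simp
      qed
    qed
  qed
  then show ?thesis using \<open>a < b\<close> unfolding P_def by simp
qed

section \<open>Winding numbers near an immersed curve\<close>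

locale immersed_curve =
  fixes \<gamma> \<gamma>' :: "real \<Rightarrow> complex"
  assumes deriv: "(\<gamma> has_vector_derivative \<gamma>' t) (at t)"
    and cont_deriv: "continuous_on UNIV \<gamma>'"
    and nonzero: "\<gamma>' t \<noteq> 0"
begin

lemma isCont_deriv: "isCont \<gamma>' t"
  using cont_deriv by (simp add: continuous_on_eq_continuous_at)

lemma isCont_curve: "isCont \<gamma> t"
  using deriv has_vector_derivative_continuous by blast

lemma continuous_on_curve: "continuous_on A \<gamma>"
  using isCont_curve continuous_at_imp_continuous_on by blast

text \<open>The mean value inequality for \<open>\<gamma> / \<gamma>' t0\<close> minus the identity,
  whose derivative is small near \<open>t0\<close> by continuity of \<open>\<gamma>'\<close>. The
  bound is uniform in both endpoints, which differentiability at \<open>t0\<close> alone would not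
  give.\<close>

lemma strictly_differentiable:
  assumes "\<kappa> > 0"
  obtains \<delta> where "\<delta> > 0"
    "\<And>t u. \<bar>t - t0\<bar> \<le> \<delta> \<Longrightarrow> \<bar>u - t0\<bar> \<le> \<delta> \<Longrightarrow>
       norm ((\<gamma> u - \<gamma> t) / \<gamma>' t0 - of_real (u - t)) \<le> \<kappa> * \<bar>u - t\<bar>"
proof -
  have "isCont (\<lambda>t. \<gamma>' t / \<gamma>' t0) t0"
    using isCont_deriv nonzero by (intro continuous_intros) auto
  then obtain \<delta>0 where \<delta>0: "\<delta>0 > 0" "\<And>t. dist t t0 < \<delta>0 \<Longrightarrow> dist (\<gamma>' t / \<gamma>' t0) (\<gamma>' t0 / \<gamma>' t0) < \<kappa>"
    using assms unfolding continuous_at_eps_delta by (metis dist_norm real_norm_def)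
  define \<delta> where "\<delta> = \<delta>0 / 2"
  have "\<delta> > 0" using \<delta>0 by (simp add: \<delta>_def)
  moreover have "norm ((\<gamma> u - \<gamma> t) / \<gamma>' t0 - of_real (u - t)) \<le> \<kappa> * \<bar>u - t\<bar>"
    if tu: "\<bar>t - t0\<bar> \<le> \<delta>" "\<bar>u - t0\<bar> \<le> \<delta>" for t u
  proof -
    define h where "h s = \<gamma> s / \<gamma>' t0 - of_real s" for s
    have "norm (h u - h t) \<le> \<kappa> * norm (u - t)"
    proof (rule differentiable_bound)
      show "convex {t0 - \<delta>..t0 + \<delta>}" by simp
      fix s assume s: "s \<in> {t0 - \<delta>..t0 + \<delta>}"
      have "(h has_vector_derivative (\<gamma>' s / \<gamma>' t0 - 1)) (at s within {t0 - \<delta>..t0 + \<delta>})"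
        unfolding h_def divide_inverse
        by (rule has_vector_derivative_at_within) (auto intro!: derivative_eq_intros deriv)
      then show "(h has_derivative (\<lambda>x. x *\<^sub>R (\<gamma>' s / \<gamma>' t0 - 1))) (at s within {t0 - \<delta>..t0 + \<delta>})"
        unfolding has_vector_derivative_def .
      have "dist s t0 < \<delta>0" using s \<delta>0 by (auto simp: \<delta>_def dist_real_def abs_if)
      from \<delta>0(2)[OF this] have "norm (\<gamma>' s / \<gamma>' t0 - 1) \<le> \<kappa>"
        using nonzero by (simp add: dist_norm)
      then show "onorm (\<lambda>x. x *\<^sub>R (\<gamma>' s / \<gamma>' t0 - 1)) \<le> \<kappa>"
        by (intro onorm_le) (metis mult.commute mult_right_mono norm_ge_zero norm_scaleR real_norm_def)
    qed (use tu in auto)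
    then show ?thesis by (simp add: h_def diff_divide_distrib algebra_simps)
  qed
  ultimately show ?thesis using that by blast
qed

text \<open>Short chords are nearly parallel to the tangent at \<open>t0\<close>. Division by
  \<open>\<gamma>' t0\<close> turns this tangent into the real axis.\<close>

lemma tangent_cone:
  assumes "\<eta> > 0"
  obtains \<delta> where "\<delta> > 0"
    "\<And>t u. \<bar>t - t0\<bar> \<le> \<delta> \<Longrightarrow> \<bar>u - t0\<bar> \<le> \<delta> \<Longrightarrow>
       \<bar>Im ((\<gamma> t - \<gamma> u) / \<gamma>' t0)\<bar> \<le> \<eta> * \<bar>Re ((\<gamma> t - \<gamma> u) / \<gamma>' t0)\<bar>"
proof -
  define v where "v = \<gamma>' t0"
  \<comment> \<open>\<open>\<kappa> \<le> 1/2\<close> keeps the real part of a chord at half the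
    parameter distance or more; \<open>\<kappa> \<le> \<eta> / 2\<close> then bounds the slope by
    \<open>\<eta>\<close>.\<close>
  define \<kappa> where "\<kappa> = min (1/2) (\<eta> / 2)"
  have \<kappa>: "\<kappa> > 0" "\<kappa> \<le> 1/2" "\<kappa> \<le> \<eta> / 2" using \<open>\<eta> > 0\<close> by (auto simp: \<kappa>_def)
  obtain \<delta>2 where \<delta>2: "\<delta>2 > 0" "\<And>t u. \<bar>t - t0\<bar> \<le> \<delta>2 \<Longrightarrow> \<bar>u - t0\<bar> \<le> \<delta>2 \<Longrightarrow>
     norm ((\<gamma> u - \<gamma> t) / v - of_real (u - t)) \<le> \<kappa> * \<bar>u - t\<bar>"
    using strictly_differentiable[of \<kappa> t0] \<kappa> by (auto simp: v_def)
  have "\<bar>Im ((\<gamma> t - \<gamma> u) / v)\<bar> \<le> \<eta> * \<bar>Re ((\<gamma> t - \<gamma> u) / v)\<bar>"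
    if "\<bar>t - t0\<bar> \<le> \<delta>2" "\<bar>u - t0\<bar> \<le> \<delta>2" for t u
  proof -
    define w where "w = (\<gamma> t - \<gamma> u) / v - of_real (t - u)"
    have w: "norm w \<le> \<kappa> * \<bar>t - u\<bar>" unfolding w_def by (rule \<delta>2(2)) (use that in auto)
    then have "norm w \<le> (1/2) * \<bar>t - u\<bar>"
      using \<kappa> by (meson abs_ge_zero mult_right_mono order_trans)
    moreover have "\<bar>Re w\<bar> \<le> norm w" by (rule abs_Re_le_cmod)
    moreover have "Re ((\<gamma> t - \<gamma> u) / v) = (t - u) + Re w" by (simp add: w_def)
    ultimately have re: "\<bar>t - u\<bar> \<le> 2 * \<bar>Re ((\<gamma> t - \<gamma> u) / v)\<bar>"
      using abs_triangle_ineq4[of "t - u + Re w" "Re w"] by simp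
    have "\<bar>Im w\<bar> \<le> norm w" by (rule abs_Im_le_cmod)
    moreover have "Im ((\<gamma> t - \<gamma> u) / v) = Im w" by (simp add: w_def)
    ultimately have im: "\<bar>Im ((\<gamma> t - \<gamma> u) / v)\<bar> \<le> \<kappa> * \<bar>t - u\<bar>" using w by linarith
    moreover have "\<kappa> * \<bar>t - u\<bar> \<le> \<eta> / 2 * \<bar>t - u\<bar>" using \<kappa> by (intro mult_right_mono) auto
    moreover have "\<eta> / 2 * \<bar>t - u\<bar> \<le> \<eta> / 2 * (2 * \<bar>Re ((\<gamma> t - \<gamma> u) / v)\<bar>)"
      using \<open>\<eta> > 0\<close> re by (intro mult_left_mono) auto
    ultimately show ?thesis using im by simp
  qed
  then show ?thesis using that \<delta>2(1) unfolding v_def by blast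
qed

text \<open>The predicate \<open>left\<close> tells on which side of a short arc through \<open>\<gamma> t\<close> a point lies. It is
  prescribed only in cones around the normal direction, but with apex at every point \<open>\<gamma> u\<close> of
  the arc, because points will be pushed off the curve at parameters close to \<open>t\<close>.\<close>
definition decides_side :: "real \<Rightarrow> (complex \<Rightarrow> bool) \<Rightarrow> bool" where
  "decides_side t left \<longleftrightarrow> (\<forall>\<eta>>0. \<exists>\<delta>>0. \<forall>\<^sub>F q in nhds (\<gamma> t). \<forall>u. \<bar>u - t\<bar> < \<delta> \<longrightarrow>
     (Im ((q - \<gamma> u) / \<gamma>' t) > \<eta> * \<bar>Re ((q - \<gamma> u) / \<gamma>' t)\<bar> \<longrightarrow> left q) \<and>
     (Im ((q - \<gamma> u) / \<gamma>' t) < - (\<eta> * \<bar>Re ((q - \<gamma> u) / \<gamma>' t)\<bar>) \<longrightarrow> \<not> left q))"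

section \<open>Cauchy integrals over arcs of the curve\<close>

text \<open>The share of the parameters \<open>{a..b}\<close> in the winding number about
  \<open>q\<close>. For an open arc it is just a complex number, but it is additive under
  subdivision.\<close>

definition cauchy :: "real \<Rightarrow> real \<Rightarrow> complex \<Rightarrow> complex" where
  "cauchy a b q = integral {a..b} (\<lambda>t. \<gamma>' t / (\<gamma> t - q)) / (2 * of_real pi * \<i>)"

text \<open>The branch cuts of \<open>Ln (\<i> * z)\<close> and \<open>Ln (- \<i> * z)\<close> are
  the upper and the lower half of the imaginary axis. From \<open>z0\<close> in the left to
  \<open>z1\<close> in the right half-plane, their increments differ by \<open>\<i> * pi\<close> and
  \<open>- \<i> * pi\<close> from one common expression that is continuous in \<open>z0\<close> and
  \<open>z1\<close>.\<close>

lemma Ln_ii_diff: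
  assumes "Re z1 > 0" "Re z0 < 0"
  shows "Ln (\<i> * z1) - Ln (\<i> * z0) = Ln z1 - Ln (- z0) + \<i> * pi"
    and "Ln (- \<i> * z1) - Ln (- \<i> * z0) = Ln z1 - Ln (- z0) - \<i> * pi"
proof -
  have "z1 \<noteq> 0" "z0 \<noteq> 0" using assms by auto
  have *: "Ln (\<i> * z) = Ln z + \<i> * pi / 2" "Ln (- \<i> * z) = Ln z - \<i> * pi / 2" if "Re z > 0" for z
    using that Ln_times_ii[of z] Ln_times_ii[of "- \<i> * z"] by (auto simp: complex_eq_iff)
  have "Ln (\<i> * z0) = Ln (- z0) - \<i> * pi / 2" "Ln (- \<i> * z0) = Ln (- z0) + \<i> * pi / 2"
    using *[of "- z0"] assms by auto
  then show "Ln (\<i> * z1) - Ln (\<i> * z0) = Ln z1 - Ln (- z0) + \<i> * pi"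
    and "Ln (- \<i> * z1) - Ln (- \<i> * z0) = Ln z1 - Ln (- z0) - \<i> * pi"
    unfolding *[OF assms(1)] by (simp_all only:) (simp_all add: field_simps)
qed

text \<open>The factor \<open>c\<close> cancels from the logarithmic derivative; it serves to turn
  the branch cut away from the arc.\<close>

lemma has_integral_log_derivative:
  assumes "a \<le> b" "c \<noteq> 0"
    and "\<And>t. a \<le> t \<Longrightarrow> t \<le> b \<Longrightarrow> c * (\<gamma> t - q) \<notin> \<real>\<^sub>\<le>\<^sub>0"
  shows "((\<lambda>t. \<gamma>' t / (\<gamma> t - q)) has_integral Ln (c * (\<gamma> b - q)) - Ln (c * (\<gamma> a - q))) {a..b}"
proof (rule fundamental_theorem_of_calculus[OF assms(1)])
  fix t assume t: "t \<in> {a..b}"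
  have "((\<lambda>t. c * (\<gamma> t - q)) has_vector_derivative c * \<gamma>' t) (at t within {a..b})"
    by (rule has_vector_derivative_at_within) (auto intro!: derivative_eq_intros deriv)
  moreover have "(Ln has_field_derivative inverse (c * (\<gamma> t - q))) (at (c * (\<gamma> t - q)))"
    using assms(3) t by (intro has_field_derivative_Ln) auto
  ultimately have "(Ln \<circ> (\<lambda>t. c * (\<gamma> t - q)) has_vector_derivative c * \<gamma>' t * inverse (c * (\<gamma> t - q)))
      (at t within {a..b})"
    by (rule field_vector_diff_chain_within[OF _ has_field_derivative_at_within])
  moreover have "c * \<gamma>' t * inverse (c * (\<gamma> t - q)) = \<gamma>' t / (\<gamma> t - q)"
    using assms(2) by (simp add: divide_inverse)
  ultimately show "((\<lambda>t. Ln (c * (\<gamma> t - q))) has_vector_derivative \<gamma>' t / (\<gamma> t - q)) (at t within {a..b})"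
    by (simp add: o_def)
qed

text \<open>Seen from a point on its left, a short arc avoids one half of the normal line, and from a point
  on its right the other half. So two different branches of \<open>Ln\<close> are primitives of the Cauchy
  kernel, and their increments differ by \<open>2 \<pi> \<i>\<close>.\<close>
lemma local_arc:
  assumes "e > 0" "range \<gamma> \<subseteq> E"
  obtains \<delta> left \<rho> where "0 < \<delta>" "\<delta> < e" "decides_side t0 left"
    "((\<lambda>q. cauchy (t0 - \<delta>) (t0 + \<delta>) q - of_bool (left q)) \<longlongrightarrow> \<rho>) (at (\<gamma> t0) within - E)"
proof -
  obtain \<delta>1 where \<delta>1: "\<delta>1 > 0" "\<And>t u. \<bar>t - t0\<bar> \<le> \<delta>1 \<Longrightarrow> \<bar>u - t0\<bar> \<le> \<delta>1 \<Longrightarrow>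
       norm ((\<gamma> u - \<gamma> t) / \<gamma>' t0 - of_real (u - t)) \<le> 1/2 * \<bar>u - t\<bar>"
    using strictly_differentiable[of "1/2" t0] by auto
  define \<delta> where "\<delta> = min \<delta>1 (e / 2)"
  have \<delta>: "0 < \<delta>" "\<delta> < e" using \<delta>1 assms by (auto simp: \<delta>_def)
  define v where "v = \<gamma>' t0"
  have v: "v \<noteq> 0" using nonzero by (simp add: v_def)
  define p where "p = \<gamma> t0"
  define a b where "a = t0 - \<delta>" and "b = t0 + \<delta>"
  have Re_incr: "Re ((\<gamma> u - \<gamma> t) / v) \<ge> (u - t) / 2" if "a \<le> t" "t \<le> u" "u \<le> b" for t u
  proof -
    have "norm ((\<gamma> u - \<gamma> t) / v - of_real (u - t)) \<le> 1/2 * \<bar>u - t\<bar>"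
      unfolding v_def by (rule \<delta>1(2)) (use that in \<open>auto simp: a_def b_def \<delta>_def\<close>)
    then have "\<bar>Re ((\<gamma> u - \<gamma> t) / v - of_real (u - t))\<bar> \<le> 1/2 * \<bar>u - t\<bar>"
      using abs_Re_le_cmod order_trans by blast
    then show ?thesis using that by (auto simp: abs_if split: if_splits)
  qed
  \<comment> \<open>In the coordinate \<open>z q\<close> the point \<open>q\<close> is the origin
    and the tangent at \<open>t0\<close> is horizontal. The real part increases along the arc, which
    therefore meets the imaginary axis at most once.\<close>
  define z where "z q t = (\<gamma> t - q) / v" for q t
  have z_diff: "z q u - z q t = (\<gamma> u - \<gamma> t) / v" for q u t
    by (simp add: z_def diff_divide_distrib)
  have z_mono: "Re (z q t) < Re (z q u)" if "a \<le> t" "t < u" "u \<le> b" for q t u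
  proof -
    have "Re (z q u - z q t) \<ge> (u - t) / 2" unfolding z_diff by (rule Re_incr) (use that in auto)
    then show ?thesis using that by simp
  qed
  have z_inj: "t = u" if "Re (z q t) = Re (z q u)" "t \<in> {a..b}" "u \<in> {a..b}" for q t u
    using z_mono[of t u q] z_mono[of u t q] that by (cases t u rule: linorder_cases) auto
  have z_cont: "continuous_on S (\<lambda>t. Re (z q t))" for q S
    unfolding z_def using v by (intro continuous_intros continuous_on_curve) auto
  \<comment> \<open>The point is on the left if the arc passes below it on the imaginary axis of the
    coordinate \<open>z q\<close>.\<close>
  define left where "left q \<longleftrightarrow> (\<exists>t\<in>{a..b}. Re (z q t) = 0 \<and> Im (z q t) < 0)" for q
  \<comment> \<open>The two branches contribute 1/2 on the left and -1/2 on the right; subtracting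
    \<open>of_bool (left q)\<close> leaves -1/2 on both sides. Unlike the Cauchy integral,
    \<open>\<rho>f\<close> is continuous at \<open>p\<close>.\<close>
  define \<rho>f where "\<rho>f q = (Ln (z q b) - Ln (- z q a)) / (2 * of_real pi * \<i>) - 1/2" for q
  have ab: "Re (z p b) > 0" "Re (z p a) < 0" "a < b"
  proof -
    have "z p t0 = 0" by (simp add: z_def p_def)
    then show "Re (z p b) > 0" "Re (z p a) < 0"
      using z_mono[of t0 b p] z_mono[of a t0 p] \<delta> by (auto simp: a_def b_def)
  qed (use \<delta> in \<open>auto simp: a_def b_def\<close>)
  have z_tendsto: "((\<lambda>q. z q t) \<longlongrightarrow> z p t) (nhds p)" for t
    unfolding z_def using v by (auto intro!: tendsto_eq_intros filterlim_ident)
  have near: "\<forall>\<^sub>F q in nhds p. Re (z q u) > 0" "\<forall>\<^sub>F q in nhds p. Re (z q u') < 0"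
    if "u \<in> {t0<..b}" "u' \<in> {a..<t0}" for u u'
  proof -
    have "z p t0 = 0" by (simp add: z_def p_def)
    then have "Re (z p u) > 0" "Re (z p u') < 0"
      using z_mono[of t0 u p] z_mono[of u' t0 p] that \<delta> by (auto simp: a_def b_def)
    then show "\<forall>\<^sub>F q in nhds p. Re (z q u) > 0" "\<forall>\<^sub>F q in nhds p. Re (z q u') < 0"
      using order_tendstoD[OF tendsto_Re[OF z_tendsto]] by auto
  qed
  note near_ab = near[of b a, unfolded greaterThanAtMost_iff atLeastLessThan_iff]
  have "decides_side t0 left" unfolding decides_side_def
  proof (intro allI impI)
    fix \<eta> :: real assume "\<eta> > 0"
    obtain \<delta>2 where \<delta>2: "\<delta>2 > 0" "\<And>t u. \<bar>t - t0\<bar> \<le> \<delta>2 \<Longrightarrow> \<bar>u - t0\<bar> \<le> \<delta>2 \<Longrightarrow>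
       \<bar>Im ((\<gamma> t - \<gamma> u) / v)\<bar> \<le> \<eta> * \<bar>Re ((\<gamma> t - \<gamma> u) / v)\<bar>"
      using tangent_cone[OF \<open>\<eta> > 0\<close>, of t0] unfolding v_def by blast
    define d where "d = min \<delta> \<delta>2"
    have d: "d > 0" "d \<le> \<delta>" "d \<le> \<delta>2" using \<delta> \<delta>2 by (auto simp: d_def)
    have cone: "\<bar>Im ((\<gamma> t - \<gamma> u) / v)\<bar> \<le> \<eta> * \<bar>Re ((\<gamma> t - \<gamma> u) / v)\<bar>"
      if "\<bar>t - t0\<bar> \<le> d" "\<bar>u - t0\<bar> \<le> d" for t u
      using \<delta>2(2)[of t u] that d by linarith
    show "\<exists>\<delta>>0. \<forall>\<^sub>F q in nhds (\<gamma> t0). \<forall>u. \<bar>u - t0\<bar> < \<delta> \<longrightarrow>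
      (\<eta> * \<bar>Re ((q - \<gamma> u) / \<gamma>' t0)\<bar> < Im ((q - \<gamma> u) / \<gamma>' t0) \<longrightarrow> left q) \<and>
      (Im ((q - \<gamma> u) / \<gamma>' t0) < - (\<eta> * \<bar>Re ((q - \<gamma> u) / \<gamma>' t0)\<bar>) \<longrightarrow> \<not> left q)"
    proof (intro exI[of _ d] conjI)
      have "\<forall>\<^sub>F q in nhds p. Re (z q (t0 + d)) > 0 \<and> Re (z q (t0 - d)) < 0"
        using near[of "t0 + d" "t0 - d"] d by (auto simp: a_def b_def eventually_conj_iff)
      then show "\<forall>\<^sub>F q in nhds (\<gamma> t0). \<forall>u. \<bar>u - t0\<bar> < d \<longrightarrow>
        (\<eta> * \<bar>Re ((q - \<gamma> u) / \<gamma>' t0)\<bar> < Im ((q - \<gamma> u) / \<gamma>' t0) \<longrightarrow> left q) \<and>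
        (Im ((q - \<gamma> u) / \<gamma>' t0) < - (\<eta> * \<bar>Re ((q - \<gamma> u) / \<gamma>' t0)\<bar>) \<longrightarrow> \<not> left q)"
        unfolding p_def[symmetric] v_def[symmetric]
      proof (rule eventually_mono, intro allI impI)
        fix q u assume q: "Re (z q (t0 + d)) > 0 \<and> Re (z q (t0 - d)) < 0" and u: "\<bar>u - t0\<bar> < d"
        have "\<exists>t. t0 - d \<le> t \<and> t \<le> t0 + d \<and> Re (z q t) = 0"
          using q d by (intro IVT' z_cont) auto
        then obtain t where t: "t0 - d \<le> t" "t \<le> t0 + d" "Re (z q t) = 0" by blast
        then have tab: "t \<in> {a..b}" using d by (auto simp: a_def b_def)
        \<comment> \<open>The normal line through \<open>q\<close> hits the arc at
          \<open>\<gamma> t\<close>. Replacing \<open>q\<close> by \<open>\<gamma> t\<close> changes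
          only the imaginary part, and the chord from \<open>\<gamma> u\<close> to
          \<open>\<gamma> t\<close> lies in the cone; outside the cone the sign of the imaginary
          part thus tells the side of \<open>q\<close>.\<close>
        have eq: "(q - \<gamma> u) / v = (\<gamma> t - \<gamma> u) / v - z q t" by (simp add: z_def diff_divide_distrib)
        have c: "\<bar>Im ((\<gamma> t - \<gamma> u) / v)\<bar> \<le> \<eta> * \<bar>Re ((\<gamma> t - \<gamma> u) / v)\<bar>"
          using cone[of t u] t u by auto
        have re: "Re ((q - \<gamma> u) / v) = Re ((\<gamma> t - \<gamma> u) / v)"
          and im: "Im ((q - \<gamma> u) / v) = Im ((\<gamma> t - \<gamma> u) / v) - Im (z q t)"
          using t by (simp_all add: eq)
        have left_iff: "left q \<longleftrightarrow> Im (z q t) < 0"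
          unfolding left_def using z_inj[of q] t tab by metis
        show "(\<eta> * \<bar>Re ((q - \<gamma> u) / v)\<bar> < Im ((q - \<gamma> u) / v) \<longrightarrow> left q) \<and>
          (Im ((q - \<gamma> u) / v) < - (\<eta> * \<bar>Re ((q - \<gamma> u) / v)\<bar>) \<longrightarrow> \<not> left q)"
          unfolding re im left_iff using c by linarith
      qed
    qed (use d in auto)
  qed
  moreover have "((\<lambda>q. cauchy a b q - of_bool (left q)) \<longlongrightarrow> \<rho>f p) (at p within - E)"
  proof -
    have "\<forall>\<^sub>F q in at p within - E. cauchy a b q - of_bool (left q) = \<rho>f q"
    proof -
      have "\<forall>\<^sub>F q in at p within - E. q \<notin> E \<and> Re (z q b) > 0 \<and> Re (z q a) < 0"
        using near_ab \<delta> by (auto simp: eventually_at_filter eventually_conj_iff a_def b_def elim: eventually_mono)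
      then show ?thesis
      proof (rule eventually_mono)
        fix q assume q: "q \<notin> E \<and> Re (z q b) > 0 \<and> Re (z q a) < 0"
        have off: "z q t \<noteq> 0" for t using q assms(2) v by (auto simp: z_def)
        have int: "cauchy a b q = (Ln (c * z q b) - Ln (c * z q a)) / (2 * of_real pi * \<i>)"
          if "c \<noteq> 0" "\<And>t. a \<le> t \<Longrightarrow> t \<le> b \<Longrightarrow> c * z q t \<notin> \<real>\<^sub>\<le>\<^sub>0" for c
        proof -
          have eq: "c / v * (\<gamma> t - q) = c * z q t" for t by (simp add: z_def)
          have "integral {a..b} (\<lambda>t. \<gamma>' t / (\<gamma> t - q)) = Ln (c * z q b) - Ln (c * z q a)"
            using has_integral_log_derivative[of a b "c / v" q, unfolded eq] that v ab
            by (intro integral_unique) auto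
          then show ?thesis by (simp add: cauchy_def)
        qed
        have half: "(X + \<i> * of_real pi) / (2 * of_real pi * \<i>) - 1 = X / (2 * of_real pi * \<i>) - 1 / 2"
          "(X - \<i> * of_real pi) / (2 * of_real pi * \<i>) = X / (2 * of_real pi * \<i>) - 1 / 2" for X :: complex
          by (simp_all add: field_simps)
        show "cauchy a b q - of_bool (left q) = \<rho>f q"
        proof (cases "left q")
          case True
          then obtain s where s: "s \<in> {a..b}" "Re (z q s) = 0" "Im (z q s) < 0" by (auto simp: left_def)
          \<comment> \<open>The only point of the arc on the imaginary axis lies in its lower half,
            so the cut in the upper half is avoided.\<close>
          have "\<i> * z q t \<notin> \<real>\<^sub>\<le>\<^sub>0" if "a \<le> t" "t \<le> b" for t
            using z_inj[of q s t] s that by (auto simp: complex_nonpos_Reals_iff)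
          then have "cauchy a b q = (Ln (\<i> * z q b) - Ln (\<i> * z q a)) / (2 * of_real pi * \<i>)"
            by (intro int) auto
          then show ?thesis using True q Ln_ii_diff(1)[of "z q b" "z q a"] half(1)
            by (simp add: \<rho>f_def)
        next
          case False
          \<comment> \<open>Here the cut is the lower half; the origin, which belongs to the cut, is
            avoided because \<open>q\<close> is not on the curve.\<close>
          have "- \<i> * z q t \<notin> \<real>\<^sub>\<le>\<^sub>0" if "a \<le> t" "t \<le> b" for t
          proof
            assume "- \<i> * z q t \<in> \<real>\<^sub>\<le>\<^sub>0"
            then have "Re (z q t) = 0 \<and> Im (z q t) \<le> 0" by (auto simp: complex_nonpos_Reals_iff)
            then show False using False that off[of t] by (auto simp: left_def complex_eq_iff le_less)
          qed
          then have "cauchy a b q = (Ln (- \<i> * z q b) - Ln (- \<i> * z q a)) / (2 * of_real pi * \<i>)"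
            by (intro int) auto
          then show ?thesis using False q Ln_ii_diff(2)[of "z q b" "z q a"]
half(2)
            by (simp add: \<rho>f_def)
        qed
      qed
    qed
    moreover have "(\<rho>f \<longlongrightarrow> \<rho>f p) (at p within - E)"
    proof -
      have "((\<lambda>q. z q t) \<longlongrightarrow> z p t) (at p within - E)" for t
        using z_tendsto by (rule tendsto_mono[rotated]) (simp add: at_within_def)
      then show ?thesis unfolding \<rho>f_def using ab
        by (intro tendsto_intros) (auto simp: complex_nonpos_Reals_iff)
    qed
    ultimately show ?thesis by (rule tendsto_cong[THEN iffD2])
  qed
  ultimately show ?thesis using that \<delta> by (auto simp: a_def b_def p_def)
qed

lemma cauchy_integrable:
  assumes "q \<notin> range \<gamma>"
  shows "(\<lambda>t. \<gamma>' t / (\<gamma> t - q)) integrable_on {a..b}"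
  by (intro integrable_continuous_interval continuous_intros continuous_on_curve
      continuous_on_subset[OF cont_deriv]) (use assms in auto)

lemma cauchy_combine:
  assumes "q \<notin> range \<gamma>" "a \<le> c" "c \<le> b"
  shows "cauchy a b q = cauchy a c q + cauchy c b q"
proof -
  have "integral {a..b} (\<lambda>t. \<gamma>' t / (\<gamma> t - q)) =
      integral {a..c} (\<lambda>t. \<gamma>' t / (\<gamma> t - q)) + integral {c..b} (\<lambda>t. \<gamma>' t / (\<gamma> t - q))"
    using assms by (intro Henstock_Kurzweil_Integration.integral_combine[symmetric] cauchy_integrable) auto
  then show ?thesis by (simp add: cauchy_def add_divide_distrib)
qed

lemma isCont_cauchy:
  assumes "p \<notin> \<gamma> ` {a..b}"
  shows "isCont (cauchy a b) p"
proof -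
  have cpt: "compact (\<gamma> ` {a..b})"
    by (intro compact_continuous_image continuous_on_curve) auto
  then have op: "open (- \<gamma> ` {a..b})" using compact_imp_closed by blast
  have "continuous_on (- \<gamma> ` {a..b}) (\<lambda>q. integral (cbox a b) (\<lambda>t. \<gamma>' t / (\<gamma> t - q)))"
  proof (rule integral_continuous_on_param)
    show "continuous_on ((- \<gamma> ` {a..b}) \<times> cbox a b) (\<lambda>(q, t). \<gamma>' t / (\<gamma> t - q))"
      unfolding case_prod_unfold
      by (intro continuous_intros continuous_on_compose2[OF continuous_on_curve[of UNIV]]
          continuous_on_compose2[OF cont_deriv]) auto
  qed
  then have "continuous_on (- \<gamma> ` {a..b}) (cauchy a b)"
    unfolding cauchy_def by (intro continuous_intros) auto
  then show ?thesis using op assms by (simp add: continuous_on_eq_continuous_at)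
qed

text \<open>Induction on the number of passages through \<open>p\<close>: a short arc around one of
  them is handled by \<open>local_arc\<close>, and the two remaining pieces have fewer. The filter
  omits a set \<open>E\<close> that may be larger than the curve, so that the strands of a diagram
  can be added up over one filter.\<close>

lemma cauchy_local:
  assumes "finite {t\<in>{a..b}. \<gamma> t = p}" "\<gamma> a \<noteq> p" "\<gamma> b \<noteq> p" "a \<le> b" "range \<gamma> \<subseteq> E"
  shows "\<exists>left \<rho>. (\<forall>t\<in>{t\<in>{a..b}. \<gamma> t = p}. decides_side t (left t)) \<and>
    ((\<lambda>q. cauchy a b q - (\<Sum>t\<in>{t\<in>{a..b}. \<gamma> t = p}. of_bool (left t q))) \<longlongrightarrow> \<rho>) (at p within - E)"
  using assms(1-4)
proof (induction "card {t\<in>{a..b}. \<gamma> t = p}" arbitrary: a b rule: less_induct)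
  case less
  define T where "T c d = {t\<in>{c..d}. \<gamma> t = p}" for c d
  show ?case
  proof (cases "T a b = {}")
    case True
    then have "isCont (cauchy a b) p" by (intro isCont_cauchy) (auto simp: T_def)
    then have "((cauchy a b) \<longlongrightarrow> cauchy a b p) (at p within - E)"
      using continuous_within isCont_def tendsto_within_subset by blast
    then show ?thesis unfolding T_def[symmetric] True by auto
  next
    case False
    then obtain t0 where t0: "t0 \<in> T a b" by blast
    have fin: "finite (T a b)" using less.prems by (simp add: T_def)
    have ne: "a < t0" "t0 < b" using t0 less.prems by (auto simp: T_def less_le)
    obtain d0 where d0: "d0 > 0" "\<And>t. t \<in> T a b \<Longrightarrow> t \<noteq> t0 \<Longrightarrow> d0 \<le> dist t0 t"
      using finite_set_avoid[OF fin, of t0] by blast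
    \<comment> \<open>Short enough to stay inside \<open>{a..b}\<close> and away from the other
      passages, so that the cut points are not mapped to \<open>p\<close>.\<close>
    define e where "e = min d0 (min (t0 - a) (b - t0))"
    have e: "e > 0" using d0 ne by (auto simp: e_def)
    obtain \<delta> left0 \<rho>0 where loc: "0 < \<delta>" "\<delta> < e" "decides_side t0 left0"
      "((\<lambda>q. cauchy (t0 - \<delta>) (t0 + \<delta>) q - of_bool (left0 q)) \<longlongrightarrow> \<rho>0) (at (\<gamma> t0) within - E)"
      using local_arc[OF e assms(5)] by metis
    have p: "\<gamma> t0 = p" using t0 by (simp add: T_def)
    have iso: "t = t0" if "t \<in> T a b" "\<bar>t - t0\<bar> < e" for t
      using d0(2)[OF that(1)] that(2) by (cases "t = t0") (auto simp: e_def dist_real_def)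
    have off: "\<gamma> (t0 - \<delta>) \<noteq> p" "\<gamma> (t0 + \<delta>) \<noteq> p"
      using iso[of "t0 - \<delta>"] iso[of "t0 + \<delta>"] loc by (auto simp: T_def e_def)
    have sub: "T a (t0 - \<delta>) \<subset> T a b" "T (t0 + \<delta>) b \<subset> T a b"
    proof -
      have "t0 \<notin> T a (t0 - \<delta>)" "t0 \<notin> T (t0 + \<delta>) b" using loc by (auto simp: T_def)
      moreover have "T a (t0 - \<delta>) \<subseteq> T a b" "T (t0 + \<delta>) b \<subseteq> T a b"
        using loc ne by (auto simp: T_def e_def)
      ultimately show "T a (t0 - \<delta>) \<subset> T a b" "T (t0 + \<delta>) b \<subset> T a b"
        using t0 by (metis psubsetI)+
    qed
    have lt: "card (T a (t0 - \<delta>)) < card (T a b)" "card (T (t0 + \<delta>) b) < card (T a b)"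
      using sub fin by (auto intro: psubset_card_mono)
    have fins: "finite (T a (t0 - \<delta>))" "finite (T (t0 + \<delta>) b)"
      using sub fin by (meson finite_subset psubset_imp_subset)+
    obtain left1 \<rho>1 where 1: "\<forall>t\<in>T a (t0 - \<delta>). decides_side t (left1 t)"
      "((\<lambda>q. cauchy a (t0 - \<delta>) q - (\<Sum>t\<in>T a (t0 - \<delta>). of_bool (left1 t q))) \<longlongrightarrow> \<rho>1) (at p within - E)"
      using less.hyps[of a "t0 - \<delta>"] lt fins off less.prems loc unfolding T_def e_def by auto
    obtain left2 \<rho>2 where 2: "\<forall>t\<in>T (t0 + \<delta>) b. decides_side t (left2 t)"
      "((\<lambda>q. cauchy (t0 + \<delta>) b q - (\<Sum>t\<in>T (t0 + \<delta>) b. of_bool (left2 t q))) \<longlongrightarrow> \<rho>2) (at p within - E)"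
      using less.hyps[of "t0 + \<delta>" b] lt fins off less.prems loc unfolding T_def e_def by auto
    define left where "left t = (if t < t0 then left1 t else if t = t0 then left0 else left2 t)" for t
    have Teq: "T a b = T a (t0 - \<delta>) \<union> {t0} \<union> T (t0 + \<delta>) b"
    proof (intro set_eqI iffI)
      fix t assume t: "t \<in> T a b"
      then show "t \<in> T a (t0 - \<delta>) \<union> {t0} \<union> T (t0 + \<delta>) b"
        using iso[OF t] loc by (cases "\<bar>t - t0\<bar> < e") (auto simp: T_def abs_if split: if_splits)
    qed (use sub t0 in auto)
    have lt1: "t < t0" if "t \<in> T a (t0 - \<delta>)" for t using that loc by (auto simp: T_def)
    have lt2: "t > t0" if "t \<in> T (t0 + \<delta>) b" for t using that loc by (auto simp: T_def)
    have "\<forall>t\<in>T a b. decides_side t (left t)"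
    proof
      fix t assume "t \<in> T a b"
      then consider "t \<in> T a (t0 - \<delta>)" | "t = t0" | "t \<in> T (t0 + \<delta>) b" unfolding Teq by blast
      then show "decides_side t (left t)"
      proof cases
        case 1 then show ?thesis using lt1[OF 1] \<open>\<forall>t\<in>T a (t0 - \<delta>). _ t\<close> by (simp add: left_def)
      next
        case 2 then show ?thesis using loc(3) by (simp add: left_def)
      next
        case 3 then show ?thesis using lt2[OF 3] \<open>\<forall>t\<in>T (t0 + \<delta>) b. _ t\<close> by (simp add: left_def)
      qed
    qed
    moreover have "((\<lambda>q. cauchy a b q - (\<Sum>t\<in>T a b. of_bool (left t q))) \<longlongrightarrow> \<rho>1 + \<rho>0 + \<rho>2) (at p within - E)"
    proof (rule Lim_transform_eventually)
      show "((\<lambda>q. (cauchy a (t0 - \<delta>) q - (\<Sum>t\<in>T a (t0 - \<delta>). of_bool (left1 t q)))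
          + (cauchy (t0 - \<delta>) (t0 + \<delta>) q - of_bool (left0 q))
          + (cauchy (t0 + \<delta>) b q - (\<Sum>t\<in>T (t0 + \<delta>) b. of_bool (left2 t q)))) \<longlongrightarrow> \<rho>1 + \<rho>0 + \<rho>2) (at p within - E)"
        using 1 2 loc p by (intro tendsto_add) auto
      have "\<forall>\<^sub>F q in at p within - E. q \<notin> E" by (auto simp: eventually_at_filter)
      then show "\<forall>\<^sub>F q in at p within - E. (cauchy a (t0 - \<delta>) q - (\<Sum>t\<in>T a (t0 - \<delta>). of_bool (left1 t q)))
          + (cauchy (t0 - \<delta>) (t0 + \<delta>) q - of_bool (left0 q))
          + (cauchy (t0 + \<delta>) b q - (\<Sum>t\<in>T (t0 + \<delta>) b. of_bool (left2 t q)))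
          = cauchy a b q - (\<Sum>t\<in>T a b. of_bool (left t q))"
      proof (rule eventually_mono)
        fix q assume "q \<notin> E"
        then have q: "q \<notin> range \<gamma>" using assms(5) by auto
        have "cauchy a b q = cauchy a (t0 - \<delta>) q + cauchy (t0 - \<delta>) b q"
          using loc by (intro cauchy_combine q) (auto simp: e_def)
        also have "cauchy (t0 - \<delta>) b q = cauchy (t0 - \<delta>) (t0 + \<delta>) q + cauchy (t0 + \<delta>) b q"
          using loc by (intro cauchy_combine q) (auto simp: e_def)
        moreover have "(\<Sum>t\<in>T a b. of_bool (left t q) :: complex) = (\<Sum>t\<in>T a (t0 - \<delta>). of_bool (left t q))
            + of_bool (left t0 q) + (\<Sum>t\<in>T (t0 + \<delta>) b. of_bool (left t q))"
        proof -
          have "T a (t0 - \<delta>) \<inter> {t0} = {}" "(T a (t0 - \<delta>) \<union> {t0}) \<inter> T (t0 + \<delta>) b = {}"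
            using lt1 lt2 by (auto dest: less_asym)
          then have "sum f (T a b) = sum f (T a (t0 - \<delta>)) + f t0 + sum f (T (t0 + \<delta>) b)"
            for f :: "real \<Rightarrow> complex"
            unfolding Teq using fins by (subst sum.union_disjoint, auto)+
          then show ?thesis .
        qed
        moreover have "(\<Sum>t\<in>T a (t0 - \<delta>). of_bool (left t q) :: complex) = (\<Sum>t\<in>T a (t0 - \<delta>). of_bool (left1 t q))"
          by (intro sum.cong) (auto simp: left_def dest: lt1)
        moreover have "(\<Sum>t\<in>T (t0 + \<delta>) b. of_bool (left t q) :: complex) = (\<Sum>t\<in>T (t0 + \<delta>) b. of_bool (left2 t q))"
          by (intro sum.cong) (auto simp: left_def dest: lt2)
        moreover have "left t0 q = left0 q" by (simp add: left_def)
        ultimately show "(cauchy a (t0 - \<delta>) q - (\<Sum>t\<in>T a (t0 - \<delta>). of_bool (left1 t q)))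
          + (cauchy (t0 - \<delta>) (t0 + \<delta>) q - of_bool (left0 q))
          + (cauchy (t0 + \<delta>) b q - (\<Sum>t\<in>T (t0 + \<delta>) b. of_bool (left2 t q)))
          = cauchy a b q - (\<Sum>t\<in>T a b. of_bool (left t q))" by (simp add: algebra_simps)
      qed
    qed
    ultimately show ?thesis unfolding T_def by blast
  qed
qed

end

locale closed_immersed_curve = immersed_curve +
  assumes periodic: "\<gamma> (t + 1) = \<gamma> t"
begin

lemma periodic_deriv: "\<gamma>' (t + 1) = \<gamma>' t"
proof -
  have "((\<lambda>s. \<gamma> (s + 1)) has_vector_derivative \<gamma>' (t + 1)) (at t)"
    using vector_diff_chain_at[of "\<lambda>s. s + 1" 1 t \<gamma> "\<gamma>' (t + 1)"] deriv[of "t + 1"]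
      has_vector_derivative_add_const[of "\<lambda>s. s" 1 1 "at t"] has_vector_derivative_id[of "at t"]
    by (simp add: o_def id_def)
  then show ?thesis using periodic deriv[of t] by (simp add: vector_derivative_unique_at)
qed

lemma valid_path_curve: "valid_path \<gamma>"
  unfolding valid_path_def
  by (intro C1_differentiable_imp_piecewise)
    (use deriv continuous_on_subset[OF cont_deriv] in \<open>auto simp: C1_differentiable_on_def intro!: exI[of _ \<gamma>']\<close>)

lemma closed_curve: "pathfinish \<gamma> = pathstart \<gamma>"
  using periodic[of 0] by (simp add: pathfinish_def pathstart_def)

lemma path_image_curve: "path_image \<gamma> \<subseteq> range \<gamma>"
  by (auto simp: path_image_def)

lemma winding_number_eq_cauchy:
  assumes "q \<notin> range \<gamma>"
  shows "winding_number \<gamma> q = cauchy 0 1 q"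
proof -
  have "contour_integral \<gamma> (\<lambda>w. 1 / (w - q)) = integral {0..1} (\<lambda>t. \<gamma>' t / (\<gamma> t - q))"
    unfolding contour_integral_integral by (intro integral_cong) (simp add: vector_derivative_at[OF deriv])
  then show ?thesis
    using winding_number_valid_path[OF valid_path_curve, of q] assms path_image_curve
    by (auto simp: cauchy_def)
qed

text \<open>A passage through \<open>p\<close> at parameter 0 would be an endpoint of
  \<open>{0..1}\<close>; by periodicity a shifted interval of length 1 serves as well.\<close>

lemma winding_number_eq_cauchy_shift:
  assumes "q \<notin> range \<gamma>" "0 \<le> d" "d \<le> 1"
  shows "winding_number \<gamma> q = cauchy (- d) (1 - d) q"
proof -
  have "cauchy (-d) 0 q = cauchy (1 - d) 1 q"
  proof -
    have "((\<lambda>t. \<gamma>' t / (\<gamma> t - q)) has_integral integral {1-d..1} (\<lambda>t. \<gamma>' t / (\<gamma> t - q))) (cbox (1-d) 1)"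
      using cauchy_integrable[OF assms(1), of "1-d" 1] by (simp add: has_integral_integral)
    from has_integral_affinity[OF this, of 1 1]
    have "((\<lambda>t. \<gamma>' t / (\<gamma> t - q)) has_integral integral {1-d..1} (\<lambda>t. \<gamma>' t / (\<gamma> t - q))) {-d..0}"
      using periodic periodic_deriv assms
      by (simp add: image_affinity_atLeastAtMost_diff add.commute)
    then show ?thesis by (simp add: cauchy_def integral_unique)
  qed
  moreover have "cauchy (-d) (1-d) q = cauchy (-d) 0 q + cauchy 0 (1-d) q"
    "cauchy 0 1 q = cauchy 0 (1-d) q + cauchy (1-d) 1 q"
    using assms by (auto intro!: cauchy_combine)
  ultimately show ?thesis using winding_number_eq_cauchy[OF assms(1)] by simp
qed

lemma winding_number_local:
  assumes "finite {t\<in>{0..<1}. \<gamma> t = p}" "range \<gamma> \<subseteq> E"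
  shows "\<exists>left \<rho>. (\<forall>t\<in>{t\<in>{0..<1}. \<gamma> t = p}. decides_side t (left t)) \<and>
    ((\<lambda>q. winding_number \<gamma> q - (\<Sum>t\<in>{t\<in>{0..<1}. \<gamma> t = p}. of_bool (left t q))) \<longlongrightarrow> \<rho>) (at p within - E)"
proof -
  define T where "T = {t\<in>{0..<1}. \<gamma> t = p}"
  obtain d0 where d0: "d0 > 0" "\<And>t. t \<in> T \<Longrightarrow> t \<noteq> 1 \<Longrightarrow> d0 \<le> dist 1 t"
    using finite_set_avoid[OF assms(1), of 1] unfolding T_def by blast
  \<comment> \<open>With \<open>d\<close> below the distance from the last passage to 1, no passage
    lies in \<open>[1 - d, 1)\<close> or, by periodicity, in \<open>[-d, 0)\<close>. So
    \<open>{-d..1-d}\<close> contains the same passages as \<open>{0..<1}\<close>, all of them in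
    its interior.\<close>
  define d where "d = min d0 1 / 2"
  have d: "0 < d" "d < d0" "d < 1" using d0 by (auto simp: d_def)
  have no: "\<gamma> t \<noteq> p" if "- d \<le> t" "t < 0" for t
  proof
    assume "\<gamma> t = p"
    then have "\<gamma> (t + 1) = p" using periodic by simp
    then have "t + 1 \<in> T" using that d by (auto simp: T_def)
    from d0(2)[OF this] show False using that d by (auto simp: dist_real_def)
  qed
  have no': "\<gamma> t \<noteq> p" if "1 - d \<le> t" "t < 1" for t
    using no[of "t - 1"] periodic[of "t - 1"] that by auto
  have T: "{t\<in>{-d..1-d}. \<gamma> t = p} = T"
    unfolding T_def using no no' d
    by auto (smt (verit))+
  have "\<exists>left \<rho>. (\<forall>t\<in>T. decides_side t (left t)) \<and>
    ((\<lambda>q. cauchy (-d) (1-d) q - (\<Sum>t\<in>T. of_bool (left t q))) \<longlongrightarrow> \<rho>) (at p within - E)"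
    using cauchy_local[of "-d" "1-d" p E] assms no[of "-d"] no'[of "1-d"] d unfolding T by (simp add: T_def)
  then obtain left \<rho> where *: "\<forall>t\<in>T. decides_side t (left t)"
    "((\<lambda>q. cauchy (-d) (1-d) q - (\<Sum>t\<in>T. of_bool (left t q))) \<longlongrightarrow> \<rho>) (at p within - E)" by blast
  have "((\<lambda>q. winding_number \<gamma> q - (\<Sum>t\<in>T. of_bool (left t q))) \<longlongrightarrow> \<rho>) (at p within - E)"
  proof (rule Lim_transform_eventually[OF *(2)])
    have "\<forall>\<^sub>F q in at p within - E. q \<notin> E" by (auto simp: eventually_at_filter)
    then show "\<forall>\<^sub>F q in at p within - E. cauchy (-d) (1-d) q - (\<Sum>t\<in>T. of_bool (left t q))
        = winding_number \<gamma> q - (\<Sum>t\<in>T. of_bool (left t q))"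
    proof (rule eventually_mono)
      fix q assume "q \<notin> E"
      then have "winding_number \<gamma> q = cauchy (-d) (1-d) q"
        using assms(2) d by (intro winding_number_eq_cauchy_shift) auto
      then show "cauchy (-d) (1-d) q - (\<Sum>t\<in>T. of_bool (left t q))
        = winding_number \<gamma> q - (\<Sum>t\<in>T. of_bool (left t q))" by simp
    qed
  qed
  then show ?thesis using * unfolding T_def by blast
qed

end

section \<open>The winding number of a diagram\<close>

lemma vector_derivative_shift:
  assumes "\<And>s. f (s + c) = f s" "(f has_vector_derivative D) (at (t + c))"
  shows "(f has_vector_derivative D) (at t)"
proof -
  have "((\<lambda>s. s + c) has_vector_derivative 1) (at t)"
    using has_vector_derivative_add_const[of "\<lambda>s. s" c 1 "at t"] has_vector_derivative_id[of "at t"]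
    by (simp add: id_def)
  from vector_diff_chain_at[OF this assms(2)] show ?thesis using assms(1) by (simp add: o_def)
qed

text \<open>\<open>det2 v d\<close> is the imaginary part of \<open>cnj v * d\<close>; this
  translates the side of a strand into the normalised coordinate of the local analysis.\<close>

lemma det2_eq_Im_divide:
  assumes "v \<noteq> 0"
  shows "det2 v d = (cmod v)\<^sup>2 * Im (d / v)"
proof -
  have "det2 v (w * v) = (cmod v)\<^sup>2 * Im w" for w
    unfolding det2_def cmod_power2 by (simp add: algebra_simps power2_eq_square)
  from this[of "d / v"] show ?thesis using assms by simp
qed

lemma det2_sign_iff:
  assumes "v \<noteq> 0"
  shows "det2 v d > 0 \<longleftrightarrow> Im (d / v) > 0" "det2 v d < 0 \<longleftrightarrow> Im (d / v) < 0" "det2 v d = 0 \<longleftrightarrow> Im (d / v) = 0"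
  using assms by (simp_all add: det2_eq_Im_divide zero_less_mult_iff mult_less_0_iff)

text \<open>Off the diagram the sum is an integer and the floor is only a type conversion.\<close>
definition wind :: "link \<Rightarrow> complex \<Rightarrow> int" where
  "wind L q = \<lfloor>Re (\<Sum>j<length L. winding_number (\<lambda>t. proj L (j, t)) q)\<rfloor>"

definition branches :: "link \<Rightarrow> complex \<Rightarrow> (nat \<times> real) set" where
  "branches L p = {x\<in>params L. proj L x = p}"

locale link_diagram =
  fixes L :: link
  assumes diagram: "knot_diagram L"
begin

abbreviation "D \<equiv> diagram_image L"

lemma component_C1: "j < length L \<Longrightarrow> L ! j C1_differentiable_on UNIV"
  and component_periodic: "j < length L \<Longrightarrow> (L ! j) (t + 1) = (L ! j) t"
  using diagram unfolding knot_diagram_def oriented_link_def by (auto simp: all_set_conv_all_nth)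

text \<open>Parameters of the diagram lie in \<open>[0, 1)\<close>, while the local analysis moves
  freely along the real line; this lemma and its relatives for \<open>frac\<close> translate between
  the two.\<close>

lemma space_point_of_int:
  assumes "j < length L"
  shows "space_point L (j, t + of_int n) = space_point L (j, t)"
proof -
  interpret periodic_fun_simple' "L ! j"
    by standard (rule component_periodic[OF assms])
  show ?thesis by (simp add: space_point_def plus_of_int)
qed

lemma proj_of_int: "j < length L \<Longrightarrow> proj L (j, t + of_int n) = proj L (j, t)"
  by (simp add: proj_def space_point_of_int)

lemma frac_eq: "frac t = t + of_int (- \<lfloor>t\<rfloor>)" for t :: real
  by (simp add: frac_def)

lemma space_point_frac: "j < length L \<Longrightarrow> space_point L (j, frac t) = space_point L (j, t)"
  unfolding frac_eq by (rule space_point_of_int)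

lemma proj_frac: "j < length L \<Longrightarrow> proj L (j, frac t) = proj L (j, t)"
  unfolding frac_eq by (rule proj_of_int)

lemma frac_params: "j < length L \<Longrightarrow> (j, frac t) \<in> params L"
  by (simp add: params_def frac_lt_1)

lemma has_tangent:
  assumes "j < length L"
  shows "((\<lambda>t. proj L (j, t)) has_vector_derivative tangent L (j, t)) (at t)"
    and "continuous_on UNIV (\<lambda>t. tangent L (j, t))"
    and "isCont (\<lambda>t. space_point L (j, t)) t"
proof -
  obtain E where E: "\<And>t. (L ! j has_vector_derivative E t) (at t)" "continuous_on UNIV E"
    using component_C1[OF assms] unfolding C1_differentiable_on_def by blast
  have E1: "((\<lambda>t. fst ((L ! j) t)) has_vector_derivative fst (E t)) (at t)" for t
    using bounded_linear.has_vector_derivative[OF bounded_linear_fst E(1)] .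
  have T: "tangent L (j, t) = fst (E t)" for t
    using E1 by (simp add: tangent_def vector_derivative_at)
  show "((\<lambda>t. proj L (j, t)) has_vector_derivative tangent L (j, t)) (at t)"
    using E1 by (simp add: proj_def space_point_def T)
  show "continuous_on UNIV (\<lambda>t. tangent L (j, t))"
    unfolding T using E(2) by (intro continuous_intros)
  show "isCont (\<lambda>t. space_point L (j, t)) t"
    using has_vector_derivative_continuous[OF E(1)] by (simp add: space_point_def)
qed

lemma tangent_of_int:
  assumes "j < length L"
  shows "tangent L (j, t + of_int n) = tangent L (j, t)"
  using vector_derivative_shift[OF proj_of_int[OF assms] has_tangent(1)[OF assms]] has_tangent(1)[OF assms]
  by (rule vector_derivative_unique_at)

lemma tangent_frac: "j < length L \<Longrightarrow> tangent L (j, frac t) = tangent L (j, t)"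
  unfolding frac_eq by (rule tangent_of_int)

lemma tangent_nonzero_params: "x \<in> params L \<Longrightarrow> tangent L x \<noteq> 0"
  using diagram unfolding knot_diagram_def by blast

lemma tangent_nonzero: "j < length L \<Longrightarrow> tangent L (j, t) \<noteq> 0"
  using tangent_nonzero_params[OF frac_params] tangent_frac by metis

lemma closed_immersed_strand:
  assumes "j < length L"
  shows "closed_immersed_curve (\<lambda>t. proj L (j, t)) (\<lambda>t. tangent L (j, t))"
  using has_tangent[OF assms] tangent_nonzero[OF assms] proj_of_int[OF assms, of _ 1]
  by unfold_locales auto

lemma immersed_strand: "j < length L \<Longrightarrow> immersed_curve (\<lambda>t. proj L (j, t)) (\<lambda>t. tangent L (j, t))"
  using closed_immersed_strand closed_immersed_curve.axioms by blast

lemma proj_in_image: "j < length L \<Longrightarrow> proj L (j, t) \<in> D"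
  unfolding diagram_image_def using frac_params proj_frac by (metis imageI)

lemma image_eq: "D = (\<Union>j<length L. (\<lambda>t. proj L (j, t)) ` {0..1})"
  using proj_in_image by (fastforce simp: diagram_image_def params_def image_iff)

lemma compact_image: "compact D"
  unfolding image_eq
  using immersed_curve.continuous_on_curve[OF immersed_strand]
  by (intro compact_UN compact_continuous_image) auto

lemma open_complement: "open (- D)"
  using compact_image compact_imp_closed by blast

text \<open>There are no triple points, so two distinct branches exhaust the fibre over
  \<open>p\<close>.\<close>

lemma finite_branches: "finite (branches L p)"
proof (cases "\<exists>x y. x \<in> branches L p \<and> y \<in> branches L p \<and> x \<noteq> y")
  case True
  then obtain x y where xy: "x \<in> branches L p" "y \<in> branches L p" "x \<noteq> y" by blast
  have "z = x \<or> z = y" if "z \<in> branches L p" for z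
    using diagram xy that unfolding knot_diagram_def branches_def by (metis (mono_tags, lifting) mem_Collect_eq)
  then show ?thesis using finite_subset[of _ "{x, y}"] by blast
next
  case False
  then obtain x where "branches L p \<subseteq> {x}" by blast
  then show ?thesis using finite_subset by blast
qed

lemma path_strand: "j < length L \<Longrightarrow> path (\<lambda>t. proj L (j, t))"
  using closed_immersed_curve.valid_path_curve[OF closed_immersed_strand] valid_path_imp_path by blast

lemma path_image_strand: "j < length L \<Longrightarrow> path_image (\<lambda>t. proj L (j, t)) \<subseteq> D"
  using proj_in_image by (auto simp: path_image_def)

lemma of_int_wind:
  assumes "q \<notin> D"
  shows "of_int (wind L q) = (\<Sum>j<length L. winding_number (\<lambda>t. proj L (j, t)) q)"
proof -
  have "winding_number (\<lambda>t. proj L (j, t)) q \<in> \<int>" if "j < length L" for j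
    using that assms path_image_strand path_strand closed_immersed_curve.closed_curve[OF closed_immersed_strand]
    by (intro integer_winding_number) auto
  then have "(\<Sum>j<length L. winding_number (\<lambda>t. proj L (j, t)) q) \<in> \<int>" by (intro Ints_sum) auto
  then show ?thesis unfolding wind_def by (elim Ints_cases) (simp del: Re_sum)
qed

lemma wind_constant:
  assumes "connected S" "S \<inter> D = {}" "x \<in> S" "y \<in> S"
  shows "wind L x = wind L y"
proof -
  have "winding_number (\<lambda>t. proj L (j, t)) x = winding_number (\<lambda>t. proj L (j, t)) y" if "j < length L" for j
  proof -
    have "winding_number (\<lambda>t. proj L (j, t)) constant_on S"
      using that assms path_image_strand path_strand closed_immersed_curve.closed_curve[OF closed_immersed_strand]
      by (intro winding_number_constant) auto
    then show ?thesis using assms by (auto simp: constant_on_def)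
  qed
  then show ?thesis unfolding wind_def by simp
qed

lemma wind_locally_constant:
  assumes "q \<notin> D"
  shows "\<forall>\<^sub>F q' in nhds q. wind L q' = wind L q"
proof -
  obtain e where e: "e > 0" "ball q e \<subseteq> - D" using open_complement assms openE by (metis ComplI)
  have "\<forall>\<^sub>F q' in nhds q. q' \<in> ball q e" using e by (intro eventually_nhds_in_open) auto
  then show ?thesis
    by (rule eventually_mono) (use e in \<open>auto intro!: wind_constant[of "ball q e"]\<close>)
qed

lemma wind_far: "\<exists>B. \<forall>q. norm q \<ge> B \<longrightarrow> wind L q = 0"
proof -
  have "\<exists>B. \<forall>q. norm q \<ge> B \<longrightarrow> winding_number (\<lambda>t. proj L (j, t)) q = 0" if "j < length L" for j
    using that path_strand closed_immersed_curve.closed_curve[OF closed_immersed_strand]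
    by (intro winding_number_zero_at_infinity) auto
  then obtain B where B: "\<And>j q. j < length L \<Longrightarrow> norm q \<ge> B j \<Longrightarrow> winding_number (\<lambda>t. proj L (j, t)) q = 0"
    by metis
  have "wind L q = 0" if "norm q \<ge> Max (insert 0 (B ` {..<length L}))" for q
    using that unfolding wind_def by (subst sum.neutral) (auto intro!: B)
  then show ?thesis by blast
qed

lemma exterior_region: "exterior_region L \<in> regions L" "\<not> bounded (exterior_region L)"
proof -
  have "bounded D" using compact_image compact_imp_bounded by blast
  then have b: "bounded (- (- D))" by simp
  have "\<exists>!\<Delta>. \<Delta> \<in> regions L \<and> \<not> bounded \<Delta>"
    using cobounded_unbounded_components[OF b] cobounded_unique_unbounded_components[OF b]
    unfolding regions_def by auto
  from theI'[OF this] show "exterior_region L \<in> regions L" "\<not> bounded (exterior_region L)"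
    unfolding exterior_region_def by auto
qed

lemma region_props:
  assumes "\<Delta> \<in> regions L"
  shows "connected \<Delta>" "\<Delta> \<inter> D = {}" "\<Delta> \<noteq> {}" "open \<Delta>"
  using assms in_components_connected in_components_subset in_components_nonempty
    open_components[OF open_complement] unfolding regions_def by blast+

text \<open>Fixes the additive constant: winding numbers vanish far out, and the exterior region,
  being unbounded, has points there.\<close>

lemma wind_exterior:
  assumes "q \<in> exterior_region L"
  shows "wind L q = 0"
proof -
  obtain B where B: "\<And>q. norm q \<ge> B \<Longrightarrow> wind L q = 0" using wind_far by blast
  obtain q' where "q' \<in> exterior_region L" "norm q' \<ge> B"
    using exterior_region(2) unfolding bounded_iff by (meson linear)
  then show ?thesis
    using wind_constant[of "exterior_region L" q q'] region_props[OF exterior_region(1)] assms B by auto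
qed

text \<open>The predicate \<open>decides_side\<close> for the strand of \<open>x\<close>, indexed by
  parameter pairs so that branches on the same and on different components are treated
  alike.\<close>

definition decides :: "nat \<times> real \<Rightarrow> (complex \<Rightarrow> bool) \<Rightarrow> bool" where
  "decides x left \<longleftrightarrow> (\<forall>\<eta>>0. \<exists>\<delta>>0. \<forall>\<^sub>F q in nhds (proj L x). \<forall>u. \<bar>u - snd x\<bar> < \<delta> \<longrightarrow>
     (Im ((q - proj L (fst x, u)) / tangent L x) > \<eta> * \<bar>Re ((q - proj L (fst x, u)) / tangent L x)\<bar> \<longrightarrow> left q) \<and>
     (Im ((q - proj L (fst x, u)) / tangent L x) < - (\<eta> * \<bar>Re ((q - proj L (fst x, u)) / tangent L x)\<bar>) \<longrightarrow> \<not> left q))"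

text \<open>\<open>K\<close> is the winding number in the sector at \<open>p\<close> that lies to the right of all strands through
  \<open>p\<close>; at a crossing it is the index of the source region.\<close>
definition base_data :: "complex \<Rightarrow> int \<Rightarrow> (nat \<times> real \<Rightarrow> complex \<Rightarrow> bool) \<Rightarrow> bool" where
  "base_data p K left \<longleftrightarrow> (\<forall>x\<in>branches L p. decides x (left x)) \<and>
     (\<forall>\<^sub>F q in at p within - D. wind L q = K + (\<Sum>x\<in>branches L p. of_bool (left x q)))"

text \<open>The choice is harmless: \<open>directional_limit\<close> expresses the chosen value
  through \<open>wind\<close>.\<close>

definition base :: "complex \<Rightarrow> int" where
  "base p = (SOME K. \<exists>left. base_data p K left)"

lemma branches_Sigma: "branches L p = (SIGMA j:{..<length L}. {t\<in>{0..<1}. proj L (j, t) = p})"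
  by (auto simp: branches_def params_def)

text \<open>Summed over the strands, the winding number minus the number of branches with
  \<open>q\<close> on their left has a limit at \<open>p\<close>. Being an integer, it is eventually
  constant.\<close>

lemma base_data_exists: "\<exists>K left. base_data p K left"
proof -
  define T where "T j = {t\<in>{0..<1}. proj L (j, t) = p}" for j
  have fin: "finite (T j)" if "j < length L" for j
    using finite_subset[of "Pair j ` T j" "branches L p"] finite_branches[of p] that
    by (auto simp: T_def branches_def params_def finite_image_iff inj_on_def)
  define P where "P j left \<rho> \<longleftrightarrow> (\<forall>t\<in>T j. decides (j, t) (left t)) \<and>
    ((\<lambda>q. winding_number (\<lambda>t. proj L (j, t)) q - (\<Sum>t\<in>T j. of_bool (left t q))) \<longlongrightarrow> \<rho>) (at p within - D)"
    for j left \<rho>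
  have "\<exists>left \<rho>. P j left \<rho>"
    if "j < length L" for j
  proof -
    have eq: "immersed_curve.decides_side (\<lambda>t. proj L (j, t)) (\<lambda>t. tangent L (j, t)) t lf \<longleftrightarrow> decides (j, t) lf"
      for t lf
      by (simp add: decides_def immersed_curve.decides_side_def[OF immersed_strand[OF that]])
    have "range (\<lambda>t. proj L (j, t)) \<subseteq> D" using proj_in_image[OF that] by auto
    from closed_immersed_curve.winding_number_local[OF closed_immersed_strand[OF that] fin[OF that, unfolded T_def] this]
    show ?thesis unfolding eq T_def P_def .
  qed
  then obtain left \<rho> where "\<And>j. j < length L \<Longrightarrow> P j (left j) (\<rho> j)" by metis
  then have left: "\<And>j t. j < length L \<Longrightarrow> t \<in> T j \<Longrightarrow> decides (j, t) (left j t)"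
    and \<rho>: "\<And>j. j < length L \<Longrightarrow> ((\<lambda>q. winding_number (\<lambda>t. proj L (j, t)) q - (\<Sum>t\<in>T j. of_bool (left j t q))) \<longlongrightarrow> \<rho> j)
      (at p within - D)"
    unfolding P_def by blast+
  define lft where "lft x = left (fst x) (snd x)" for x
  \<comment> \<open>An integer within 1/2 of the limit equals the rounded limit.\<close>
  define K where "K = round (Re (\<Sum>j<length L. \<rho> j))"
  define f where "f q = wind L q - (\<Sum>x\<in>branches L p. of_bool (lft x q))" for q
  have "((\<lambda>q. \<Sum>j<length L. winding_number (\<lambda>t. proj L (j, t)) q - (\<Sum>t\<in>T j. of_bool (left j t q))) \<longlongrightarrow> (\<Sum>j<length L. \<rho> j))
      (at p within - D)"
    using \<rho> by (intro tendsto_sum) auto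
  then have "((\<lambda>q. of_int (f q) :: complex) \<longlongrightarrow> (\<Sum>j<length L. \<rho> j)) (at p within - D)"
  proof (rule Lim_transform_eventually)
    have "\<forall>\<^sub>F q in at p within - D. q \<notin> D" by (auto simp: eventually_at_filter)
    then show "\<forall>\<^sub>F q in at p within - D. (\<Sum>j<length L. winding_number (\<lambda>t. proj L (j, t)) q - (\<Sum>t\<in>T j. of_bool (left j t q)))
        = of_int (f q)"
    proof (rule eventually_mono)
      fix q assume "q \<notin> D"
      have "(\<Sum>x\<in>Sigma {..<length L} T. of_bool (lft x q) :: complex) = (\<Sum>j<length L. \<Sum>t\<in>T j. of_bool (left j t q))"
        using fin by (subst sum.Sigma) (auto simp: lft_def case_prod_unfold)
      then show "(\<Sum>j<length L. winding_number (\<lambda>t. proj L (j, t)) q - (\<Sum>t\<in>T j. of_bool (left j t q))) = of_int (f q)"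
        unfolding f_def of_int_diff of_int_wind[OF \<open>q \<notin> D\<close>] branches_Sigma T_def[symmetric] sum_subtractf
        by simp
    qed
  qed
  then have "((\<lambda>q. Re (of_int (f q))) \<longlongrightarrow> Re (\<Sum>j<length L. \<rho> j)) (at p within - D)"
    by (rule tendsto_Re)
  then have "\<forall>\<^sub>F q in at p within - D. dist (Re (of_int (f q))) (Re (\<Sum>j<length L. \<rho> j)) < 1/2"
    by (rule tendstoD) simp
  then have "\<forall>\<^sub>F q in at p within - D. wind L q = K + (\<Sum>x\<in>branches L p. of_bool (lft x q))"
  proof (rule eventually_mono)
    fix q assume q: "dist (Re (of_int (f q))) (Re (\<Sum>j<length L. \<rho> j)) < 1/2"
    have "round (Re (\<Sum>j<length L. \<rho> j)) = f q"
      by (rule round_unique') (use q in \<open>simp add: dist_real_def abs_minus_commute\<close>)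
    then show "wind L q = K + (\<Sum>x\<in>branches L p. of_bool (lft x q))"
      by (simp add: K_def f_def)
  qed
  moreover have "\<forall>x\<in>branches L p. decides x (lft x)"
    using left unfolding branches_Sigma T_def[symmetric] by (auto simp: lft_def)
  ultimately show ?thesis unfolding base_data_def by blast
qed

lemma base: "\<exists>left. base_data p (base p) left"
  unfolding base_def using someI_ex[OF base_data_exists] .

text \<open>By compactness of the parameter interval, points of the diagram close to
  \<open>p\<close> come from parameters close to a passage through \<open>p\<close>, where
  \<open>tangent_cone\<close> applies. The aperture may differ from branch to branch.\<close>

lemma image_near_tangents:
  fixes \<eta> :: "nat \<times> real \<Rightarrow> real"
  assumes "\<And>x. x \<in> branches L p \<Longrightarrow> \<eta> x > 0"
  shows "\<forall>\<^sub>F q in nhds p. q \<in> D \<longrightarrow>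
    (\<exists>x\<in>branches L p. \<bar>Im ((q - p) / tangent L x)\<bar> \<le> \<eta> x * \<bar>Re ((q - p) / tangent L x)\<bar>)"
proof -
  define cone where "cone q \<longleftrightarrow> (\<exists>x\<in>branches L p. \<bar>Im ((q - p) / tangent L x)\<bar> \<le> \<eta> x * \<bar>Re ((q - p) / tangent L x)\<bar>)" for q
  have "\<forall>\<^sub>F q in nhds p. \<forall>u\<in>{0..1}. proj L (j, u) = q \<longrightarrow> cone q" if j: "j < length L" for j
  proof -
    interpret closed_immersed_curve "\<lambda>t. proj L (j, t)" "\<lambda>t. tangent L (j, t)" by (rule closed_immersed_strand[OF j])
    show ?thesis
    proof (rule Bolzano[where P = "\<lambda>a b. \<forall>\<^sub>F q in nhds p. \<forall>u\<in>{a..b}. proj L (j, u) = q \<longrightarrow> cone q"])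
      fix a b c :: real
      assume "\<forall>\<^sub>F q in nhds p. \<forall>u\<in>{a..b}. proj L (j, u) = q \<longrightarrow> cone q"
        "\<forall>\<^sub>F q in nhds p. \<forall>u\<in>{b..c}. proj L (j, u) = q \<longrightarrow> cone q"
      then show "\<forall>\<^sub>F q in nhds p. \<forall>u\<in>{a..c}. proj L (j, u) = q \<longrightarrow> cone q"
        by eventually_elim (metis atLeastAtMost_iff linear)
    next
      fix t :: real
      show "\<exists>d>0. \<forall>a b. a \<le> t \<and> t \<le> b \<and> b - a < d \<longrightarrow> (\<forall>\<^sub>F q in nhds p. \<forall>u\<in>{a..b}. proj L (j, u) = q \<longrightarrow> cone q)"
      proof (cases "proj L (j, t) = p")
        case True
        have x: "(j, frac t) \<in> branches L p"
          using True frac_params[OF j] proj_frac[OF j] by (simp add: branches_def)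
        obtain \<delta> where \<delta>: "\<delta> > 0" "\<And>u s. \<bar>u - t\<bar> \<le> \<delta> \<Longrightarrow> \<bar>s - t\<bar> \<le> \<delta> \<Longrightarrow>
          \<bar>Im ((proj L (j, u) - proj L (j, s)) / tangent L (j, t))\<bar> \<le> \<eta> (j, frac t) * \<bar>Re ((proj L (j, u) - proj L (j, s)) / tangent L (j, t))\<bar>"
          using tangent_cone[OF assms[OF x], of t] by blast
        have "cone (proj L (j, u))" if "\<bar>u - t\<bar> \<le> \<delta>" for u
          unfolding cone_def
          by (rule bexI[OF _ x]) (use \<delta>(2)[of u t] \<delta>(1) that True tangent_frac[OF j, of t] in simp)
        then have "\<forall>\<^sub>F q in nhds p. \<forall>u\<in>{a..b}. proj L (j, u) = q \<longrightarrow> cone q"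
          if "a \<le> t" "t \<le> b" "b - a < \<delta>" for a b
          by (intro always_eventually) (use that in auto)
        then show ?thesis using \<delta>(1) by blast
      next
        case False
        obtain U V where UV: "open U" "open V" "proj L (j, t) \<in> U" "p \<in> V" "U \<inter> V = {}"
          using hausdorff[OF False] by blast
        obtain \<delta> where \<delta>: "\<delta> > 0" "\<And>u. dist u t < \<delta> \<Longrightarrow> proj L (j, u) \<in> U"
          using topological_tendstoD[OF isCont_curve[of t, unfolded isCont_def] UV(1,3)] UV(3)
          unfolding eventually_at by auto metis
        have "\<forall>\<^sub>F q in nhds p. q \<in> V" using UV by (intro eventually_nhds_in_open) auto
        then have "\<forall>\<^sub>F q in nhds p. \<forall>u\<in>{a..b}. proj L (j, u) = q \<longrightarrow> cone q"
          if "a \<le> t" "t \<le> b" "b - a < \<delta>" for a b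
        proof (rule eventually_mono)
          have U: "proj L (j, u) \<in> U" if "u \<in> {a..b}" for u
            by (rule \<delta>(2)) (use that \<open>a \<le> t\<close> \<open>t \<le> b\<close> \<open>b - a < \<delta>\<close> in \<open>auto simp: dist_real_def\<close>)
          fix q assume "q \<in> V"
          then show "\<forall>u\<in>{a..b}. proj L (j, u) = q \<longrightarrow> cone q" using U UV(5) by (metis IntI empty_iff)
        qed
        then show ?thesis using \<delta>(1) by blast
      qed
    qed auto
  qed
  then have "\<forall>\<^sub>F q in nhds p. \<forall>j\<in>{..<length L}. \<forall>u\<in>{0..1}. proj L (j, u) = q \<longrightarrow> cone q"
    by (intro eventually_ball_finite) auto
  then show ?thesis unfolding cone_def[symmetric]
    by (rule eventually_mono) (auto simp: image_eq)
qed

end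

section \<open>Approaching a point of the diagram from a given direction\<close>

text \<open>The sign of \<open>\<sigma>\<close> selects the side, so that both one-sided limits live
  over \<open>at_right 0\<close>.\<close>

lemma has_vector_derivative_one_sided:
  fixes g :: "real \<Rightarrow> complex"
  assumes "(g has_vector_derivative D) (at s)"
  shows "((\<lambda>r. (g (s + \<sigma> * r) - g s) / of_real r) \<longlongrightarrow> of_real \<sigma> * D) (at_right 0)"
proof -
  have "((\<lambda>r. s + \<sigma> * r) has_vector_derivative \<sigma>) (at 0)"
    by (auto intro!: derivative_eq_intros simp: has_vector_derivative_def)
  from vector_diff_chain_at[OF this, of g D] assms
  have "((\<lambda>r. g (s + \<sigma> * r)) has_vector_derivative \<sigma> *\<^sub>R D) (at 0)" by (simp add: o_def)
  then have "(\<lambda>h. norm (g (s + \<sigma> * h) - g s - h *\<^sub>R \<sigma> *\<^sub>R D) / norm h) \<midarrow>0\<rightarrow> 0"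
    unfolding has_vector_derivative_def has_derivative_at by simp
  then have "(\<lambda>h. norm ((g (s + \<sigma> * h) - g s) / of_real h - of_real \<sigma> * D)) \<midarrow>0\<rightarrow> 0"
  proof (rule Lim_transform_eventually)
    have "norm (g (s + \<sigma> * h) - g s - h *\<^sub>R \<sigma> *\<^sub>R D) / norm h
      = norm ((g (s + \<sigma> * h) - g s) / of_real h - of_real \<sigma> * D)" if "h \<noteq> 0" for h
    proof -
      have "(g (s + \<sigma> * h) - g s) / of_real h - of_real \<sigma> * D
        = (g (s + \<sigma> * h) - g s - h *\<^sub>R \<sigma> *\<^sub>R D) / of_real h"
        using that by (simp add: diff_divide_distrib scaleR_conv_of_real)
      then show ?thesis by (simp add: norm_divide)
    qed
    then show "\<forall>\<^sub>F h in at 0. norm (g (s + \<sigma> * h) - g s - h *\<^sub>R \<sigma> *\<^sub>R D) / norm h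
      = norm ((g (s + \<sigma> * h) - g s) / of_real h - of_real \<sigma> * D)"
      by (simp add: eventually_at_filter)
  qed
  then have "(\<lambda>h. (g (s + \<sigma> * h) - g s) / of_real h) \<midarrow>0\<rightarrow> of_real \<sigma> * D"
    using Lim_null tendsto_norm_zero_iff by blast
  then show ?thesis by (rule tendsto_mono[rotated]) (simp add: at_le)
qed

lemma tendsto_of_quotient:
  fixes h :: "real \<Rightarrow> complex"
  assumes "((\<lambda>r. (h r - p) / of_real r) \<longlongrightarrow> d) (at_right 0)"
  shows "(h \<longlongrightarrow> p) (at_right 0)"
proof -
  have "((\<lambda>r. p + of_real r * ((h r - p) / of_real r)) \<longlongrightarrow> p + of_real 0 * d) (at_right 0)"
    by (intro tendsto_intros assms)
  moreover have "\<forall>\<^sub>F r in at_right (0::real). p + of_real r * ((h r - p) / of_real r) = h r"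
    using eventually_at_right_less[of 0] by (rule eventually_mono) simp
  ultimately show ?thesis by (simp add: Lim_transform_eventually)
qed

text \<open>A curve leaving \<open>p\<close> transversely to the line of \<open>v\<close> eventually
  stays in a sector that excludes this line; such sectors are where \<open>decides\<close>
  prescribes the side.\<close>

lemma eventually_in_sector:
  fixes h :: "real \<Rightarrow> complex"
  assumes lim: "((\<lambda>r. (h r - p) / of_real r) \<longlongrightarrow> d) (at_right 0)"
    and "v \<noteq> 0" "det2 v d \<noteq> 0"
  shows "\<exists>\<eta>>0. \<forall>\<^sub>F r in at_right 0. if det2 v d > 0 then Im ((h r - p) / v) > \<eta> * \<bar>Re ((h r - p) / v)\<bar>
       else Im ((h r - p) / v) < - (\<eta> * \<bar>Re ((h r - p) / v)\<bar>)"
proof -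
  define s :: real where "s = (if det2 v d > 0 then 1 else -1)"
  \<comment> \<open>At most half the slope of \<open>d\<close>, so that \<open>d\<close> itself lies
    strictly inside the sector; the summand 1 covers directions with real part 0.\<close>
  define \<eta> where "\<eta> = \<bar>Im (d / v)\<bar> / (2 * (1 + \<bar>Re (d / v)\<bar>))"
  have Im: "Im (d / v) \<noteq> 0" using assms det2_sign_iff by blast
  then have \<eta>: "\<eta> > 0" by (auto simp: \<eta>_def intro!: divide_pos_pos)
  have "s * Im (d / v) = \<bar>Im (d / v)\<bar>"
    using det2_sign_iff[OF \<open>v \<noteq> 0\<close>, of d] assms(3) by (auto simp: s_def)
  moreover have "\<eta> * \<bar>Re (d / v)\<bar> \<le> \<bar>Im (d / v)\<bar> / 2"
    unfolding \<eta>_def by (simp add: field_simps)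
  ultimately have pos: "s * Im (d / v) - \<eta> * \<bar>Re (d / v)\<bar> > 0" using Im by simp
  have "((\<lambda>r. s * Im ((h r - p) / of_real r / v) - \<eta> * \<bar>Re ((h r - p) / of_real r / v)\<bar>) \<longlongrightarrow>
      s * Im (d / v) - \<eta> * \<bar>Re (d / v)\<bar>) (at_right 0)"
    by (intro tendsto_intros lim \<open>v \<noteq> 0\<close>)
  from order_tendstoD(1)[OF this pos]
  have "\<forall>\<^sub>F r in at_right 0. s * Im ((h r - p) / v) > \<eta> * \<bar>Re ((h r - p) / v)\<bar>"
    using eventually_at_right_less[of 0]
  proof eventually_elim
    case (elim r)
    define w where "w = (h r - p) / of_real r / v"
    have w: "(h r - p) / v = r *\<^sub>R w" using elim(2) by (simp add: w_def scaleR_conv_of_real)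
    have "s * Im ((h r - p) / v) - \<eta> * \<bar>Re ((h r - p) / v)\<bar> = r * (s * Im w - \<eta> * \<bar>Re w\<bar>)"
      unfolding w using elim(2) by (simp add: abs_mult algebra_simps)
    moreover have "r * (s * Im w - \<eta> * \<bar>Re w\<bar>) > 0" using elim unfolding w_def by (intro mult_pos_pos)
    ultimately show ?case by linarith
  qed
  then have "\<forall>\<^sub>F r in at_right 0. if det2 v d > 0 then Im ((h r - p) / v) > \<eta> * \<bar>Re ((h r - p) / v)\<bar>
       else Im ((h r - p) / v) < - (\<eta> * \<bar>Re ((h r - p) / v)\<bar>)"
    by (rule eventually_mono) (auto simp: s_def)
  then show ?thesis using \<eta> by blast
qed

context link_diagram begin

lemma branches_nonempty: "p \<in> D \<Longrightarrow> branches L p \<noteq> {}"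
  by (auto simp: diagram_image_def branches_def)

lemma branch_tangent_nonzero: "x \<in> branches L p \<Longrightarrow> tangent L x \<noteq> 0"
  by (simp add: branches_def tangent_nonzero_params)

text \<open>The special case in which the apex of the cones is the branch point itself.\<close>

lemma decidesD:
  assumes "decides x left" "\<eta> > 0"
  shows "\<forall>\<^sub>F q in nhds (proj L x).
    (Im ((q - proj L x) / tangent L x) > \<eta> * \<bar>Re ((q - proj L x) / tangent L x)\<bar> \<longrightarrow> left q) \<and>
    (Im ((q - proj L x) / tangent L x) < - (\<eta> * \<bar>Re ((q - proj L x) / tangent L x)\<bar>) \<longrightarrow> \<not> left q)"
proof -
  obtain \<delta> where \<delta>: "\<delta> > 0" "\<forall>\<^sub>F q in nhds (proj L x). \<forall>u. \<bar>u - snd x\<bar> < \<delta> \<longrightarrow>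
     (Im ((q - proj L (fst x, u)) / tangent L x) > \<eta> * \<bar>Re ((q - proj L (fst x, u)) / tangent L x)\<bar> \<longrightarrow> left q) \<and>
     (Im ((q - proj L (fst x, u)) / tangent L x) < - (\<eta> * \<bar>Re ((q - proj L (fst x, u)) / tangent L x)\<bar>) \<longrightarrow> \<not> left q)"
    using assms unfolding decides_def by blast
  show ?thesis using \<delta>(2) by (rule eventually_mono) (use \<delta>(1) in \<open>auto dest: spec[of _ "snd x"]\<close>)
qed

text \<open>Transversality puts \<open>h r\<close> into the deciding sector of every branch, which
  turns the local count into the number of branches with \<open>d\<close> on their left. With the
  same apertures, \<open>image_near_tangents\<close> keeps the diagram out of the common part of
  these sectors.\<close>

lemma directional_limit:
  assumes lim: "((\<lambda>r. (h r - p) / of_real r) \<longlongrightarrow> d) (at_right 0)"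
    and "p \<in> D" and d: "\<And>x. x \<in> branches L p \<Longrightarrow> det2 (tangent L x) d \<noteq> 0"
  shows "\<forall>\<^sub>F r in at_right 0. h r \<notin> D \<and>
    wind L (h r) = base p + (\<Sum>x\<in>branches L p. of_bool (det2 (tangent L x) d > 0))"
proof -
  have hp: "(h \<longlongrightarrow> p) (at_right 0)" using tendsto_of_quotient[OF lim] .
  define Q where "Q x \<eta> r \<longleftrightarrow> (if det2 (tangent L x) d > 0
      then Im ((h r - p) / tangent L x) > \<eta> * \<bar>Re ((h r - p) / tangent L x)\<bar>
      else Im ((h r - p) / tangent L x) < - (\<eta> * \<bar>Re ((h r - p) / tangent L x)\<bar>))" for x \<eta> r
  have "\<exists>\<eta>>0. \<forall>\<^sub>F r in at_right 0. Q x \<eta> r" if "x \<in> branches L p" for x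
    unfolding Q_def using eventually_in_sector[OF lim branch_tangent_nonzero[OF that] d[OF that]] .
  then obtain \<eta> where \<eta>: "\<And>x. x \<in> branches L p \<Longrightarrow> \<eta> x > 0"
    "\<And>x. x \<in> branches L p \<Longrightarrow> \<forall>\<^sub>F r in at_right 0. Q x (\<eta> x) r" by metis
  have Q: "\<forall>\<^sub>F r in at_right 0. \<forall>x\<in>branches L p. Q x (\<eta> x) r"
    using \<eta>(2) by (intro eventually_ball_finite finite_branches) auto
  obtain left where left: "base_data p (base p) left" using base by blast
  have L1: "\<forall>\<^sub>F q in nhds p. q \<noteq> p \<longrightarrow> q \<notin> D \<longrightarrow> wind L q = base p + (\<Sum>x\<in>branches L p. of_bool (left x q))"
    using left unfolding base_data_def eventually_at_filter by auto
  have L2: "\<forall>\<^sub>F q in nhds p. \<forall>x\<in>branches L p.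
    (Im ((q - p) / tangent L x) > \<eta> x * \<bar>Re ((q - p) / tangent L x)\<bar> \<longrightarrow> left x q) \<and>
    (Im ((q - p) / tangent L x) < - (\<eta> x * \<bar>Re ((q - p) / tangent L x)\<bar>) \<longrightarrow> \<not> left x q)"
  proof (intro eventually_ball_finite finite_branches ballI)
    fix x assume x: "x \<in> branches L p"
    then have "decides x (left x)" "proj L x = p"
      using left unfolding base_data_def by (blast, simp add: branches_def)
    then show "\<forall>\<^sub>F q in nhds p. (Im ((q - p) / tangent L x) > \<eta> x * \<bar>Re ((q - p) / tangent L x)\<bar> \<longrightarrow> left x q) \<and>
    (Im ((q - p) / tangent L x) < - (\<eta> x * \<bar>Re ((q - p) / tangent L x)\<bar>) \<longrightarrow> \<not> left x q)"
      using decidesD[of x "left x" "\<eta> x"] \<eta>(1)[OF x] by simp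
  qed
  have near: "\<forall>\<^sub>F q in nhds p. q \<in> D \<longrightarrow>
    (\<exists>x\<in>branches L p. \<bar>Im ((q - p) / tangent L x)\<bar> \<le> \<eta> x * \<bar>Re ((q - p) / tangent L x)\<bar>)"
    using image_near_tangents[of p \<eta>] \<eta>(1) by blast
  from Q filterlim_iff[THEN iffD1, OF hp, rule_format, OF L1] filterlim_iff[THEN iffD1, OF hp, rule_format, OF L2]
    filterlim_iff[THEN iffD1, OF hp, rule_format, OF near]
  show ?thesis
  proof eventually_elim
    case (elim r)
    have "h r \<notin> D"
    proof
      assume "h r \<in> D"
      then obtain x where "x \<in> branches L p" "\<bar>Im ((h r - p) / tangent L x)\<bar> \<le> \<eta> x * \<bar>Re ((h r - p) / tangent L x)\<bar>"
        using elim(4) by blast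
      then show False using elim(1) unfolding Q_def by (auto split: if_splits dest!: bspec)
    qed
    moreover have "h r \<noteq> p" using \<open>h r \<notin> D\<close> \<open>p \<in> D\<close> by auto
    moreover have "left x (h r) \<longleftrightarrow> det2 (tangent L x) d > 0" if "x \<in> branches L p" for x
    proof -
      have "Q x (\<eta> x) r" using elim(1) that by blast
      then show ?thesis using elim(3) that unfolding Q_def by (cases "det2 (tangent L x) d > 0") auto
    qed
    ultimately show ?case using elim(2) by simp
  qed
qed

definition double_points :: "complex set" where
  "double_points = (\<lambda>x. proj L (fst x)) ` crossings L"

lemma finite_crossings: "finite (crossings L)"
  using diagram unfolding knot_diagram_def by blast

lemma inj_space_point: "inj_on (space_point L) (params L)"
  using diagram unfolding knot_diagram_def oriented_link_def by blast

text \<open>The link is embedded in space, so two branches over one point have different heights and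
  one of them is the over-strand.\<close>

lemma crossing_of_branches:
  assumes "x \<in> branches L p" "y \<in> branches L p" "x \<noteq> y"
  shows "(x, y) \<in> crossings L \<or> (y, x) \<in> crossings L"
proof -
  have "space_point L x \<noteq> space_point L y"
    using assms inj_space_point by (auto simp: branches_def inj_on_def)
  then have "height L x \<noteq> height L y"
    using assms by (auto simp: branches_def proj_def height_def prod_eq_iff)
  then show ?thesis using assms by (auto simp: crossings_def branches_def)
qed

lemma branches_crossing:
  assumes "(x, y) \<in> crossings L"
  shows "branches L (proj L x) = {x, y}" "x \<noteq> y" "det2 (tangent L x) (tangent L y) \<noteq> 0"
    "det2 (tangent L y) (tangent L x) \<noteq> 0"
proof -
  have xy: "x \<in> params L" "y \<in> params L" "proj L x = proj L y" "x \<noteq> y"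
    using assms by (auto simp: crossings_def)
  have "z = x \<or> z = y" if "z \<in> params L" "proj L z = proj L x" for z
    using diagram xy that unfolding knot_diagram_def by metis
  then show "branches L (proj L x) = {x, y}" using xy by (auto simp: branches_def)
  show "x \<noteq> y" by fact
  show "det2 (tangent L x) (tangent L y) \<noteq> 0" "det2 (tangent L y) (tangent L x) \<noteq> 0"
    using diagram xy unfolding knot_diagram_def by metis+
qed

lemma branches_simple:
  assumes "x \<in> branches L p" "p \<notin> double_points"
  shows "branches L p = {x}"
proof -
  have "y = x" if "y \<in> branches L p" for y
    using crossing_of_branches[OF assms(1) that] assms that
    by (force simp: double_points_def branches_def)
  then show ?thesis using assms by blast
qed

lemma transverse_branches:
  assumes "x \<in> branches L p" "y \<in> branches L p" "x \<noteq> y"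
  shows "det2 (tangent L x) (tangent L y) \<noteq> 0"
  using assms diagram unfolding knot_diagram_def branches_def by auto

lemma proj_strand_quotient:
  assumes "j < length L"
  shows "((\<lambda>r. (proj L (j, t + \<sigma> * r) - proj L (j, t)) / of_real r) \<longlongrightarrow> of_real \<sigma> * tangent L (j, t)) (at_right 0)"
  using has_vector_derivative_one_sided[OF has_tangent(1)[OF assms]] .

text \<open>The nonzero tangent makes the strand leave its starting point at once; every other point
  is avoided by continuity.\<close>

lemma proj_strand_avoids:
  assumes "j < length L" "\<sigma> \<noteq> 0" "finite P"
  shows "\<forall>\<^sub>F r in at_right 0. proj L (j, t + \<sigma> * r) \<notin> P"
proof -
  have "\<forall>\<^sub>F r in at_right 0. proj L (j, t + \<sigma> * r) \<noteq> z" for z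
  proof (cases "z = proj L (j, t)")
    case True
    have "of_real \<sigma> * tangent L (j, t) \<noteq> 0" using assms tangent_nonzero by simp
    from tendsto_imp_eventually_ne[OF proj_strand_quotient[OF assms(1)] this]
    show ?thesis by (rule eventually_mono) (use True in auto)
  next
    case False
    show ?thesis
      using tendsto_imp_eventually_ne[OF tendsto_of_quotient[OF proj_strand_quotient[OF assms(1)]], of t z] False by simp
  qed
  then have "\<forall>\<^sub>F r in at_right 0. \<forall>z\<in>P. proj L (j, t + \<sigma> * r) \<noteq> z"
    using assms(3) by (intro eventually_ball_finite) auto
  then show ?thesis by (rule eventually_mono) auto
qed

lemma finite_double_points: "finite double_points"
  unfolding double_points_def using finite_crossings by blast

text \<open>Both sides are compared at a point just to the right of the strand: near \<open>p\<close> its winding number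
  is read off from the local picture at \<open>p\<close>, where only the other strand contributes, and near
  the moved point from the local picture there.\<close>
lemma base_along_strand:
  assumes x: "x \<in> params L" and \<sigma>: "\<sigma> = 1 \<or> \<sigma> = -1"
  defines "p \<equiv> proj L x"
  shows "\<forall>\<^sub>F r in at_right 0. base (proj L (fst x, snd x + \<sigma> * r)) = base p +
    (\<Sum>y\<in>branches L p - {x}. of_bool (\<sigma> * det2 (tangent L y) (tangent L x) > 0))"
proof -
  obtain j t where xjt: "x = (j, t)" by fastforce
  have j: "j < length L" using x xjt by (auto simp: params_def)
  define v where "v = tangent L x"
  have v: "v \<noteq> 0" using tangent_nonzero[OF j] by (simp add: v_def xjt)
  define h where "h r = proj L (j, t + \<sigma> * r)" for r
  have xb: "x \<in> branches L p" using x by (simp add: branches_def p_def)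
  have quot: "((\<lambda>r. (h r - p) / of_real r) \<longlongrightarrow> of_real \<sigma> * v) (at_right 0)"
    using proj_strand_quotient[OF j, of t \<sigma>] by (simp add: h_def p_def xjt v_def)
  have hp: "(h \<longlongrightarrow> p) (at_right 0)" using tendsto_of_quotient[OF quot] .
  \<comment> \<open>Perpendicular to the strand and pointing to its right.\<close>
  define d where "d = - \<i> * v"
  define up where "up y \<longleftrightarrow> \<sigma> * det2 (tangent L y) v > 0" for y
  define Q where "Q y \<eta> q \<longleftrightarrow> (if up y
      then Im ((q - p) / tangent L y) > \<eta> * \<bar>Re ((q - p) / tangent L y)\<bar>
      else Im ((q - p) / tangent L y) < - (\<eta> * \<bar>Re ((q - p) / tangent L y)\<bar>))" for y \<eta> q
  have up: "up y \<longleftrightarrow> det2 (tangent L y) (of_real \<sigma> * v) > 0" for y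
    using \<sigma> by (auto simp: up_def det2_def)
  have "\<exists>\<eta>>0. \<forall>\<^sub>F r in at_right 0. Q y \<eta> (h r)" if "y \<in> branches L p - {x}" for y
  proof -
    have "det2 (tangent L y) v \<noteq> 0" unfolding v_def using transverse_branches[of y p x] that xb by blast
    then have "det2 (tangent L y) (of_real \<sigma> * v) \<noteq> 0" using \<sigma> by (auto simp: det2_def)
    from eventually_in_sector[OF quot branch_tangent_nonzero[of y p] this] that
    show ?thesis unfolding Q_def up by blast
  qed
  then obtain \<eta> where \<eta>: "\<And>y. y \<in> branches L p - {x} \<Longrightarrow> \<eta> y > 0"
    "\<And>y. y \<in> branches L p - {x} \<Longrightarrow> \<forall>\<^sub>F r in at_right 0. Q y (\<eta> y) (h r)" by metis
  have Q: "\<forall>\<^sub>F r in at_right 0. \<forall>y\<in>branches L p - {x}. Q y (\<eta> y) (h r)"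
    using \<eta>(2) finite_branches by (intro eventually_ball_finite) auto
  obtain left where left: "base_data p (base p) left" using base by blast
  have L1: "\<forall>\<^sub>F q in nhds p. q \<noteq> p \<longrightarrow> q \<notin> D \<longrightarrow> wind L q = base p + (\<Sum>x\<in>branches L p. of_bool (left x q))"
    using left unfolding base_data_def eventually_at_filter by auto
  have L2: "\<forall>\<^sub>F q in nhds p. \<forall>y\<in>branches L p - {x}. Q y (\<eta> y) q \<longrightarrow> (left y q \<longleftrightarrow> up y)"
  proof (intro eventually_ball_finite ballI)
    fix y assume y: "y \<in> branches L p - {x}"
    then have "decides y (left y)" "proj L y = p"
      using left unfolding base_data_def by (blast, simp add: branches_def)
    from decidesD[OF this(1) \<eta>(1)[OF y], unfolded this(2)]
    show "\<forall>\<^sub>F q in nhds p. Q y (\<eta> y) q \<longrightarrow> (left y q \<longleftrightarrow> up y)"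
      by (rule eventually_mono) (auto simp: Q_def)
  qed (use finite_branches in auto)
  have dec: "decides x (left x)" using left xb by (auto simp: base_data_def)
  \<comment> \<open>The apex is now a moving point \<open>proj L (j, u)\<close> of the strand.
    Aperture 1 is enough, as the points to be tested are pushed off along \<open>d\<close>,
    perpendicularly to \<open>v\<close>.\<close>
  then obtain \<delta> where \<delta>: "\<delta> > 0" and L3: "\<forall>\<^sub>F q in nhds p. \<forall>u. \<bar>u - t\<bar> < \<delta> \<longrightarrow>
     Im ((q - proj L (j, u)) / v) < - \<bar>Re ((q - proj L (j, u)) / v)\<bar> \<longrightarrow> \<not> left x q"
  proof -
    obtain \<delta> where "\<delta> > 0" and *: "\<forall>\<^sub>F q in nhds (proj L x). \<forall>u. \<bar>u - snd x\<bar> < \<delta> \<longrightarrow>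
     (Im ((q - proj L (fst x, u)) / tangent L x) > 1 * \<bar>Re ((q - proj L (fst x, u)) / tangent L x)\<bar> \<longrightarrow> left x q) \<and>
     (Im ((q - proj L (fst x, u)) / tangent L x) < - (1 * \<bar>Re ((q - proj L (fst x, u)) / tangent L x)\<bar>) \<longrightarrow> \<not> left x q)"
      using dec[unfolded decides_def, rule_format, OF zero_less_one] by blast
    have "\<forall>\<^sub>F q in nhds p. \<forall>u. \<bar>u - t\<bar> < \<delta> \<longrightarrow>
     Im ((q - proj L (j, u)) / v) < - \<bar>Re ((q - proj L (j, u)) / v)\<bar> \<longrightarrow> \<not> left x q"
      unfolding p_def using * by (rule eventually_mono) (auto simp: v_def xjt)
    then show ?thesis using that \<open>\<delta> > 0\<close> by blast
  qed
  \<comment> \<open>The facts valid near \<open>p\<close> are bundled into one predicate, because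
    they will be used on a whole neighbourhood of the moved point \<open>h r\<close>, not just at
    \<open>h r\<close> itself.\<close>
  define good where "good q \<longleftrightarrow> (q \<noteq> p \<longrightarrow> q \<notin> D \<longrightarrow> wind L q = base p + (\<Sum>x\<in>branches L p. of_bool (left x q))) \<and>
    (\<forall>y\<in>branches L p - {x}. Q y (\<eta> y) q \<longrightarrow> (left y q \<longleftrightarrow> up y)) \<and>
    (\<forall>u. \<bar>u - t\<bar> < \<delta> \<longrightarrow> Im ((q - proj L (j, u)) / v) < - \<bar>Re ((q - proj L (j, u)) / v)\<bar> \<longrightarrow> \<not> left x q)" for q
  have "\<forall>\<^sub>F q in nhds p. good q" unfolding good_def using L1 L2 L3 by eventually_elim blast
  then have "\<forall>\<^sub>F q in nhds p. \<forall>\<^sub>F q' in nhds q. good q'" by (simp add: eventually_eventually)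
  then have G: "\<forall>\<^sub>F r in at_right 0. \<forall>\<^sub>F q in nhds (h r). good q"
    using hp unfolding filterlim_iff by blast
  have S: "\<forall>\<^sub>F r in at_right 0. h r \<notin> double_points"
    unfolding h_def using \<sigma> by (intro proj_strand_avoids[OF j] finite_double_points) auto
  have "((\<lambda>r. t + \<sigma> * r) \<longlongrightarrow> t) (at_right 0)" by (auto intro!: tendsto_eq_intros)
  moreover have "isCont (\<lambda>s. tangent L (j, s)) t"
    using has_tangent(2)[OF j] by (simp add: continuous_on_eq_continuous_at)
  ultimately have tl: "((\<lambda>r. tangent L (j, t + \<sigma> * r)) \<longlongrightarrow> v) (at_right 0)"
    unfolding v_def xjt using isCont_tendsto_compose by blast
  \<comment> \<open>By continuity of the tangent, \<open>d\<close> still points to the right of the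
    strand at the moved point.\<close>
  have "((\<lambda>r. det2 (tangent L (j, t + \<sigma> * r)) d) \<longlongrightarrow> det2 v d) (at_right 0)"
    unfolding det2_def by (intro tendsto_intros tl)
  moreover have "det2 v d < 0" using det2_sign_iff(2)[OF v, of d] v by (simp add: d_def)
  ultimately have N: "\<forall>\<^sub>F r in at_right 0. det2 (tangent L (j, t + \<sigma> * r)) d < 0"
    by (rule order_tendstoD)
  have B: "\<forall>\<^sub>F r in at_right 0. \<bar>\<sigma> * r\<bar> < \<delta>"
    using eventually_at_right_less[of 0] eventually_at_right_real[OF \<delta>]
    by eventually_elim (use \<sigma> in auto)
  from Q G S N B show ?thesis unfolding up_def[symmetric] v_def[symmetric]
  proof eventually_elim
    case (elim r)
    define p' where "p' = h r"
    \<comment> \<open>\<open>r\<close> stays fixed while \<open>\<rho>\<close> tends to 0: the test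
      point approaches the moved point from the right of the strand.\<close>
    define k where "k \<rho> = p' + of_real \<rho> * d" for \<rho> :: real
    have p'D: "p' \<in> D" using proj_in_image[OF j] by (simp add: p'_def h_def)
    have br: "branches L p' = {(j, frac (t + \<sigma> * r))}"
      using branches_simple[of "(j, frac (t + \<sigma> * r))" p'] elim(3) frac_params[OF j] proj_frac[OF j]
      by (simp add: branches_def p'_def h_def)
    have neg: "det2 (tangent L y) d < 0" if "y \<in> branches L p'" for y
      using that elim(4) tangent_frac[OF j] unfolding br by auto
    have kq: "((\<lambda>\<rho>. (k \<rho> - p') / of_real \<rho>) \<longlongrightarrow> d) (at_right 0)"
    proof (rule Lim_transform_eventually[OF tendsto_const])
      show "\<forall>\<^sub>F \<rho> in at_right 0. d = (k \<rho> - p') / of_real \<rho>"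
        using eventually_at_right_less[of 0] by (rule eventually_mono) (simp add: k_def)
    qed
    have kp: "(k \<longlongrightarrow> p') (at_right 0)" using tendsto_of_quotient[OF kq] .
    have 1: "\<forall>\<^sub>F \<rho> in at_right 0. k \<rho> \<notin> D \<and> wind L (k \<rho>) = base p' +
        (\<Sum>y\<in>branches L p'. of_bool (det2 (tangent L y) d > 0))"
      using directional_limit[OF kq p'D] neg by (metis less_irrefl)
    have no_left: "(\<Sum>y\<in>branches L p'. of_bool (det2 (tangent L y) d > 0) :: int) = 0"
      using neg by (intro sum.neutral ballI) (simp add: not_less less_imp_le)
    have 2: "\<forall>\<^sub>F \<rho> in at_right 0. good (k \<rho>)"
      using elim(2) kp unfolding filterlim_iff p'_def by blast
    have 3: "\<forall>\<^sub>F \<rho> in at_right 0. \<forall>y\<in>branches L p - {x}. Q y (\<eta> y) (k \<rho>)"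
    proof (intro eventually_ball_finite ballI)
      fix y assume y: "y \<in> branches L p - {x}"
      then have ty: "tangent L y \<noteq> 0" using branch_tangent_nonzero by blast
      have lim: "((\<lambda>\<rho>. Im ((k \<rho> - p) / tangent L y)) \<longlongrightarrow> Im ((p' - p) / tangent L y)) (at_right 0)"
        "((\<lambda>\<rho>. \<eta> y * \<bar>Re ((k \<rho> - p) / tangent L y)\<bar>) \<longlongrightarrow> \<eta> y * \<bar>Re ((p' - p) / tangent L y)\<bar>) (at_right 0)"
        by (intro tendsto_intros kp ty)+
      have Qy: "Q y (\<eta> y) p'" using elim(1) y by (simp add: p'_def)
      show "\<forall>\<^sub>F \<rho> in at_right 0. Q y (\<eta> y) (k \<rho>)"
      proof (cases "up y")
        case True
        then show ?thesis using Qy order_tendstoD(1)[OF tendsto_diff[OF lim], of 0]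
          by (auto simp: Q_def elim: eventually_mono)
      next
        case False
        then show ?thesis using Qy order_tendstoD(2)[OF tendsto_add[OF lim], of 0]
          by (auto simp: Q_def elim: eventually_mono)
      qed
    qed (use finite_branches in auto)
    \<comment> \<open>The equation does not involve \<open>\<rho>\<close>; a single suitable
      \<open>\<rho>\<close> proves it.\<close>
    have "\<forall>\<^sub>F \<rho> in at_right (0::real). base p' = base p + (\<Sum>y\<in>branches L p - {x}. of_bool (up y))"
      using 1 2 3 eventually_at_right_less[of 0]
    proof eventually_elim
      case (elim \<rho>)
      have "k \<rho> \<notin> D" and w: "wind L (k \<rho>) = base p'"
        using elim(1) no_left by auto
      moreover have "p \<in> D" using x by (simp add: p_def diagram_image_def)
      ultimately have w': "wind L (k \<rho>) = base p + (\<Sum>x\<in>branches L p. of_bool (left x (k \<rho>)))"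
        using elim(2) unfolding good_def by metis
      have "(k \<rho> - proj L (j, t + \<sigma> * r)) / v = of_real \<rho> * (- \<i>)"
        using v by (simp add: k_def p'_def h_def d_def)
      then have "\<not> left x (k \<rho>)"
        using elim(2,4) \<open>\<bar>\<sigma> * r\<bar> < \<delta>\<close> unfolding good_def by (auto dest!: spec[of _ "t + \<sigma> * r"])
      moreover have "left y (k \<rho>) \<longleftrightarrow> up y" if "y \<in> branches L p - {x}" for y
        using elim(2,3) that unfolding good_def by blast
      ultimately show ?case
        using w w' sum.remove[OF finite_branches xb, of "\<lambda>x. of_bool (left x (k \<rho>)) :: int"] by simp
    qed
    then show ?case
      by (simp add: p'_def h_def xjt)
  qed
qed

end

section \<open>Indices of regions\<close>

text \<open>Solutions are isolated, and bisection plays the part of compactness.\<close>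

lemma finite_level_set:
  fixes f :: "real \<Rightarrow> real"
  assumes "\<And>t. a \<le> t \<Longrightarrow> t \<le> b \<Longrightarrow> \<forall>\<^sub>F u in at t. f u \<noteq> c" "a \<le> b"
  shows "finite {t\<in>{a..b}. f t = c}"
proof (rule Bolzano[where P = "\<lambda>a b. finite {t\<in>{a..b}. f t = c}"])
  fix x y z assume "finite {t\<in>{x..y}. f t = c}" "finite {t\<in>{y..z}. f t = c}"
  then have "finite ({t\<in>{x..y}. f t = c} \<union> {t\<in>{y..z}. f t = c})" by blast
  then show "finite {t\<in>{x..z}. f t = c}" by (rule rev_finite_subset) auto
next
  fix t assume t: "a \<le> t" "t \<le> b"
  then obtain d where d: "d > 0" "\<And>u. u \<noteq> t \<Longrightarrow> dist u t < d \<Longrightarrow> f u \<noteq> c"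
    using assms(1) unfolding eventually_at by blast
  have "finite {u\<in>{x..y}. f u = c}" if "x \<le> t" "t \<le> y" "y - x < d" for x y
  proof (rule finite_subset)
    show "{u\<in>{x..y}. f u = c} \<subseteq> {t}" using d(2) that by (force simp: dist_real_def)
  qed simp
  then show "\<exists>d>0. \<forall>x y. x \<le> t \<and> t \<le> y \<and> y - x < d \<longrightarrow> finite {u\<in>{x..y}. f u = c}"
    using d(1) by blast
qed (use assms in auto)

lemma eventually_at_left_to_right0:
  "eventually P (at_left (s::real)) \<longleftrightarrow> eventually (\<lambda>r. P (s - r)) (at_right 0)"
proof -
  have "eventually P (at_left s) \<longleftrightarrow> eventually (\<lambda>x. P (- x)) (at_right (- s))"
    by (simp add: at_left_minus eventually_filtermap)
  also have "\<dots> \<longleftrightarrow> eventually (\<lambda>r. P (s - r)) (at_right 0)"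
    by (subst eventually_at_right_to_0) simp
  finally show ?thesis .
qed

lemma eventually_at_right_to_right0:
  "eventually P (at_right (s::real)) \<longleftrightarrow> eventually (\<lambda>r. P (s + r)) (at_right 0)"
  by (subst eventually_at_right_to_0) (simp add: add.commute)

text \<open>One-dimensional Sard, transported to \<open>real^1\<close>: a vanishing derivative has
  rank 0, below the dimension 1.\<close>

lemma negligible_critical_values:
  fixes f f' :: "real \<Rightarrow> real"
  assumes "\<And>t. (f has_real_derivative f' t) (at t)"
  shows "negligible {f t | t. f' t = 0}"
proof -
  define F :: "real^1 \<Rightarrow> real^1" where "F x = (\<chi> i. f (x $ 1))" for x
  define S where "S = {x::real^1. f' (x $ 1) = 0}"
  have "negligible (F ` S)"
  proof (rule baby_Sard)
    fix x assume x: "x \<in> S"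
    have "((\<lambda>x. f (x $ 1)) has_derivative (\<lambda>h. f' (x $ 1) * h $ 1)) (at x)"
      using has_derivative_compose[OF bounded_linear_imp_has_derivative[OF bounded_linear_vec_nth[of 1]]
          assms[of "x $ 1", unfolded has_field_derivative_def]] .
    then have "((\<lambda>x. f (x $ 1)) has_derivative (\<lambda>h. 0)) (at x within S)"
      using x by (auto simp: S_def intro: has_derivative_at_withinI)
    then show "(F has_derivative (\<lambda>h. 0)) (at x within S)"
      unfolding F_def by (subst has_derivative_componentwise_within) (auto simp: Basis_vec_def inner_axis)
    have "matrix (\<lambda>h::real^1. 0::real^1) = 0" by (simp add: matrix_def vec_eq_iff)
    then show "rank (matrix (\<lambda>h::real^1. 0::real^1)) < CARD(1)" by simp
  qed simp
  moreover have "(\<lambda>x::real^1. x $ 1) differentiable_on F ` S"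
    using bounded_linear_imp_differentiable_on bounded_linear_vec_nth by blast
  ultimately have "negligible ((\<lambda>x::real^1. x $ 1) ` F ` S)"
    by (rule negligible_differentiable_image_negligible[rotated]) simp
  moreover have "(\<lambda>x::real^1. x $ 1) ` F ` S = {f t | t. f' t = 0}"
  proof -
    have "f t \<in> (\<lambda>x::real^1. x $ 1) ` F ` S" if "f' t = 0" for t
    proof
      show "f t = F (\<chi> i. t) $ 1" by (simp add: F_def)
      show "F (\<chi> i. t) \<in> F ` S" using that by (intro imageI) (simp add: S_def)
    qed
    then show ?thesis by (auto simp: F_def S_def)
  qed
  ultimately show ?thesis by simp
qed

context link_diagram begin

text \<open>Along \<open>g\<close> the winding number is a step function. At a hit,
  \<open>directional_limit\<close> gives its values on both sides, and they differ by 1: passing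
  from left to right leaves the left side of the strand and lowers the winding number. The jumps
  telescope to the difference of the end values.\<close>

lemma wind_transverse_path:
  assumes "\<Delta> \<in> regions L" "\<Delta>' \<in> regions L" "transverse_path L \<Delta> \<Delta>' g" "z \<in> \<Delta>" "z' \<in> \<Delta>'"
  shows "intersection_number L g = wind L z - wind L z'"
proof -
  have g: "path g" "g 0 \<in> \<Delta>" "g 1 \<in> \<Delta>'" "finite (hits L g)"
    and hit: "\<And>s x. (s, x) \<in> hits L g \<Longrightarrow> (\<forall>y\<in>params L. proj L y = proj L x \<longrightarrow> y = x)"
    "\<And>s x. (s, x) \<in> hits L g \<Longrightarrow> (g has_vector_derivative vector_derivative g (at s)) (at s)"
    "\<And>s x. (s, x) \<in> hits L g \<Longrightarrow> det2 (tangent L x) (vector_derivative g (at s)) \<noteq> 0"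
    using assms(3) unfolding transverse_path_def pathstart_def pathfinish_def vector_derivative_works by blast+
  have on: "(s, x) \<in> hits L g \<longleftrightarrow> s \<in> {0..1} \<and> x \<in> branches L (g s)" for s x
    by (auto simp: hits_def branches_def)
  have br: "branches L (g s) = {x}" if "(s, x) \<in> hits L g" for s x
  proof -
    have "y = x" if "y \<in> branches L (g s)" for y
      using hit(1)[OF \<open>(s, x) \<in> hits L g\<close>] that \<open>(s, x) \<in> hits L g\<close> by (auto simp: branches_def hits_def)
    then show ?thesis using on that by blast
  qed
  define S where "S = fst ` hits L g"
  \<comment> \<open>A hit is never at a crossing, so its time determines its branch and the sum over
    hits is a sum over times.\<close>
  have inj: "inj_on fst (hits L g)"
    using br unfolding inj_on_def by (metis on prod.collapse singletonD)
  have S: "s \<in> S \<longleftrightarrow> g s \<in> D" if "s \<in> {0..1}" for s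
  proof
    assume "g s \<in> D"
    then obtain x where "x \<in> branches L (g s)" using branches_nonempty by blast
    then show "s \<in> S" using on[of s x] that unfolding S_def by (metis fst_conv imageI)
  next
    assume "s \<in> S"
    then obtain x where "(s, x) \<in> hits L g" by (auto simp: S_def)
    then show "g s \<in> D" by (auto simp: hits_def diagram_image_def)
  qed
  have "g 0 \<notin> D" "g 1 \<notin> D"
    using region_props(2)[OF assms(1)] region_props(2)[OF assms(2)] g(2,3) by blast+
  then have ends: "0 \<notin> S" "1 \<notin> S"
    using S[of 0] S[of 1] by auto
  define f where "f s = wind L (g s)" for s
  define v where "v s = tangent L (the_elem (branches L (g s)))" for s
  define w where "w s = vector_derivative g (at s)" for s
  \<comment> \<open>Before a hit the path is seen in direction \<open>- w s\<close>, after it in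
    direction \<open>w s\<close>; off the diagram there is no jump.\<close>
  define l where "l s = (if s \<in> S then base (g s) + of_bool (det2 (v s) (- w s) > 0) else f s)" for s
  define r where "r s = (if s \<in> S then base (g s) + of_bool (det2 (v s) (w s) > 0) else f s)" for s
  have hit_lim: "\<forall>\<^sub>F u in at_right 0. f (s + \<sigma> * u) = base (g s) + of_bool (det2 (v s) (of_real \<sigma> * w s) > 0)"
    if s: "s \<in> S" and \<sigma>: "\<sigma> = 1 \<or> \<sigma> = -1" for s \<sigma>
  proof -
    obtain x where x: "(s, x) \<in> hits L g" using s by (auto simp: S_def)
    have b: "branches L (g s) = {x}" and v: "v s = tangent L x" using br[OF x] by (auto simp: v_def)
    have "((\<lambda>u. (g (s + \<sigma> * u) - g s) / of_real u) \<longlongrightarrow> of_real \<sigma> * w s) (at_right 0)"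
      using has_vector_derivative_one_sided[OF hit(2)[OF x]] unfolding w_def .
    moreover have "g s \<in> D" using x by (auto simp: hits_def diagram_image_def)
    moreover have "det2 (tangent L y) (of_real \<sigma> * w s) \<noteq> 0" if "y \<in> branches L (g s)" for y
      using that hit(3)[OF x] \<sigma> unfolding b w_def by (auto simp: det2_def)
    ultimately have "\<forall>\<^sub>F u in at_right 0. g (s + \<sigma> * u) \<notin> D \<and> wind L (g (s + \<sigma> * u)) =
      base (g s) + (\<Sum>x\<in>branches L (g s). of_bool (det2 (tangent L x) (of_real \<sigma> * w s) > 0))"
      by (rule directional_limit)
    then show ?thesis by (rule eventually_mono) (simp add: b v f_def)
  qed
  \<comment> \<open>The filter is relative to \<open>{0..1}\<close>, since a path is known to be
    continuous only there.\<close>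
  have cont: "\<forall>\<^sub>F u in at s within {0..1}. f u = f s" if "s \<in> {0..1}" "s \<notin> S" for s
  proof -
    have "g s \<notin> D" using S that by blast
    moreover have "(g \<longlongrightarrow> g s) (at s within {0..1})"
      using g(1) that unfolding path_def continuous_on by auto
    ultimately show ?thesis
      using wind_locally_constant[of "g s"] unfolding filterlim_iff f_def by blast
  qed
  have "l 1 - r 0 = (\<Sum>s\<in>S \<inter> {0<..<1}. r s - l s)"
  proof (rule jump_sum_interval[where f = f])
    show "finite S" using g by (simp add: S_def)
    fix s :: real assume s: "0 < s" "s \<le> 1"
    show "\<forall>\<^sub>F y in at_left s. f y = l s"
    proof (cases "s \<in> S")
      case True
      from hit_lim[OF this, of "-1"] show ?thesis
        unfolding eventually_at_left_to_right0 l_def using True by simp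
    next
      case False
      have "at_left s = at s within {0..<s}"
        using s by (intro at_within_nhd[of _ "{0<..}"]) auto
      then have "at_left s \<le> at s within {0..1}" using s by (auto intro!: at_le)
      then show ?thesis using cont[of s] s False by (auto simp: l_def le_filter_def)
    qed
  next
    fix s :: real assume s: "0 \<le> s" "s < 1"
    show "\<forall>\<^sub>F y in at_right s. f y = r s"
    proof (cases "s \<in> S")
      case True
      from hit_lim[OF this, of "1"] show ?thesis
        unfolding eventually_at_right_to_right0[of _ s] r_def using True by simp
    next
      case False
      have "at_right s = at s within {s<..1}"
        using s by (intro at_within_nhd[of _ "{..<1}"]) auto
      then have "at_right s \<le> at s within {0..1}" using s by (auto intro!: at_le)
      then show ?thesis using cont[of s] s False by (auto simp: r_def le_filter_def)
    qed
  qed (auto simp: l_def r_def)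
  moreover have "S \<inter> {0<..<1} = S"
  proof -
    have "S \<subseteq> {0..1}" by (auto simp: S_def hits_def)
    then show ?thesis using ends by (force simp: less_le)
  qed
  moreover have "(\<Sum>s\<in>S. r s - l s) = - intersection_number L g"
  proof -
    have "(\<Sum>s\<in>S. r s - l s) = (\<Sum>(s, x)\<in>hits L g. r s - l s)"
      unfolding S_def by (subst sum.reindex[OF inj]) (simp add: case_prod_unfold)
    also have "\<dots> = (\<Sum>(s, x)\<in>hits L g. - (if det2 (tangent L x) (vector_derivative g (at s)) < 0 then 1 else -1))"
    proof (rule sum.cong[OF refl], clarify)
      fix s j t assume x: "(s, j, t) \<in> hits L g"
      then have "s \<in> S" by (force simp: S_def)
      moreover have "v s = tangent L (j, t)" using br[OF x] by (simp add: v_def)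
      ultimately show "r s - l s = - (if det2 (tangent L (j, t)) (vector_derivative g (at s)) < 0 then 1 else -1)"
        using hit(3)[OF x] by (auto simp: r_def l_def w_def det2_def)
    qed
    finally show ?thesis by (simp add: intersection_number_def sum_negf case_prod_unfold)
  qed
  moreover have "l 1 = wind L z'" "r 0 = wind L z"
    using ends g wind_constant[OF region_props(1,2)[OF assms(1)] _ assms(4)]
      wind_constant[OF region_props(1,2)[OF assms(2)] _ assms(5)]
    by (auto simp: l_def r_def f_def)
  ultimately show ?thesis by simp
qed

lemma far_exterior: "\<exists>R>0. \<forall>q. norm q > R \<longrightarrow> q \<in> exterior_region L"
proof -
  obtain R where R: "R > 0" "D \<subseteq> ball 0 R"
    using bounded_subset_ballD[OF compact_imp_bounded[OF compact_image]] by blast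
  let ?O = "- cball (0::complex) R"
  have "connected ?O" by (intro connected_complement_bounded_convex) auto
  moreover have ne: "\<not> bounded ?O" using cobounded_imp_unbounded[of ?O] by simp
  moreover have "?O \<subseteq> - D" using R ball_subset_cball by blast
  ultimately obtain \<Delta> where \<Delta>: "\<Delta> \<in> components (- D)" "?O \<subseteq> \<Delta>"
    using exists_component_superset[of ?O "- D"] by (metis bounded_empty subset_empty)
  have "\<not> bounded \<Delta>" using ne \<Delta>(2) bounded_subset by blast
  then have "\<Delta> = exterior_region L"
    using cobounded_unique_unbounded_components[of "- D" \<Delta> "exterior_region L"] \<Delta>(1) exterior_region
      compact_imp_bounded[OF compact_image] by (simp add: regions_def)
  then show ?thesis using \<Delta>(2) R(1) by (intro exI[of _ R]) auto
qed

text \<open>A vertical segment works if its abscissa is a regular value of the real part of every strand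
  and avoids the double points; by Sard's theorem such abscissae are dense.\<close>
lemma transverse_path_exists:
  assumes "\<Delta> \<in> regions L"
  shows "\<exists>g. transverse_path L \<Delta> (exterior_region L) g"
proof -
  have Re_deriv: "((\<lambda>t. Re (proj L (j, t))) has_real_derivative Re (tangent L (j, t))) (at t)"
    if "j < length L" for j t
    using bounded_linear.has_vector_derivative[OF bounded_linear_Re has_tangent(1)[OF that]]
    by (simp add: has_real_derivative_iff_has_vector_derivative)
  define B where "B = (\<Union>j<length L. {Re (proj L (j, t)) | t. Re (tangent L (j, t)) = 0}) \<union> Re ` double_points"
  have "negligible (\<Union>j<length L. {Re (proj L (j, t)) | t. Re (tangent L (j, t)) = 0})"
    by (rule negligible_Union, simp) (auto intro!: negligible_critical_values Re_deriv)
  then have "negligible B" unfolding B_def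
    by (rule negligible_Un) (intro negligible_finite finite_imageI finite_double_points)
  obtain z0 where z0: "z0 \<in> \<Delta>" using region_props(3)[OF assms] by blast
  obtain e where e: "e > 0" "ball z0 e \<subseteq> \<Delta>" using region_props(4)[OF assms] z0 openE by blast
  \<comment> \<open>Abscissae from this interval keep the start of the vertical path inside the ball
    around \<open>z0\<close>; not being negligible, the interval contains one outside
    \<open>B\<close>.\<close>
  have "\<not> negligible {Re z0 <..< Re z0 + e}"
    using e(1) by (intro open_not_negligible) auto
  then obtain x where x: "x \<in> {Re z0 <..< Re z0 + e}" "x \<notin> B"
    using negligible_subset[OF \<open>negligible B\<close>] by blast
  obtain R where R: "R > 0" "\<And>q. norm q > R \<Longrightarrow> q \<in> exterior_region L" using far_exterior by blast
  define y where "y = Im z0"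
  \<comment> \<open>The endpoint has imaginary part at least \<open>R + 1\<close>, whatever the sign
    of \<open>y\<close>, and so lies in the exterior region.\<close>
  define h where "h = R + 1 + \<bar>y\<bar>"
  have h: "h > 0" "y + h > R" using R by (auto simp: h_def)
  define g where "g s = Complex x (y + s * h)" for s
  have gd: "(g has_vector_derivative Complex 0 h) (at s)" for s
    unfolding g_def has_vector_derivative_complex_iff by (auto intro!: derivative_eq_intros)
  have vd: "vector_derivative g (at s) = Complex 0 h" for s using gd vector_derivative_at by blast
  have "transverse_path L \<Delta> (exterior_region L) g" unfolding transverse_path_def
  proof (intro conjI)
    show "path g" unfolding path_def
      using gd continuous_at_imp_continuous_on has_vector_derivative_continuous by blast
    have "dist z0 (Complex x y) < e"
      using x by (simp add: y_def dist_complex_def cmod_def)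
    then show "pathstart g \<in> \<Delta>" using e(2) by (auto simp: pathstart_def g_def)
    have "norm (Complex x (y + h)) > R" using h abs_Im_le_cmod[of "Complex x (y + h)"] by simp
    then show "pathfinish g \<in> exterior_region L" using R(2) by (simp add: pathfinish_def g_def)
    have reg: "Re (tangent L (j, t)) \<noteq> 0" if "j < length L" "Re (proj L (j, t)) = x" for j t
      using x(2) that unfolding B_def by blast
    show "finite (hits L g)"
    proof -
      have fin: "finite {t\<in>{0..1}. Re (proj L (j, t)) = x}" if j: "j < length L" for j
      proof (rule finite_level_set)
        fix t :: real
        show "\<forall>\<^sub>F u in at t. Re (proj L (j, u)) \<noteq> x"
        proof (cases "Re (proj L (j, t)) = x")
          case True
          have "((\<lambda>u. (Re (proj L (j, u)) - Re (proj L (j, t))) / (u - t)) \<longlongrightarrow> Re (tangent L (j, t))) (at t)"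
            using Re_deriv[OF j] unfolding has_field_derivative_iff .
          from tendsto_imp_eventually_ne[OF this reg[OF j True]] show ?thesis
            by (rule eventually_mono) (use True in auto)
        next
          case False
          have "((\<lambda>u. Re (proj L (j, u))) \<longlongrightarrow> Re (proj L (j, t))) (at t)"
            using DERIV_isCont[OF Re_deriv[OF j]] by (simp add: isCont_def)
          from tendsto_imp_eventually_ne[OF this False] show ?thesis .
        qed
      qed simp
      \<comment> \<open>On a vertical segment the time of a hit is determined by the imaginary part
        of the point that is hit, so finitely many parameters give finitely many hits.\<close>
      have "hits L g \<subseteq> (\<lambda>(j, t). ((Im (proj L (j, t)) - y) / h, (j, t))) `
        (SIGMA j:{..<length L}. {t\<in>{0..1}. Re (proj L (j, t)) = x})"
      proof
        fix a assume "a \<in> hits L g"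
        then obtain s j t where a: "a = (s, (j, t))" "j < length L" "0 \<le> t" "t < 1" "g s = proj L (j, t)"
          by (auto simp: hits_def params_def)
        have "Re (proj L (j, t)) = x" "Im (proj L (j, t)) = y + s * h"
          using a(5)[symmetric] by (simp_all add: g_def)
        then show "a \<in> (\<lambda>(j, t). ((Im (proj L (j, t)) - y) / h, (j, t))) `
          (SIGMA j:{..<length L}. {t\<in>{0..1}. Re (proj L (j, t)) = x})"
          using a h by (intro image_eqI[of _ _ "(j, t)"]) auto
      qed
      then show ?thesis by (rule finite_subset) (use fin in auto)
    qed
    show "\<forall>(s, p)\<in>hits L g. (\<forall>q\<in>params L. proj L q = proj L p \<longrightarrow> q = p) \<and>
        g differentiable (at s) \<and> det2 (tangent L p) (vector_derivative g (at s)) \<noteq> 0"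
    proof
      fix a assume "a \<in> hits L g"
      moreover obtain s j t where a: "a = (s, (j, t))" by (metis prod.exhaust)
      ultimately have p: "(j, t) \<in> params L" "g s = proj L (j, t)" by (auto simp: hits_def)
      have j: "j < length L" using p by (auto simp: params_def)
      have re: "Re (proj L (j, t)) = x" using p(2)[symmetric] by (simp add: g_def)
      have "proj L (j, t) \<notin> double_points" using x(2) re unfolding B_def by blast
      then have "q = (j, t)" if "q \<in> params L" "proj L q = proj L (j, t)" for q
        using branches_simple[of "(j, t)" "proj L (j, t)"] p that by (auto simp: branches_def)
      moreover have "g differentiable (at s)" using gd differentiableI_vector by blast
      moreover have "det2 (tangent L (j, t)) (vector_derivative g (at s)) \<noteq> 0"
        using reg[OF j re] h by (simp add: vd det2_def)
      ultimately show "case a of (s, p) \<Rightarrow> (\<forall>q\<in>params L. proj L q = proj L p \<longrightarrow> q = p) \<and>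
        g differentiable (at s) \<and> det2 (tangent L p) (vector_derivative g (at s)) \<noteq> 0"
        unfolding a prod.case by blast
    qed
  qed
  then show ?thesis by blast
qed

text \<open>Gives the definite description its meaning: a transverse path exists, and each one has
  intersection number \<open>wind L z\<close> because the winding number vanishes at its exterior
  end.\<close>

lemma region_index_eq_wind:
  assumes "\<Delta> \<in> regions L" "z \<in> \<Delta>"
  shows "region_index L \<Delta> = wind L z"
  unfolding region_index_def
proof (rule the_equality)
  obtain z' where z': "z' \<in> exterior_region L" using region_props(3)[OF exterior_region(1)] by blast
  have *: "intersection_number L g = wind L z" if "transverse_path L \<Delta> (exterior_region L) g" for g
    using wind_transverse_path[OF assms(1) exterior_region(1) that assms(2) z'] wind_exterior[OF z'] by simp
  show "\<exists>g. transverse_path L \<Delta> (exterior_region L) g \<and> wind L z = intersection_number L g"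
    using transverse_path_exists[OF assms(1)] * by metis
  show "i = wind L z" if "\<exists>g. transverse_path L \<Delta> (exterior_region L) g \<and> i = intersection_number L g" for i
    using that * by blast
qed

section \<open>Source regions and arcs\<close>

text \<open>Directions to the right of all branches form a convex set, so the small wedge swept
  between the two rays misses the tangent cones and with them the diagram.\<close>

lemma rays_in_same_region:
  assumes "\<And>x. x \<in> branches L p \<Longrightarrow> det2 (tangent L x) d < 0"
    and "\<And>x. x \<in> branches L p \<Longrightarrow> det2 (tangent L x) d' < 0"
  shows "\<exists>\<rho>>0. \<forall>r r'. 0 < r \<longrightarrow> r < \<rho> \<longrightarrow> 0 < r' \<longrightarrow> r' < \<rho> \<longrightarrow>
      connected_component (- D) (p + of_real r * d) (p + of_real r' * d')"
proof -
  \<comment> \<open>For every direction between \<open>d\<close> and \<open>d'\<close>, the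
    imaginary part in the coordinate of \<open>x\<close> is in absolute value at least the minimum
    in the numerator, and the real part at most the sum in the denominator. Half the quotient is an
    aperture that excludes all of them.\<close>
  define \<eta> where "\<eta> x = min \<bar>Im (d / tangent L x)\<bar> \<bar>Im (d' / tangent L x)\<bar>
    / (2 * (1 + \<bar>Re (d / tangent L x)\<bar> + \<bar>Re (d' / tangent L x)\<bar>))" for x
  have neg: "Im (d / tangent L x) < 0" "Im (d' / tangent L x) < 0" if "x \<in> branches L p" for x
    using assms[OF that] det2_sign_iff(2)[OF branch_tangent_nonzero[OF that]] by auto
  have \<eta>: "\<eta> x > 0" if "x \<in> branches L p" for x
    unfolding \<eta>_def using neg[OF that] by (intro divide_pos_pos) (auto simp: min_def)
  obtain \<epsilon> where \<epsilon>: "\<epsilon> > 0" "\<And>q. dist q p < \<epsilon> \<Longrightarrow> q \<in> D \<Longrightarrow>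
      \<exists>x\<in>branches L p. \<bar>Im ((q - p) / tangent L x)\<bar> \<le> \<eta> x * \<bar>Re ((q - p) / tangent L x)\<bar>"
    using image_near_tangents[of p \<eta>, OF \<eta>] unfolding eventually_nhds_metric by blast
  define e where "e s = of_real (1 - s) * d + of_real s * d'" for s :: real
  \<comment> \<open>Norms on the segment from \<open>d\<close> to \<open>d'\<close> are at most
    \<open>norm d + norm d'\<close>, so this radius keeps the wedge within distance
    \<open>\<epsilon>\<close> of \<open>p\<close>; the summand 1 keeps the denominator
    positive.\<close>
  define \<rho> where "\<rho> = \<epsilon> / (1 + norm d + norm d')"
  have pos: "1 + norm d + norm d' > 0" by (intro add_pos_nonneg) auto
  then have \<rho>: "\<rho> > 0" using \<epsilon>(1) by (simp add: \<rho>_def)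
  have off: "p + of_real r * e s \<notin> D" if r: "0 < r" "r < \<rho>" and s: "s \<in> {0..1}" for r s
  proof
    assume D: "p + of_real r * e s \<in> D"
    have "norm (e s) \<le> (1 - s) * norm d + s * norm d'"
      unfolding e_def using s by (intro norm_triangle_le) (simp add: norm_mult del: of_real_diff)
    also have "\<dots> \<le> 1 * norm d + 1 * norm d'" using s by (intro add_mono mult_right_mono) auto
    finally have "norm (e s) \<le> norm d + norm d'" by simp
    then have "r * norm (e s) \<le> r * (norm d + norm d')" using r by (intro mult_left_mono) auto
    also have "\<dots> \<le> r * (1 + norm d + norm d')" using r by (intro mult_left_mono) auto
    also have "\<dots> < \<epsilon>"
      using r(2) unfolding \<rho>_def pos_less_divide_eq[OF pos] by simp
    finally have "dist (p + of_real r * e s) p < \<epsilon>" using r by (simp add: dist_norm norm_mult)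
    from \<epsilon>(2)[OF this D] obtain x where x: "x \<in> branches L p"
      "\<bar>Im (of_real r * e s / tangent L x)\<bar> \<le> \<eta> x * \<bar>Re (of_real r * e s / tangent L x)\<bar>" by auto
    define a a' where "a = d / tangent L x" and "a' = d' / tangent L x"
    have "of_real r * e s / tangent L x = r *\<^sub>R ((1 - s) *\<^sub>R a + s *\<^sub>R a')"
      unfolding e_def a_def a'_def scaleR_conv_of_real by (simp add: add_divide_distrib distrib_left)
    then have "r * \<bar>(1 - s) * Im a + s * Im a'\<bar> \<le> \<eta> x * (r * \<bar>(1 - s) * Re a + s * Re a'\<bar>)"
      using x(2) r(1) by (simp add: abs_mult)
    then have le: "\<bar>(1 - s) * Im a + s * Im a'\<bar> \<le> \<eta> x * \<bar>(1 - s) * Re a + s * Re a'\<bar>"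
      using r(1) by (simp add: mult.left_commute)
    have na: "Im a < 0" "Im a' < 0" using neg[OF x(1)] by (auto simp: a_def a'_def)
    define m where "m = min \<bar>Im a\<bar> \<bar>Im a'\<bar>"
    have m: "m > 0" using na by (simp add: m_def)
    have "(1 - s) * Im a \<le> (1 - s) * (- m)" "s * Im a' \<le> s * (- m)"
      using s na by (intro mult_left_mono; auto simp: m_def)+
    then have lower: "m \<le> \<bar>(1 - s) * Im a + s * Im a'\<bar>" by (simp add: algebra_simps)
    have "\<bar>(1 - s) * Re a + s * Re a'\<bar> \<le> (1 - s) * \<bar>Re a\<bar> + s * \<bar>Re a'\<bar>"
      using s by (intro order_trans[OF abs_triangle_ineq]) (simp add: abs_mult)
    also have "\<dots> \<le> 1 * \<bar>Re a\<bar> + 1 * \<bar>Re a'\<bar>" using s by (intro add_mono mult_right_mono) auto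
    finally have "\<eta> x * \<bar>(1 - s) * Re a + s * Re a'\<bar> \<le> \<eta> x * (1 + \<bar>Re a\<bar> + \<bar>Re a'\<bar>)"
      using \<eta>[OF x(1)] by (intro mult_left_mono) auto
    also have "\<dots> = m / 2"
      unfolding \<eta>_def a_def[symmetric] a'_def[symmetric] m_def[symmetric]
      by (simp add: divide_simps add_nonneg_eq_0_iff)
    finally show False using le lower m by linarith
  qed
  define S where "S = (\<lambda>(r, s). p + of_real r * e s) ` ({0<..<\<rho>} \<times> {0..1})"
  have "connected S" unfolding S_def e_def case_prod_unfold
    by (intro connected_continuous_image continuous_intros connected_Times) auto
  moreover have "S \<subseteq> - D" using off by (auto simp: S_def)
  moreover have mem: "p + of_real r * e s \<in> S" if "0 < r" "r < \<rho>" "s \<in> {0..1}" for r s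
    unfolding S_def by (rule image_eqI[of _ _ "(r, s)"]) (use that in auto)
  have "p + of_real r * d \<in> S" "p + of_real r * d' \<in> S" if "0 < r" "r < \<rho>" for r
    using mem[OF that, of 0] mem[OF that, of 1] by (simp_all add: e_def)
  ultimately have "connected_component (- D) (p + of_real r * d) (p + of_real r' * d')"
    if "0 < r" "r < \<rho>" "0 < r'" "r' < \<rho>" for r r'
    unfolding connected_component_def using that by (intro exI[of _ S]) simp
  then show ?thesis using \<rho> by (intro exI[of _ \<rho>]) simp
qed

lemma crossing_tangents:
  assumes "x \<in> crossings L"
  shows "det2 (tangent L (fst x)) (tangent L (snd x)) \<noteq> 0"
    "branches L (proj L (fst x)) = {fst x, snd x}" "fst x \<noteq> snd x"
  using branches_crossing[of "fst x" "snd x"] assms by auto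

lemma det2_swap: "det2 w v = - det2 v w"
  by (simp add: det2_def)

text \<open>To the right of both strands neither is counted, so the winding number of the source
  region is \<open>base\<close> at the crossing. By \<open>rays_in_same_region\<close>, all rays in
  the definition of \<open>source_region\<close> end up in a single region.\<close>

lemma crossing_index_eq_base:
  assumes x: "x \<in> crossings L"
  shows "crossing_index L x = base (proj L (fst x))"
proof -
  define p v w where "p = proj L (fst x)" and "v = tangent L (fst x)" and "w = tangent L (snd x)"
  note br = crossing_tangents(2)[OF x, folded p_def]
  define N where "N d \<longleftrightarrow> det2 v d < 0 \<and> det2 w d < 0" for d
  have N: "N d \<longleftrightarrow> (\<forall>y\<in>branches L p. det2 (tangent L y) d < 0)" for d
    by (simp add: br N_def v_def w_def)
  \<comment> \<open>An explicit direction to the right of both strands: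
    \<open>det2 v (v - w)\<close> and \<open>det2 w (v - w)\<close> both equal
    \<open>- det2 v w\<close>.\<close>
  define d0 where "d0 = of_real (sgn (det2 v w)) * (v - w)"
  have "det2 v d0 = - (sgn (det2 v w) * det2 v w)" "det2 w d0 = - (sgn (det2 v w) * det2 v w)"
    by (simp_all add: d0_def det2_def algebra_simps)
  moreover have "sgn (det2 v w) * det2 v w > 0"
    using crossing_tangents(1)[OF x] by (simp add: v_def w_def sgn_if)
  ultimately have d0: "N d0" by (simp add: N_def)
  have same: "\<exists>\<rho>>0. \<forall>r r'. 0 < r \<longrightarrow> r < \<rho> \<longrightarrow> 0 < r' \<longrightarrow> r' < \<rho> \<longrightarrow>
      connected_component (- D) (p + of_real r * d0) (p + of_real r' * d)" if "N d" for d
    by (rule rays_in_same_region) (use d0 that in \<open>simp_all add: N\<close>)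
  obtain \<rho>0 where \<rho>0: "\<rho>0 > 0" "\<And>r r'. 0 < r \<Longrightarrow> r < \<rho>0 \<Longrightarrow> 0 < r' \<Longrightarrow> r' < \<rho>0 \<Longrightarrow>
      connected_component (- D) (p + of_real r * d0) (p + of_real r' * d0)"
    using same[OF d0] by auto
  define \<Delta>0 where "\<Delta>0 = connected_component_set (- D) (p + of_real (\<rho>0 / 2) * d0)"
  have "connected_component (- D) (p + of_real (\<rho>0 / 2) * d0) (p + of_real (\<rho>0 / 2) * d0)"
    using \<rho>0(1) by (intro \<rho>0(2)) auto
  then have reg: "\<Delta>0 \<in> regions L" unfolding regions_def \<Delta>0_def
    by (intro componentsI) (simp add: connected_component_refl_eq del: of_real_divide)
  have ray: "\<forall>\<^sub>F r in at_right 0. p + of_real r * d \<in> \<Delta>0" if "N d" for d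
  proof -
    obtain \<rho> where \<rho>: "\<rho> > 0" "\<And>r r'. 0 < r \<Longrightarrow> r < \<rho> \<Longrightarrow> 0 < r' \<Longrightarrow> r' < \<rho> \<Longrightarrow>
        connected_component (- D) (p + of_real r * d0) (p + of_real r' * d)"
      using same[OF \<open>N d\<close>] by auto
    define r0 where "r0 = min \<rho> \<rho>0 / 2"
    have r0: "0 < r0" "r0 < \<rho>" "r0 < \<rho>0" using \<rho>(1) \<rho>0(1) by (auto simp: r0_def)
    have "p + of_real r * d \<in> \<Delta>0" if "0 < r" "r < \<rho>" for r
      unfolding \<Delta>0_def mem_Collect_eq
      by (rule connected_component_trans[OF \<rho>0(2)[of "\<rho>0 / 2" r0] \<rho>(2)[of r0 r]]) (use \<rho>0(1) r0 that in auto)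
    then show ?thesis unfolding eventually_at_right_field using \<rho>(1) by blast
  qed
  have "source_region L x = \<Delta>0"
    unfolding source_region_def p_def[symmetric] v_def[symmetric] w_def[symmetric]
  proof (rule the_equality)
    show "\<Delta>0 \<in> regions L \<and> (\<forall>d. det2 v d < 0 \<and> det2 w d < 0 \<longrightarrow> (\<forall>\<^sub>F r in at_right 0. p + of_real r * d \<in> \<Delta>0))"
      using reg ray by (simp add: N_def)
  next
    fix \<Delta> assume *: "\<Delta> \<in> regions L \<and> (\<forall>d. det2 v d < 0 \<and> det2 w d < 0 \<longrightarrow> (\<forall>\<^sub>F r in at_right 0. p + of_real r * d \<in> \<Delta>))"
    then have "\<forall>\<^sub>F r in at_right 0. p + of_real r * d0 \<in> \<Delta> \<and> p + of_real r * d0 \<in> \<Delta>0"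
      using ray[OF d0] d0 by (auto simp: N_def eventually_conj_iff)
    then obtain r :: real where "p + of_real r * d0 \<in> \<Delta> \<inter> \<Delta>0"
      using eventually_happens'[OF trivial_limit_at_right_real] by blast
    then show "\<Delta> = \<Delta>0"
      using components_nonoverlap[of \<Delta> "- D" \<Delta>0] * reg unfolding regions_def by blast
  qed
  \<comment> \<open>An equation without \<open>r\<close>, stated as an eventual one in order to
    reach a point of the source region close to the crossing.\<close>
  moreover have "\<forall>\<^sub>F r in at_right (0::real). region_index L \<Delta>0 = base p"
  proof -
    have "((\<lambda>r. (p + of_real r * d0 - p) / of_real r) \<longlongrightarrow> d0) (at_right 0)"
    proof (rule Lim_transform_eventually[OF tendsto_const])
      show "\<forall>\<^sub>F r in at_right 0. d0 = (p + of_real r * d0 - p) / of_real r"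
        using eventually_at_right_less[of 0] by (rule eventually_mono) simp
    qed
    moreover have "p \<in> D" using x by (auto simp: p_def crossings_def diagram_image_def)
    ultimately have "\<forall>\<^sub>F r in at_right 0. p + of_real r * d0 \<notin> D \<and> wind L (p + of_real r * d0) =
        base p + (\<Sum>y\<in>branches L p. of_bool (det2 (tangent L y) d0 > 0))"
      using d0 unfolding N by (intro directional_limit) auto
    then show ?thesis using ray[OF d0]
    proof eventually_elim
      case (elim r)
      moreover have "(\<Sum>y\<in>branches L p. of_bool (det2 (tangent L y) d0 > 0) :: int) = 0"
        using d0 unfolding N by (intro sum.neutral ballI) (auto simp: not_less less_imp_le)
      ultimately show ?case using region_index_eq_wind[OF reg] by simp
    qed
  qed
  ultimately show ?thesis
    unfolding crossing_index_def p_def using eventually_happens'[OF trivial_limit_at_right_real] by simp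
qed

section \<open>Arcs followed along a strand\<close>

definition under_params :: "(nat \<times> real) set" where
  "under_params = snd ` crossings L"

text \<open>The arc as a function of the point, so that it can be followed along a strand. At an
  undercrossing point the value is the empty set.\<close>

definition arc_at :: "complex \<times> real \<Rightarrow> (complex \<times> real) set" where
  "arc_at z = connected_component_set (cut_link L) z"

lemma under_params_subset: "under_params \<subseteq> params L"
  by (auto simp: under_params_def crossings_def)

lemma cut_link_iff:
  assumes "x \<in> params L"
  shows "space_point L x \<in> cut_link L \<longleftrightarrow> x \<notin> under_params"
proof -
  have "(\<lambda>x. space_point L (snd x)) ` crossings L = space_point L ` under_params"
    by (simp add: under_params_def image_image)
  then show ?thesis using assms inj_space_point under_params_subset
    by (auto simp: cut_link_def inj_on_def)
qed

lemma under_proj_double: "x \<in> under_params \<Longrightarrow> proj L x \<in> double_points"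
  by (auto simp: under_params_def double_points_def crossings_def image_iff) (metis fst_conv)

text \<open>An over-parameter that is also an under-parameter would need a strand above it, but the
  only other strand at this crossing is below. Hence arcs run through overcrossings.\<close>

lemma fst_crossing_not_under:
  assumes "x \<in> crossings L"
  shows "fst x \<notin> under_params"
proof
  assume "fst x \<in> under_params"
  then obtain o' where o': "(o', fst x) \<in> crossings L" by (auto simp: under_params_def)
  then have "o' \<in> branches L (proj L (fst x))" by (auto simp: crossings_def branches_def)
  then have "o' = fst x \<or> o' = snd x" using crossing_tangents(2)[OF assms] by blast
  then show False using o' assms by (auto simp: crossings_def)
qed

lemma arc_at_eq:
  assumes "A \<in> arcs L" "z \<in> A"
  shows "arc_at z = A"
proof -
  obtain w where "A = connected_component_set (cut_link L) w"
    using assms(1) unfolding arcs_def by (elim componentsE)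
  then show ?thesis using assms(2) connected_component_eq[of z "cut_link L" w] by (simp add: arc_at_def)
qed

text \<open>A short one-sided piece of a strand avoids the double points and hence the
  undercrossings, so by connectedness it lies in one arc. The piece includes its initial point
  unless an undercrossing is there.\<close>

lemma arc_near:
  assumes j: "j < length L" and \<sigma>: "\<sigma> = 1 \<or> \<sigma> = -1"
  shows "\<exists>A\<in>arcs L. (\<forall>\<^sub>F r in at_right 0. space_point L (j, t + \<sigma> * r) \<in> A) \<and>
    ((j, frac t) \<notin> under_params \<longrightarrow> space_point L (j, t) \<in> A)"
proof -
  have "\<forall>\<^sub>F r in at_right 0. proj L (j, t + \<sigma> * r) \<notin> double_points"
    using \<sigma> by (intro proj_strand_avoids[OF j] finite_double_points) auto
  then obtain \<delta> where \<delta>: "\<delta> > 0" "\<And>r. 0 < r \<Longrightarrow> r < \<delta> \<Longrightarrow> proj L (j, t + \<sigma> * r) \<notin> double_points"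
    unfolding eventually_at_right_field by blast
  define I where "I = (if (j, frac t) \<in> under_params then {0<..<\<delta>} else {0..<\<delta>})"
  define S where "S = (\<lambda>r. space_point L (j, t + \<sigma> * r)) ` I"
  have cut: "space_point L (j, s) \<in> cut_link L \<longleftrightarrow> (j, frac s) \<notin> under_params" for s
    using cut_link_iff[OF frac_params[OF j]] space_point_frac[OF j] by simp
  have "S \<subseteq> cut_link L"
  proof -
    have "(j, frac (t + \<sigma> * r)) \<notin> under_params" if "r \<in> I" for r
    proof (cases "r = 0")
      case True then show ?thesis using that by (auto simp: I_def split: if_splits)
    next
      case False
      then have "0 < r" "r < \<delta>" using that by (auto simp: I_def split: if_splits)
      then show ?thesis using \<delta>(2)[of r] under_proj_double proj_frac[OF j] by metis
    qed
    then show ?thesis using cut by (auto simp: S_def)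
  qed
  moreover have "connected S"
  proof -
    have c: "continuous_on UNIV (\<lambda>s. space_point L (j, s))"
      using has_tangent(3)[OF j] continuous_at_imp_continuous_on by blast
    have "continuous_on I (\<lambda>r. space_point L (j, t + \<sigma> * r))"
      by (rule continuous_on_compose2[OF c]) (auto intro!: continuous_intros)
    then show ?thesis unfolding S_def
      by (rule connected_continuous_image) (auto simp: I_def)
  qed
  moreover have "S \<noteq> {}" using \<delta>(1) by (auto simp: S_def I_def)
  ultimately obtain A where A: "A \<in> arcs L" "S \<subseteq> A"
    unfolding arcs_def using exists_component_superset[of S "cut_link L"] by blast
  have "space_point L (j, t + \<sigma> * r) \<in> A" if "0 < r" "r < \<delta>" for r
    using A(2) that by (auto simp: S_def I_def)
  then have "\<forall>\<^sub>F r in at_right 0. space_point L (j, t + \<sigma> * r) \<in> A"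
    unfolding eventually_at_right_field using \<delta>(1) by blast
  moreover have "space_point L (j, t) \<in> A" if "(j, frac t) \<notin> under_params"
    using A(2) that \<delta>(1) by (force simp: S_def I_def)
  ultimately show ?thesis using A(1) by blast
qed

lemma arc_at_locally_constant:
  assumes "x \<in> params L" "x \<notin> under_params" "\<sigma> = 1 \<or> \<sigma> = -1"
  shows "\<forall>\<^sub>F r in at_right 0. arc_at (space_point L (fst x, snd x + \<sigma> * r)) = arc_at (space_point L x)"
proof -
  obtain j t where x: "x = (j, t)" "j < length L" "0 \<le> t" "t < 1" using assms by (auto simp: params_def)
  have "frac t = t" using x by (simp add: frac_eq_id)
  then obtain A where A: "A \<in> arcs L" "\<forall>\<^sub>F r in at_right 0. space_point L (j, t + \<sigma> * r) \<in> A"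
    "space_point L (j, t) \<in> A"
    using arc_near[OF x(2) assms(3), of t] assms(2) x(1) by metis
  show ?thesis using A(2) by (rule eventually_mono) (use arc_at_eq[OF A(1)] A(3) x(1) in auto)
qed

lemma components_eventually_unique:
  assumes "A \<in> arcs L" "B \<in> arcs L" "\<forall>\<^sub>F r in F. h r \<in> A" "\<forall>\<^sub>F r in F. h r \<in> B" "F \<noteq> bot"
  shows "A = B"
proof -
  have "\<forall>\<^sub>F r in F. h r \<in> A \<inter> B" using assms(3,4) by eventually_elim blast
  then obtain r where "h r \<in> A \<inter> B" using eventually_happens'[OF assms(5)] by blast
  then show ?thesis using arc_at_eq assms(1,2) by blast
qed

text \<open>Resolves the definite descriptions of the under-arcs. The factors \<open>1\<close> and
  \<open>-1\<close> fit the pattern \<open>\<sigma> * r\<close> of the other one-sided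
  statements.\<close>

lemma arc_at_under:
  assumes x: "x \<in> crossings L"
  shows "\<forall>\<^sub>F r in at_right 0. arc_at (space_point L (fst (snd x), snd (snd x) + 1 * r)) = under_arc_out L x"
    and "\<forall>\<^sub>F r in at_right 0. arc_at (space_point L (fst (snd x), snd (snd x) + (-1) * r)) = under_arc_in L x"
proof -
  define j t where "j = fst (snd x)" and "t = snd (snd x)"
  have j: "j < length L" using x by (auto simp: crossings_def params_def j_def)
  have sp: "(L ! j) s = space_point L (j, s)" for s by (simp add: space_point_def)
  obtain A where A: "A \<in> arcs L" "\<forall>\<^sub>F r in at_right 0. space_point L (j, t + r) \<in> A"
    using arc_near[OF j, of "1" t] by auto
  have "under_arc_out L x = A"
    unfolding under_arc_out_def j_def[symmetric] t_def[symmetric] sp eventually_at_right_to_right0[of _ t]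
  proof (rule the_equality)
    show "A \<in> arcs L \<and> (\<forall>\<^sub>F r in at_right 0. space_point L (j, t + r) \<in> A)" using A by blast
    show "X = A" if "X \<in> arcs L \<and> (\<forall>\<^sub>F r in at_right 0. space_point L (j, t + r) \<in> X)" for X
      using components_eventually_unique[OF _ A(1) _ A(2) trivial_limit_at_right_real] that by blast
  qed
  moreover have "\<forall>\<^sub>F r in at_right 0. arc_at (space_point L (j, t + r)) = A"
    using A(2) by (rule eventually_mono) (rule arc_at_eq[OF A(1)])
  ultimately show "\<forall>\<^sub>F r in at_right 0. arc_at (space_point L (fst (snd x), snd (snd x) + 1 * r)) = under_arc_out L x"
    by (simp add: j_def t_def)
  obtain B where B: "B \<in> arcs L" "\<forall>\<^sub>F r in at_right 0. space_point L (j, t - r) \<in> B"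
    using arc_near[OF j, of "-1" t] by auto
  have "under_arc_in L x = B"
    unfolding under_arc_in_def j_def[symmetric] t_def[symmetric] sp eventually_at_left_to_right0[of _ t]
  proof (rule the_equality)
    show "B \<in> arcs L \<and> (\<forall>\<^sub>F r in at_right 0. space_point L (j, t - r) \<in> B)" using B by blast
    show "X = B" if "X \<in> arcs L \<and> (\<forall>\<^sub>F r in at_right 0. space_point L (j, t - r) \<in> X)" for X
      using components_eventually_unique[OF _ B(1) _ B(2) trivial_limit_at_right_real] that by blast
  qed
  moreover have "\<forall>\<^sub>F r in at_right 0. arc_at (space_point L (j, t - r)) = B"
    using B(2) by (rule eventually_mono) (rule arc_at_eq[OF B(1)])
  ultimately show "\<forall>\<^sub>F r in at_right 0. arc_at (space_point L (fst (snd x), snd (snd x) + (-1) * r)) = under_arc_in L x"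
    by (simp add: j_def t_def)
qed

lemma over_arc_eq:
  assumes x: "x \<in> crossings L"
  shows "over_arc L x = arc_at (space_point L (fst x))"
  unfolding over_arc_def
proof (rule the_equality)
  have "space_point L (fst x) \<in> cut_link L"
    using cut_link_iff[of "fst x"] fst_crossing_not_under[OF x] x by (auto simp: crossings_def)
  then show "arc_at (space_point L (fst x)) \<in> arcs L \<and> space_point L (fst x) \<in> arc_at (space_point L (fst x))"
    by (auto simp: arcs_def arc_at_def intro: componentsI)
  show "A = arc_at (space_point L (fst x))" if "A \<in> arcs L \<and> space_point L (fst x) \<in> A" for A
    using arc_at_eq that by metis
qed

section \<open>Telescoping along the strands\<close>

text \<open>Each component is cut at parameter 0. On \<open>{0..1}\<close> the interior jumps sum to
  the left value at 1 minus the right value at 0; by periodicity this is minus the jump at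
  0.\<close>

lemma sum_jumps_eq_0:
  fixes G :: "nat \<times> real \<Rightarrow> 'm::ab_group_add"
  assumes per: "\<And>j t. j < length L \<Longrightarrow> G (j, t + 1) = G (j, t)"
    and S: "finite S" "S \<subseteq> params L"
    and l: "\<And>x. x \<in> params L \<Longrightarrow> \<forall>\<^sub>F r in at_right 0. G (fst x, snd x + (-1) * r) = l x"
    and r: "\<And>x. x \<in> params L \<Longrightarrow> \<forall>\<^sub>F s in at_right 0. G (fst x, snd x + 1 * s) = r x"
    and plain: "\<And>x. x \<in> params L \<Longrightarrow> x \<notin> S \<Longrightarrow> l x = G x \<and> r x = G x"
  shows "(\<Sum>x\<in>S. r x - l x) = 0"
proof -
  define T where "T j = {t. (j, t) \<in> S}" for j
  have finT: "finite (T j)" for j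
  proof -
    have "finite (snd ` S)" using S(1) by simp
    then show ?thesis by (rule rev_finite_subset) (force simp: T_def)
  qed
  have T_sub: "t \<in> {0..<1}" if "t \<in> T j" for t j using that S(2) by (auto simp: T_def params_def)
  have strand_sum: "(\<Sum>t\<in>T j. r (j, t) - l (j, t)) = 0" if j: "j < length L" for j
  proof -
    have x: "(j, t) \<in> params L" if "0 \<le> t" "t < 1" for t using that j by (simp add: params_def)
    \<comment> \<open>\<open>frac\<close> sends the endpoint 1 to the parameter 0 and is the
      identity on \<open>[0, 1)\<close>.\<close>
    have "l (j, frac 1) - r (j, frac 0) = (\<Sum>t\<in>T j \<inter> {0<..<1}. r (j, frac t) - l (j, frac t))"
    proof (rule jump_sum_interval[where f = "\<lambda>t. G (j, t)" and l = "\<lambda>t. l (j, frac t)" and r = "\<lambda>t. r (j, frac t)"])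
      fix t :: real assume t: "0 < t" "t \<le> 1"
      show "\<forall>\<^sub>F s in at_left t. G (j, s) = l (j, frac t)"
      proof (cases "t = 1")
        case True
        have "G (j, 1 - s) = G (j, - s)" for s using per[OF j, of "- s"] by (simp add: add.commute)
        then show ?thesis using l[OF x[of 0]] True by (simp add: eventually_at_left_to_right0)
      next
        case False
        then show ?thesis using l[OF x[of t]] t by (simp add: eventually_at_left_to_right0 frac_eq_id)
      qed
    next
      fix t :: real assume t: "0 \<le> t" "t < 1"
      then show "\<forall>\<^sub>F s in at_right t. G (j, s) = r (j, frac t)"
        using r[OF x[of t]] by (simp add: eventually_at_right_to_right0[of _ t] frac_eq_id)
    next
      fix t :: real assume t: "0 < t" "t < 1" "t \<notin> T j"
      then show "l (j, frac t) = G (j, t) \<and> r (j, frac t) = G (j, t)"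
        using plain[OF x[of t]] by (simp add: T_def frac_eq_id)
    qed (use finT in auto)
    also have "\<dots> = (\<Sum>t\<in>T j \<inter> {0<..<1}. r (j, t) - l (j, t))"
      by (intro sum.cong) (auto simp: frac_eq_id)
    finally have inner: "(\<Sum>t\<in>T j \<inter> {0<..<1}. r (j, t) - l (j, t)) = l (j, 0) - r (j, 0)" by simp
    show ?thesis
    \<comment> \<open>The jump at 0 either belongs to the sum and closes it, or vanishes.\<close>
    proof (cases "0 \<in> T j")
      case True
      then have "T j = insert 0 (T j \<inter> {0<..<1})" using T_sub[of _ j] by (force simp: less_le)
      then have "(\<Sum>t\<in>T j. r (j, t) - l (j, t)) = (\<Sum>t\<in>insert 0 (T j \<inter> {0<..<1}). r (j, t) - l (j, t))" by simp
      also have "\<dots> = 0" using finT inner by simp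
      finally show ?thesis .
    next
      case False
      then have "T j \<inter> {0<..<1} = T j" using T_sub[of _ j] by (force simp: less_le)
      then show ?thesis using inner plain[OF x[of 0]] False by (simp add: T_def)
    qed
  qed
  have "S = Sigma {..<length L} T" using S(2) by (auto simp: T_def params_def)
  then have "(\<Sum>x\<in>S. r x - l x) = (\<Sum>j<length L. \<Sum>t\<in>T j. r (j, t) - l (j, t))"
    using finT by (simp add: sum.Sigma case_prod_unfold)
  then show ?thesis using strand_sum by simp
qed

text \<open>An over-parameter fixes the double point and, in the absence of triple points, the other
  branch there.\<close>

lemma inj_on_fst_crossings: "inj_on fst (crossings L)"
proof (rule inj_onI)
  fix x y assume *: "x \<in> crossings L" "y \<in> crossings L" "fst x = fst y"
  then have "{fst x, snd x} = {fst y, snd y}" using crossing_tangents(2) by metis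
  then show "x = y" using * crossing_tangents(3)[OF *(1)] by (auto simp: prod_eq_iff doubleton_eq_iff)
qed

lemma inj_on_snd_crossings: "inj_on snd (crossings L)"
proof (rule inj_onI)
  fix x y assume *: "x \<in> crossings L" "y \<in> crossings L" "snd x = snd y"
  then have "proj L (fst x) = proj L (fst y)" by (auto simp: crossings_def)
  then have "{fst x, snd x} = {fst y, snd y}" using * crossing_tangents(2) by metis
  then show "x = y" using * crossing_tangents(3)[OF *(1)] by (auto simp: prod_eq_iff doubleton_eq_iff)
qed

text \<open>The under-strand is on the left of the over-strand after a positive crossing and before
  a negative one; the over-strand is on the left of the under-strand in the opposite cases. Being on
  the left raises \<open>base\<close> by 1, and only the under-strand changes its arc.\<close>

lemma crossing_telescope:
  fixes \<phi> :: "int \<Rightarrow> (complex \<times> real) set \<Rightarrow> 'm::ab_group_add"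
  defines "pos \<equiv> \<lambda>x. of_bool (det2 (tangent L (fst x)) (tangent L (snd x)) > 0)"
    and "neg \<equiv> \<lambda>x. of_bool (det2 (tangent L (fst x)) (tangent L (snd x)) < 0)"
  shows "(\<Sum>x\<in>crossings L.
      \<phi> (crossing_index L x + pos x) (under_arc_out L x) - \<phi> (crossing_index L x + neg x) (under_arc_in L x)
    + (\<phi> (crossing_index L x + neg x) (over_arc L x) - \<phi> (crossing_index L x + pos x) (over_arc L x))) = 0"
proof -
  define G where "G x = \<phi> (base (proj L x)) (arc_at (space_point L x))" for x
  \<comment> \<open>The one-sided eventual value of \<open>G\<close>, in place of a limit in a
    codomain without topology.\<close>
  define lim where "lim \<sigma> x = (THE c. \<forall>\<^sub>F r in at_right 0. G (fst x, snd x + \<sigma> * r) = c)" for \<sigma> :: real and x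
  have limI: "lim \<sigma> x = c" "\<forall>\<^sub>F r in at_right 0. G (fst x, snd x + \<sigma> * r) = lim \<sigma> x"
    if "\<forall>\<^sub>F r in at_right 0. G (fst x, snd x + \<sigma> * r) = c" for \<sigma> x c
  proof -
    have "c' = c" if "\<forall>\<^sub>F r in at_right 0. G (fst x, snd x + \<sigma> * r) = c'" for c'
    proof -
      have "\<forall>\<^sub>F r in at_right (0::real). c' = c"
        using that \<open>\<forall>\<^sub>F r in at_right 0. G (fst x, snd x + \<sigma> * r) = c\<close> by eventually_elim simp
      then show ?thesis using eventually_happens'[OF trivial_limit_at_right_real] by blast
    qed
    then show "lim \<sigma> x = c" unfolding lim_def using that by blast
    then show "\<forall>\<^sub>F r in at_right 0. G (fst x, snd x + \<sigma> * r) = lim \<sigma> x" using that by simp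
  qed
  have combine: "\<forall>\<^sub>F r in at_right 0. G (fst x, snd x + \<sigma> * r) = \<phi> K A"
    if "\<forall>\<^sub>F r in at_right 0. base (proj L (fst x, snd x + \<sigma> * r)) = K"
      "\<forall>\<^sub>F r in at_right 0. arc_at (space_point L (fst x, snd x + \<sigma> * r)) = A" for x \<sigma> K A
    using that by eventually_elim (simp add: G_def)
  define O' U S where "O' = fst ` crossings L" and "U = snd ` crossings L" and "S = O' \<union> U"
  have plain: "\<forall>\<^sub>F r in at_right 0. G (fst x, snd x + \<sigma> * r) = G x"
    if x: "x \<in> params L" "x \<notin> S" and \<sigma>: "\<sigma> = 1 \<or> \<sigma> = -1" for x \<sigma>
  proof -
    have b: "branches L (proj L x) - {x} = {}"
      using crossing_of_branches[of x "proj L x"] x by (force simp: branches_def S_def O'_def U_def)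
    have "x \<notin> under_params" using x(2) by (auto simp: under_params_def S_def U_def)
    then show ?thesis
      using combine[OF base_along_strand[OF x(1) \<sigma>, unfolded b] arc_at_locally_constant[OF x(1) _ \<sigma>]]
      by (simp add: G_def)
  qed
  have single: "(\<Sum>y\<in>{z}. f y) = f z" for f :: "nat \<times> real \<Rightarrow> int" and z by simp
  have par: "fst x \<in> params L" "snd x \<in> params L" "proj L (snd x) = proj L (fst x)" if "x \<in> crossings L" for x
    using that by (auto simp: crossings_def)
  have under: "\<forall>\<^sub>F r in at_right 0. G (fst (snd x), snd (snd x) + 1 * r) = \<phi> (crossing_index L x + pos x) (under_arc_out L x)"
    "\<forall>\<^sub>F r in at_right 0. G (fst (snd x), snd (snd x) + (-1) * r) = \<phi> (crossing_index L x + neg x) (under_arc_in L x)"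
    if x: "x \<in> crossings L" for x
  proof -
    have b: "branches L (proj L (snd x)) - {snd x} = {fst x}"
      using crossing_tangents(2,3)[OF x] par[OF x] by auto
    show "\<forall>\<^sub>F r in at_right 0. G (fst (snd x), snd (snd x) + 1 * r) = \<phi> (crossing_index L x + pos x) (under_arc_out L x)"
      using combine[OF base_along_strand[OF par(2)[OF x], of 1, unfolded b single] arc_at_under(1)[OF x]]
      by (simp add: crossing_index_eq_base[OF x] pos_def par(3)[OF x])
    show "\<forall>\<^sub>F r in at_right 0. G (fst (snd x), snd (snd x) + (-1) * r) = \<phi> (crossing_index L x + neg x) (under_arc_in L x)"
      using combine[OF base_along_strand[OF par(2)[OF x], of "-1", unfolded b single] arc_at_under(2)[OF x]]
      by (simp add: crossing_index_eq_base[OF x] neg_def par(3)[OF x])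
  qed
  have over: "\<forall>\<^sub>F r in at_right 0. G (fst (fst x), snd (fst x) + 1 * r) = \<phi> (crossing_index L x + neg x) (over_arc L x)"
    "\<forall>\<^sub>F r in at_right 0. G (fst (fst x), snd (fst x) + (-1) * r) = \<phi> (crossing_index L x + pos x) (over_arc L x)"
    if x: "x \<in> crossings L" for x
  proof -
    have b: "branches L (proj L (fst x)) - {fst x} = {snd x}"
      using crossing_tangents(2,3)[OF x] by auto
    note swap = det2_swap[of "tangent L (snd x)" "tangent L (fst x)"]
    show "\<forall>\<^sub>F r in at_right 0. G (fst (fst x), snd (fst x) + 1 * r) = \<phi> (crossing_index L x + neg x) (over_arc L x)"
      using combine[OF base_along_strand[OF par(1)[OF x], of 1, unfolded b single]
          arc_at_locally_constant[OF par(1)[OF x] fst_crossing_not_under[OF x], of 1]]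
      by (simp add: crossing_index_eq_base[OF x] neg_def over_arc_eq[OF x] swap)
    show "\<forall>\<^sub>F r in at_right 0. G (fst (fst x), snd (fst x) + (-1) * r) = \<phi> (crossing_index L x + pos x) (over_arc L x)"
      using combine[OF base_along_strand[OF par(1)[OF x], of "-1", unfolded b single]
          arc_at_locally_constant[OF par(1)[OF x] fst_crossing_not_under[OF x], of "-1"]]
      by (simp add: crossing_index_eq_base[OF x] pos_def over_arc_eq[OF x] swap)
  qed
  have ex: "\<exists>c. \<forall>\<^sub>F r in at_right 0. G (fst x, snd x + \<sigma> * r) = c"
    if x: "x \<in> params L" and \<sigma>: "\<sigma> = 1 \<or> \<sigma> = -1" for x \<sigma>
  proof (cases "x \<in> S")
    case True
    then show ?thesis using under over \<sigma> unfolding S_def O'_def U_def by blast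
  qed (use plain x \<sigma> in blast)
  have "(\<Sum>x\<in>S. lim 1 x - lim (-1) x) = 0"
  proof (rule sum_jumps_eq_0[where G = G])
    show "G (j, t + 1) = G (j, t)" if "j < length L" for j t
      using proj_of_int[OF that, of t 1] space_point_of_int[OF that, of t 1] by (simp add: G_def)
    show "finite S" "S \<subseteq> params L"
      using finite_crossings par by (auto simp: S_def O'_def U_def)
    show "\<forall>\<^sub>F r in at_right 0. G (fst x, snd x + (-1) * r) = lim (-1) x" if "x \<in> params L" for x
      using ex[OF that, of "-1"] limI(2)[of x "-1"] by auto
    show "\<forall>\<^sub>F r in at_right 0. G (fst x, snd x + 1 * r) = lim 1 x" if "x \<in> params L" for x
      using ex[OF that, of 1] limI(2)[of x 1] by auto
    show "lim (-1) x = G x \<and> lim 1 x = G x" if "x \<in> params L" "x \<notin> S" for x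
      using limI(1)[OF plain[OF that]] by blast
  qed
  moreover have "O' \<inter> U = {}"
    using fst_crossing_not_under unfolding O'_def U_def under_params_def by blast
  moreover have "finite O'" "finite U" using finite_crossings by (auto simp: O'_def U_def)
  \<comment> \<open>No parameter is both over and under, so the two passages of a crossing can be
    summed separately.\<close>
  ultimately have "0 = (\<Sum>x\<in>U. lim 1 x - lim (-1) x) + (\<Sum>x\<in>O'. lim 1 x - lim (-1) x)"
    unfolding S_def by (simp add: sum.union_disjoint add.commute)
  also have "\<dots> = (\<Sum>x\<in>crossings L. (lim 1 (snd x) - lim (-1) (snd x)) + (lim 1 (fst x) - lim (-1) (fst x)))"
    unfolding U_def O'_def by (simp add: sum.reindex inj_on_fst_crossings inj_on_snd_crossings sum.distrib)
  also have "\<dots> = (\<Sum>x\<in>crossings L.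
      \<phi> (crossing_index L x + pos x) (under_arc_out L x) - \<phi> (crossing_index L x + neg x) (under_arc_in L x)
    + (\<phi> (crossing_index L x + neg x) (over_arc L x) - \<phi> (crossing_index L x + pos x) (over_arc L x)))"
  proof (rule sum.cong[OF refl])
    fix x assume x: "x \<in> crossings L"
    show "(lim 1 (snd x) - lim (-1) (snd x)) + (lim 1 (fst x) - lim (-1) (fst x)) =
      \<phi> (crossing_index L x + pos x) (under_arc_out L x) - \<phi> (crossing_index L x + neg x) (under_arc_in L x)
    + (\<phi> (crossing_index L x + neg x) (over_arc L x) - \<phi> (crossing_index L x + pos x) (over_arc L x))"
      using limI(1)[OF under(1)[OF x]] limI(1)[OF under(2)[OF x]] limI(1)[OF over(1)[OF x]] limI(1)[OF over(2)[OF x]]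
      by simp
  qed
  finally show ?thesis by simp
qed

end

section \<open>Twisted weights of shifted colourings\<close>

lemma unit_pow_simps:
  fixes \<alpha> \<beta> :: "'r::comm_ring_1"
  assumes "\<alpha> * \<beta> = 1"
  shows "unit_pow \<alpha> n = (if n \<ge> 0 then \<alpha> ^ nat n else \<beta> ^ nat (- n))"
proof -
  have "(THE \<beta>. \<alpha> * \<beta> = 1) = \<beta>"
  proof (rule the_equality)
    show "\<alpha> * \<beta> = 1" by (rule assms)
  next
    fix \<beta>' assume "\<alpha> * \<beta>' = 1"
    have "\<beta>' * (\<alpha> * \<beta>) = \<alpha> * \<beta>' * \<beta>" by (simp add: ac_simps)
    also have "\<dots> = \<beta>" by (simp add: \<open>\<alpha> * \<beta>' = 1\<close>)
    finally have "\<beta>' * (\<alpha> * \<beta>) = \<beta>" .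
    then show "\<beta>' = \<beta>" using assms by simp
  qed
  then show ?thesis by (simp add: unit_pow_def)
qed

lemma unit_pow_1 [simp]: "unit_pow \<alpha> 1 = \<alpha>"
  and unit_pow_0 [simp]: "unit_pow \<alpha> 0 = 1"
  by (simp_all add: unit_pow_def)

lemma unit_pow_Suc:
  fixes \<alpha> :: "'r::comm_ring_1"
  assumes "\<alpha> dvd 1"
  shows "unit_pow \<alpha> (n + 1) = \<alpha> * unit_pow \<alpha> n"
proof -
  obtain \<beta> where \<beta>: "\<alpha> * \<beta> = 1" using assms by (metis dvdE)
  show ?thesis
  proof (cases "n \<ge> 0")
    case True
    then show ?thesis by (simp add: unit_pow_simps[OF \<beta>] nat_add_distrib)
  next
    case False
    then have "nat (- n) = Suc (nat (- (n + 1)))" by simp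
    then have "\<alpha> * \<beta> ^ nat (- n) = (\<alpha> * \<beta>) * \<beta> ^ nat (- (n + 1))" by (simp add: mult.assoc)
    then show ?thesis using False \<beta> by (cases "n = -1") (auto simp: unit_pow_simps[OF \<beta>])
  qed
qed

lemma unit_pow_add:
  fixes \<alpha> :: "'r::comm_ring_1"
  assumes "\<alpha> dvd 1"
  shows "unit_pow \<alpha> (m + n) = unit_pow \<alpha> m * unit_pow \<alpha> n"
proof (induction m rule: int_induct[of _ 0])
  case (step1 i)
  then show ?case using unit_pow_Suc[OF assms, of "i + n"] unit_pow_Suc[OF assms, of i]
    by (simp add: algebra_simps)
next
  case (step2 i)
  obtain \<beta> where \<beta>: "\<alpha> * \<beta> = 1" using assms by (metis dvdE)
  have "\<alpha> * unit_pow \<alpha> (i - 1 + n) = \<alpha> * (unit_pow \<alpha> (i - 1) * unit_pow \<alpha> n)"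
    using step2 unit_pow_Suc[OF assms, of "i - 1 + n"] unit_pow_Suc[OF assms, of "i - 1"]
    by (simp add: algebra_simps)
  then have "\<beta> * \<alpha> * unit_pow \<alpha> (i - 1 + n) = \<beta> * \<alpha> * (unit_pow \<alpha> (i - 1) * unit_pow \<alpha> n)"
    by (simp only: mult.assoc)
  then show ?case using \<beta> by (simp add: mult.commute)
qed simp

context quandle begin

lemma coloring_tri:
  assumes "coloring (\<lhd>) L C"
  shows "coloring (\<lhd>) L (\<lambda>A. C A \<lhd> c)"
  using assms self_distrib[symmetric] by (simp add: coloring_def)

text \<open>Right translation by \<open>c\<close> is an automorphism, hence so is its
  inverse.\<close>

lemma tri_inv_distrib: "(a \<lhd> b) \<unlhd> c = (a \<unlhd> c) \<lhd> (b \<unlhd> c)"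
  by (metis self_distrib tri_inv_tri tri_tri_inv)

lemma coloring_tri_inv:
  assumes "coloring (\<lhd>) L C"
  shows "coloring (\<lhd>) L (\<lambda>A. C A \<unlhd> c)"
  using assms by (simp add: coloring_def tri_inv_distrib)

text \<open>At a positive crossing of index i, the under-strand takes f from \<alpha>^(-i)
  \<omega>(a, c) to \<alpha>^(-i-1) \<omega>(a \<lhd> b, c) and the over-strand from \<alpha>^(-i-1)
  \<omega>(b, c) to \<alpha>^(-i) \<omega>(b, c). At a negative crossing both changes are reversed,
  which accounts for the sign.\<close>

lemma twisted_weight_tri:
  fixes smul :: "'r::comm_ring_1 \<Rightarrow> 'm::ab_group_add \<Rightarrow> 'm"
  assumes "module smul" "\<alpha> dvd 1" and cocycle: "twisted_cocycle (\<lhd>) smul \<alpha> \<omega>"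
    and "knot_diagram L" and col: "coloring (\<lhd>) L C"
  shows "twisted_weight smul \<omega> L (\<lambda>A. C A \<lhd> c) \<alpha> = smul \<alpha> (twisted_weight smul \<omega> L C \<alpha>)"
proof -
  interpret M: module smul by fact
  interpret link_diagram L by standard fact
  define \<phi> where "\<phi> k A = smul (unit_pow \<alpha> (- k)) (\<omega> (C A, c))" for k A
  define i where "i x = crossing_index L x" for x
  define u where "u x = unit_pow \<alpha> (- i x)" for x
  define s where "s x = (of_int (crossing_sign L x) :: 'r)" for x
  define a b where "a x = C (under_arc_right L x)" and "b x = C (over_arc L x)" for x
  define pos neg where "pos x = (of_bool (det2 (tangent L (fst x)) (tangent L (snd x)) > 0) :: int)"
    and "neg x = (of_bool (det2 (tangent L (fst x)) (tangent L (snd x)) < 0) :: int)" for x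
  define T where "T x = \<phi> (i x + pos x) (under_arc_out L x) - \<phi> (i x + neg x) (under_arc_in L x)
    + (\<phi> (i x + neg x) (over_arc L x) - \<phi> (i x + pos x) (over_arc L x))" for x
  \<comment> \<open>\<open>T x\<close> is the jump at \<open>x\<close>; the cocycle condition turns \<open>smul \<alpha> (T x)\<close> into the defect of the
    contribution of \<open>x\<close>.\<close>
  have sum_T: "(\<Sum>x\<in>crossings L. T x) = 0"
    unfolding T_def i_def pos_def neg_def by (rule crossing_telescope)
  have u: "\<alpha> * unit_pow \<alpha> (- i x - 1) = u x" for x
    using unit_pow_Suc[OF \<open>\<alpha> dvd 1\<close>, of "- i x - 1"] by (simp add: u_def)
  \<comment> \<open>The two cases are the positive and the negative crossing: \<open>v\<close> is
    \<alpha>^(-i), \<open>w\<close> is \<alpha>^(-i-1), and \<open>P\<close>, \<open>Q\<close>,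
    \<open>R\<close> are the values of \<omega>(_, c) at the left under-arc, the right under-arc and
    the over-arc.\<close>
  have alg: "smul \<alpha> (smul w P - smul v Q + (smul v R - smul w R)) = smul v (P - smul \<alpha> Q - smul (1 - \<alpha>) R)"
    "smul \<alpha> (smul v Q - smul w P + (smul w R - smul v R)) = smul (- v) (P - smul \<alpha> Q - smul (1 - \<alpha>) R)"
    if "\<alpha> * w = v" for v w P Q R
    by (simp_all add: that M.scale_right_distrib M.scale_right_diff_distrib M.scale_left_diff_distrib
        right_diff_distrib left_diff_distrib mult.commute[of v \<alpha>])
  have T: "smul \<alpha> (T x) = smul (s x * u x) (\<omega> (a x \<lhd> b x, c) - smul \<alpha> (\<omega> (a x, c)) - smul (1 - \<alpha>) (\<omega> (b x, c)))"
    if x: "x \<in> crossings L" for x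
  proof -
    have left: "C (under_arc_left L x) = a x \<lhd> b x"
      using col x by (simp add: coloring_def a_def b_def)
    consider "det2 (tangent L (fst x)) (tangent L (snd x)) > 0" | "det2 (tangent L (fst x)) (tangent L (snd x)) < 0"
      using crossing_tangents(1)[OF x] by linarith
    then show ?thesis
    proof cases
      case 1
      then have "C (under_arc_out L x) = a x \<lhd> b x" "C (under_arc_in L x) = a x"
        using left by (simp_all add: under_arc_left_def under_arc_right_def a_def)
      then show ?thesis using 1 alg(1)[OF u]
        by (simp add: T_def \<phi>_def pos_def neg_def s_def crossing_sign_def b_def[symmetric] u_def[symmetric])
    next
      case 2
      then have "C (under_arc_in L x) = a x \<lhd> b x" "C (under_arc_out L x) = a x"
        using left by (simp_all add: under_arc_left_def under_arc_right_def a_def)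
      then show ?thesis using 2 alg(2)[OF u]
        by (simp add: T_def \<phi>_def pos_def neg_def s_def crossing_sign_def b_def[symmetric] u_def[symmetric])
    qed
  qed
  have split: "\<omega> (p \<lhd> c, q \<lhd> c) = smul \<alpha> (\<omega> (p, q)) +
      (\<omega> (p \<lhd> q, c) - smul \<alpha> (\<omega> (p, c)) - smul (1 - \<alpha>) (\<omega> (q, c)))" for p q
    using cocycle unfolding twisted_cocycle_def by (simp add: algebra_simps)
  have "twisted_weight smul \<omega> L (\<lambda>A. C A \<lhd> c) \<alpha> =
      (\<Sum>x\<in>crossings L. smul (s x * u x) (\<omega> (a x \<lhd> c, b x \<lhd> c)))"
    by (simp add: twisted_weight_def s_def u_def i_def a_def b_def)
  also have "\<dots> = (\<Sum>x\<in>crossings L. smul \<alpha> (smul (s x * u x) (\<omega> (a x, b x))) + smul \<alpha> (T x))"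
  proof (rule sum.cong[OF refl])
    fix x assume x: "x \<in> crossings L"
    show "smul (s x * u x) (\<omega> (a x \<lhd> c, b x \<lhd> c)) =
        smul \<alpha> (smul (s x * u x) (\<omega> (a x, b x))) + smul \<alpha> (T x)"
      unfolding T[OF x] M.scale_left_commute[of \<alpha>] M.scale_right_distrib[symmetric] split[symmetric] ..
  qed
  also have "\<dots> = smul \<alpha> (\<Sum>x\<in>crossings L. smul (s x * u x) (\<omega> (a x, b x))) + smul \<alpha> (\<Sum>x\<in>crossings L. T x)"
    by (simp only: sum.distrib M.scale_sum_right)
  also have "\<dots> = smul \<alpha> (twisted_weight smul \<omega> L C \<alpha>)"
    by (simp add: sum_T twisted_weight_def s_def u_def i_def a_def b_def)
  finally show ?thesis .
qed

text \<open>\<open>foldl\<close> applies the first letter to the colouring before all others, so the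
  induction runs over arbitrary colourings.\<close>

lemma twisted_weight_foldl:
  fixes smul :: "'r::comm_ring_1 \<Rightarrow> 'm::ab_group_add \<Rightarrow> 'm"
  assumes "module smul" "\<alpha> dvd 1" "twisted_cocycle (\<lhd>) smul \<alpha> \<omega>" "knot_diagram L"
    and "coloring (\<lhd>) L C" "\<forall>(c, e)\<in>set ces. e = 1 \<or> e = -1"
  shows "twisted_weight smul \<omega> L (\<lambda>A. foldl (\<lambda>a (c, e). tri_pow (\<lhd>) (\<unlhd>) e a c) (C A) ces) \<alpha>
    = smul (unit_pow \<alpha> (\<Sum>(c, e)\<leftarrow>ces. e)) (twisted_weight smul \<omega> L C \<alpha>)"
  using assms(5,6)
proof (induction ces arbitrary: C)
  case Nil
  interpret module smul by fact
  show ?case by simp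
next
  case (Cons ce ces)
  interpret M: module smul by fact
  obtain c e where ce: "ce = (c, e)" by fastforce
  note tri = twisted_weight_tri[OF assms(1-4)]
  define C1 where "C1 A = tri_pow (\<lhd>) (\<unlhd>) e (C A) c" for A
  have "coloring (\<lhd>) L C1 \<and> twisted_weight smul \<omega> L C1 \<alpha> = smul (unit_pow \<alpha> e) (twisted_weight smul \<omega> L C \<alpha>)"
  proof (cases "e = 1")
    case True
    then have "C1 = (\<lambda>A. C A \<lhd> c)" by (simp add: C1_def tri_pow_def fun_eq_iff)
    then show ?thesis using True tri[OF Cons.prems(1), of c] coloring_tri[OF Cons.prems(1)] by simp
  next
    case False
    then have e: "e = -1" using Cons.prems(2) ce by auto
    have C1: "C1 = (\<lambda>A. C A \<unlhd> c)" using False by (simp add: C1_def tri_pow_def fun_eq_iff)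
    have col: "coloring (\<lhd>) L C1" unfolding C1 by (rule coloring_tri_inv[OF Cons.prems(1)])
    \<comment> \<open>For an inverse letter, \<open>C\<close> is the shift of \<open>C1\<close>; the
      formula for \<open>\<lhd>\<close> is applied to \<open>C1\<close> and solved for its weight by
      the inverse of \<alpha>.\<close>
    have "(\<lambda>A. C1 A \<lhd> c) = C" by (simp add: C1 tri_inv_tri)
    then have "twisted_weight smul \<omega> L C \<alpha> = smul \<alpha> (twisted_weight smul \<omega> L C1 \<alpha>)"
      using tri[OF col, of c] by simp
    moreover have "unit_pow \<alpha> (-1) * \<alpha> = 1"
      using unit_pow_add[OF assms(2), of "-1" 1] by simp
    ultimately show ?thesis using col e by simp
  qed
  then have col: "coloring (\<lhd>) L C1"
    and w: "twisted_weight smul \<omega> L C1 \<alpha> = smul (unit_pow \<alpha> e) (twisted_weight smul \<omega> L C \<alpha>)" by blast+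
  have "twisted_weight smul \<omega> L (\<lambda>A. foldl (\<lambda>a (c, e). tri_pow (\<lhd>) (\<unlhd>) e a c) (C1 A) ces) \<alpha>
    = smul (unit_pow \<alpha> (\<Sum>(c, e)\<leftarrow>ces. e)) (twisted_weight smul \<omega> L C1 \<alpha>)"
    using Cons.prems(2) by (intro Cons.IH[OF col]) auto
  then show ?case
    by (simp add: ce C1_def w unit_pow_add[OF assms(2)] mult.commute)
qed

end

theorem proposition4p6:
  fixes tri tri_inv :: "'q \<Rightarrow> 'q \<Rightarrow> 'q"
    and smul :: "'r::comm_ring_1 \<Rightarrow> 'm::ab_group_add \<Rightarrow> 'm"
    and \<alpha> :: 'r
    and ces :: "('q \<times> int) list"
    and \<omega> :: "'q \<times> 'q \<Rightarrow> 'm"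
    and L :: link
    and C :: "(complex \<times> real) set \<Rightarrow> 'q"
  assumes "quandle tri tri_inv"
    and "module smul"
    and "\<alpha> dvd 1"
    and "\<forall>(c, e)\<in>set ces. e = 1 \<or> e = -1"
    and "\<forall>a. foldl (\<lambda>a (c, e). tri_pow tri tri_inv e a c) a ces = a"
    and "twisted_cocycle tri smul \<alpha> \<omega>"
    and "knot_diagram L"
    and "coloring tri L C"
  shows "smul (unit_pow \<alpha> (\<Sum>(c, e)\<leftarrow>ces. e) - 1) (twisted_weight smul \<omega> L C \<alpha>) = 0"
proof -
  interpret module smul by fact
  have "smul (unit_pow \<alpha> (\<Sum>(c, e)\<leftarrow>ces. e)) (twisted_weight smul \<omega> L C \<alpha>) = twisted_weight smul \<omega> L C \<alpha>"
    using quandle.twisted_weight_foldl[OF assms(1-3,6-8,4), symmetric] by (simp only: assms(5)[rule_format])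
  then show ?thesis by (simp add: scale_left_diff_distrib)
qed

end
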